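(* Let $(M,d,\mathbf m)$ be a complete metric measure space with $\mathbf m$ a Radon measure, let $p\in[1,\infty]$, and let $\mathcal M$ be a locally finite dimensional $L^p(\mathbf m)$-normed module with dimensional decomposition $\{E_n\}_{n=0}^\infty\cup\{E_\infty\}$, $\mathbf m(E_\infty)=0$. Then $\mathcal M$ is isometric (as an $L^p(\mathbf m)$-normed module) to an $L^p$-product of vector-valued $L^p$-spaces: for each $n\ge 0$ there is a measurable map $E_n\ni x\mapsto |\cdot|_x\in \mathrm{Norm}(\mathbb R^n)$ such that $$\mathcal M\cong\bigoplus_{n=0}^{\infty}L^p(E_n,\mathbb R^n,|\cdot|).$$ If moreover the local dimension of $\mathcal M$ is bounded by some $N\in\mathbb N$, then $\mathcal M$ admits a uniformly equivalent norm coming from a pointwise norm $x\mapsto|\cdot|'_x$ (with $|\cdot|'$ and $|\cdot|$ uniformly equivalent $\mathbf m$-a.e.) such that $|\cdot|'_x$ is induced by a scalar product for $\mathbf m$-a.e. $x$. In particular, in this case $\mathcal M$ is (super-)reflexive if $p\in(1,\infty)$.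
   Context: An $L^p(\mathbf m)$-normed premodule is a Banach space $(\mathcal M,\|\cdot\|_{\mathcal M})$ with a bilinear map $L^\infty(\mathbf m)\times\mathcal M\to\mathcal M$, $(f,v)\mapsto f\cdot v$, and a map $|\cdot|:\mathcal M\to L^p(\mathbf m)$ (with non-negative values) such that $(fg)\cdot v=f\cdot(g\cdot v)$, $\mathbf 1\cdot v=v$, $\|v\|_{\mathcal M}=\||v|\|_{L^p(\mathbf m)}$ and $|f\cdot v|=|f||v|$ $\mathbf m$-a.e. It is an $L^p(\mathbf m)$-normed module if in addition: (Locality) if $\chi_{A_n}\cdot v=0$ for all $n\in\mathbb N$ then $\chi_{\cup_nA_n}\cdot v=0$; (Glueing) for sequences $(v_n)$ in $\mathcal M$ and Borel sets $(A_n)$ with $\chi_{A_i\cap A_j}\cdot v_i=\chi_{A_i\cap A_j}\cdot v_j$ and $\limsup_n\|\sum_{i=1}^n\chi_{A_i}\cdot v_i\|_{\mathcal M}<\infty$ there is $v\in\mathcal M$ with $\chi_{A_i}\cdot v=\chi_{A_i}\cdot v_i$ for all $i$ and $\|v\|_{\mathcal M}\le\liminf_n\|\sum_{i=1}^n\chi_{A_i}\cdot v_i\|_{\mathcal M}$. A finite set $\{v_1,\dots,v_k\}\subset\mathcal M$ is (locally) independent on a Borel set $A$ if $v\mapsto|v|_x$ is a norm on the span of $v_1,\dots,v_k$ for ($\mathbf m$-a.e.) $x\in A$; equivalently, $f_i\in L^\infty(\mathbf m)$ and $\chi_A\sum_i f_i v_i=0$ imply $f_i=0$ $\mathbf m$-a.e.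 on $A$. $\mathcal M$ is locally finite dimensional if there is a Borel partition $\{E_n\}_{n=0}^\infty\cup\{E_\infty\}$ of $M$ with $\mathbf m(E_\infty)=0$ such that for every Borel subset $E\subset E_n$ (of positive measure) every maximal independent set $\{v_i\}$ on $E$ with $\mathbf m(\{v_i\ne0\}\setminus E)=0$ has cardinality $n$. The local dimension at $x\in E_n$ is $n$, and it is bounded by $N$ if $\mathbf m(E_n)=0$ for $n>N$. $\mathrm{Norm}(\mathbb R^n)$ is the space of norms on $\mathbb R^n$ with the metric $d(F,F')=\sup_{v\ne0}\max\{\ln\frac{F(v)}{F'(v)},\ln\frac{F'(v)}{F(v)}\}$ (its topology is that of $C^0$ convergence). $L^p(E,\mathbb R^n,|\cdot|)$ is the space of measurable $v:E\to\mathbb R^n$ (mod a.e. equality) with $x\mapsto|v(x)|_x$ in $L^p(\mathbf m|_E)$, with that pointwise norm; it is trivial for $n=0$ or $\mathbf m(E)=0$. The $L^p$-product of countably many modules $\mathcal M_i$ consists of $v=\sum_iv_i$, $v_i\in\mathcal M_i$, with $|v|=(\sum_i|v_i|^p)^{1/p}$ ($\sup_i|v_i|$ if $p=\infty$) finite a.e. and in $L^p(\mathbf m)$. Isometries of modules are $L^\infty(\mathbf m)$-linear bijections preserving the pointwise norm. *)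

theory Defs
  imports "HOL-Analysis.Analysis" "HOL-Probability.Essential_Supremum"
begin

section \<open>Radon measures and Lebesgue spaces\<close>

text \<open>For Borel measures on metric spaces, local finiteness in this definition may be replaced by
  finiteness on compact sets.\<close>

definition Radon_measure :: "'a::metric_space measure \<Rightarrow> bool" where
  "Radon_measure m \<longleftrightarrow>
     sets m = sets borel \<and>
     (\<forall>x. \<exists>U. open U \<and> x \<in> U \<and> emeasure m U < \<infinity>) \<and>
     (\<forall>A \<in> sets borel. emeasure m A = (SUP K \<in> {K. compact K \<and> K \<subseteq> A}. emeasure m K))"

text \<open>Elements of $L^p(m)$ are given by representatives; equality of elements is equality almost
  everywhere, and every notion below respects it.\<close>

definition Lp_space :: "ennreal \<Rightarrow> 'a measure \<Rightarrow> ('a \<Rightarrow> real) set" where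
  "Lp_space p m = {f \<in> borel_measurable m.
     if p = \<infinity> then esssup m (\<lambda>x. ennreal \<bar>f x\<bar>) < \<infinity>
     else integrable m (\<lambda>x. \<bar>f x\<bar> powr enn2real p)}"

definition Lp_norm :: "ennreal \<Rightarrow> 'a measure \<Rightarrow> ('a \<Rightarrow> real) \<Rightarrow> real" where
  "Lp_norm p m f =
     (if p = \<infinity> then enn2real (esssup m (\<lambda>x. ennreal \<bar>f x\<bar>))
      else (\<integral>x. \<bar>f x\<bar> powr enn2real p \<partial>m) powr (1 / enn2real p))"

abbreviation Linf :: "'a measure \<Rightarrow> ('a \<Rightarrow> real) set" where
  "Linf m \<equiv> Lp_space \<infinity> m"


section \<open>Normed modules\<close>

definition Banach_norm :: "('v::real_vector \<Rightarrow> real) \<Rightarrow> bool" where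
  "Banach_norm nrm \<longleftrightarrow>
     (\<forall>v. 0 \<le> nrm v) \<and>
     (\<forall>v. nrm v = 0 \<longleftrightarrow> v = 0) \<and>
     (\<forall>c v. nrm (c *\<^sub>R v) = \<bar>c\<bar> * nrm v) \<and>
     (\<forall>v w. nrm (v + w) \<le> nrm v + nrm w) \<and>
     Metric_space.mcomplete UNIV (\<lambda>v w. nrm (v - w))"

lemma Banach_norm_norm: "Banach_norm (norm :: 'v::banach \<Rightarrow> real)"
proof -
  have "Met_TC.mcomplete TYPE('v)"
    by (simp add: mcomplete_iff_complete complete_UNIV)
  then show ?thesis
    by (simp add: Banach_norm_def norm_triangle_ineq dist_norm[abs_def])
qed

text \<open>The norm is a parameter because one vector space will carry two module structures; the
  multiplication \<open>act\<close> and the pointwise norm \<open>pn\<close> act on and return representatives.\<close>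

locale Lp_normed_premodule =
  fixes p :: ennreal
    and m :: "'a measure"
    and nrm :: "'v::real_vector \<Rightarrow> real"
    and act :: "('a \<Rightarrow> real) \<Rightarrow> 'v \<Rightarrow> 'v"
    and pn :: "'v \<Rightarrow> 'a \<Rightarrow> real"
  assumes banach: "Banach_norm nrm"
    and act_cong: "\<lbrakk>f \<in> Linf m; g \<in> Linf m; AE x in m. f x = g x\<rbrakk> \<Longrightarrow> act f v = act g v"
    and act_add_left: "\<lbrakk>f \<in> Linf m; g \<in> Linf m\<rbrakk> \<Longrightarrow> act (\<lambda>x. f x + g x) v = act f v + act g v"
    and act_scale_left: "f \<in> Linf m \<Longrightarrow> act (\<lambda>x. c * f x) v = c *\<^sub>R act f v"
    and act_add_right: "f \<in> Linf m \<Longrightarrow> act f (v + w) = act f v + act f w"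
    and act_scale_right: "f \<in> Linf m \<Longrightarrow> act f (c *\<^sub>R v) = c *\<^sub>R act f v"
    and act_mult: "\<lbrakk>f \<in> Linf m; g \<in> Linf m\<rbrakk> \<Longrightarrow> act (\<lambda>x. f x * g x) v = act f (act g v)"
    and act_one: "act (\<lambda>x. 1) v = v"
    and pn_Lp: "pn v \<in> Lp_space p m"
    and pn_nonneg: "AE x in m. 0 \<le> pn v x"
    and nrm_eq: "nrm v = Lp_norm p m (pn v)"
    and pn_act: "f \<in> Linf m \<Longrightarrow> AE x in m. pn (act f v) x = \<bar>f x\<bar> * pn v x"

locale Lp_normed_module = Lp_normed_premodule p m nrm act pn
  for p :: ennreal
    and m :: "'a measure"
    and nrm :: "'v::real_vector \<Rightarrow> real"
    and act :: "('a \<Rightarrow> real) \<Rightarrow> 'v \<Rightarrow> 'v"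
    and pn :: "'v \<Rightarrow> 'a \<Rightarrow> real" +
  assumes locality:
      "\<And>v A. \<lbrakk>\<And>n::nat. A n \<in> sets m; \<And>n. act (indicator (A n)) v = 0\<rbrakk>
        \<Longrightarrow> act (indicator (\<Union>n. A n)) v = 0"
    and glueing:
      "\<And>(w :: nat \<Rightarrow> 'v) A.
        \<lbrakk>\<And>n. A n \<in> sets m;
         \<And>i j. act (indicator (A i \<inter> A j)) (w i) = act (indicator (A i \<inter> A j)) (w j);
         limsup (\<lambda>n. ereal (nrm (\<Sum>i<n. act (indicator (A i)) (w i)))) < \<infinity>\<rbrakk>
        \<Longrightarrow> \<exists>v. (\<forall>i. act (indicator (A i)) v = act (indicator (A i)) (w i)) \<and>
                ereal (nrm v) \<le> liminf (\<lambda>n. ereal (nrm (\<Sum>i<n. act (indicator (A i)) (w i))))"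


section \<open>Local dimension\<close>

text \<open>An infinite set is independent when all its finite subsets are. Admitting infinite sets is
  essential: in a module of infinite local dimension no finite independent set need be maximal, and
  a condition on finite maximal sets only would hold vacuously.\<close>

definition locally_independent ::
    "'a measure \<Rightarrow> (('a \<Rightarrow> real) \<Rightarrow> 'v::real_vector \<Rightarrow> 'v) \<Rightarrow> 'a set \<Rightarrow> 'v set \<Rightarrow> bool" where
  "locally_independent m act A V \<longleftrightarrow>
     (\<forall>S f. finite S \<and> S \<subseteq> V \<and> (\<forall>v\<in>S. f v \<in> Linf m) \<and>
        act (indicator A) (\<Sum>v\<in>S. act (f v) v) = 0 \<longrightarrow>
        (\<forall>v\<in>S. AE x in m. x \<in> A \<longrightarrow> f v x = 0))"

definition maximal_locally_independent ::
    "'a measure \<Rightarrow> (('a \<Rightarrow> real) \<Rightarrow> 'v::real_vector \<Rightarrow> 'v) \<Rightarrow> 'a set \<Rightarrow> 'v set \<Rightarrow> bool" where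
  "maximal_locally_independent m act A V \<longleftrightarrow>
     locally_independent m act A V \<and>
     (\<forall>W. V \<subseteq> W \<and> locally_independent m act A W \<longrightarrow> W = V)"

definition dimensional_decomposition ::
    "'a measure \<Rightarrow> (('a \<Rightarrow> real) \<Rightarrow> 'v::real_vector \<Rightarrow> 'v) \<Rightarrow> ('v \<Rightarrow> 'a \<Rightarrow> real) \<Rightarrow>
      (nat \<Rightarrow> 'a set) \<Rightarrow> 'a set \<Rightarrow> bool" where
  "dimensional_decomposition m act pn E Einf \<longleftrightarrow>
     (\<forall>n. E n \<in> sets m) \<and> Einf \<in> sets m \<and>
     disjoint_family E \<and> (\<Union>n. E n) \<inter> Einf = {} \<and> (\<Union>n. E n) \<union> Einf = space m \<and>
     emeasure m Einf = 0 \<and>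
     (\<forall>n. \<forall>A \<in> sets m. A \<subseteq> E n \<and> emeasure m A > 0 \<longrightarrow>
        (\<forall>V. maximal_locally_independent m act A V \<and>
             (\<forall>v\<in>V. AE x in m. x \<notin> A \<longrightarrow> pn v x = 0) \<longrightarrow>
             finite V \<and> card V = n))"


section \<open>The space of norms\<close>

text \<open>Since the dimension varies with the point, $\mathbb{R}^n$ is the set of all sequences
  vanishing from index \<open>n\<close> on.\<close>

abbreviation Rn :: "nat \<Rightarrow> (nat \<Rightarrow> real) set" where
  "Rn n \<equiv> topspace (Euclidean_space n)"

definition Norms :: "nat \<Rightarrow> ((nat \<Rightarrow> real) \<Rightarrow> real) set" where
  "Norms n = {F \<in> extensional (Rn n).
     (\<forall>a \<in> Rn n. 0 \<le> F a \<and> (F a = 0 \<longleftrightarrow> a = (\<lambda>i. 0))) \<and>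
     (\<forall>c. \<forall>a \<in> Rn n. F (\<lambda>i. c * a i) = \<bar>c\<bar> * F a) \<and>
     (\<forall>a \<in> Rn n. \<forall>b \<in> Rn n. F (\<lambda>i. a i + b i) \<le> F a + F b)}"

text \<open>Inserting \<open>0\<close> only matters for \<open>n = 0\<close>, where the supremum ranges over the empty set; the
  value outside \<^term>\<open>Norms n\<close> is chosen because \<^locale>\<open>Metric_space\<close> asks for nonnegativity
  there, too.\<close>

definition Norms_dist ::
    "nat \<Rightarrow> ((nat \<Rightarrow> real) \<Rightarrow> real) \<Rightarrow> ((nat \<Rightarrow> real) \<Rightarrow> real) \<Rightarrow> real" where
  "Norms_dist n F G =
     (if F \<in> Norms n \<and> G \<in> Norms n
      then Sup (insert 0 ((\<lambda>a. max (ln (F a / G a)) (ln (G a / F a))) ` (Rn n - {\<lambda>i. 0})))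
      else 0)"

lemma Norms_equivalent:
  assumes F: "F \<in> Norms n" and G: "G \<in> Norms n"
  shows "\<exists>C>0. \<forall>a \<in> Rn n. F a \<le> C * G a"
proof -
  define s where "s a = (\<Sum>i<n. \<bar>a i\<bar>)" for a :: "nat \<Rightarrow> real"
  define e where "e i = (\<lambda>j::nat. if j = i then 1 else 0::real)" for i :: nat
  have upper: "H a \<le> (\<Sum>i<n. H (e i)) * s a" if H: "H \<in> Norms n" and a: "a \<in> Rn n" for H a
  proof -
    have e_Rn: "(\<lambda>j. c * e i j) \<in> Rn n" if "i < n" for i c
      using that by (auto simp: e_def topspace_Euclidean_space)
    have e_Rn1: "e i \<in> Rn n" if "i < n" for i
      using that by (auto simp: e_def topspace_Euclidean_space)
    have part: "H (\<lambda>j. if j < k then a j else 0) \<le> (\<Sum>i<k. \<bar>a i\<bar> * H (e i))" if "k \<le> n" for k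
      using that
    proof (induction k)
      case 0
      have "(\<lambda>i. 0) \<in> Rn n" by (simp add: topspace_Euclidean_space)
      then have "H (\<lambda>i. 0) = 0" using H by (auto simp: Norms_def)
      then show ?case by simp
    next
      case (Suc k)
      let ?b = "\<lambda>j. if j < k then a j else 0"
      have b: "?b \<in> Rn n" using Suc.prems by (auto simp: topspace_Euclidean_space)
      have "(\<lambda>j. if j < Suc k then a j else 0) = (\<lambda>j. ?b j + a k * e k j)"
        by (auto simp: e_def less_Suc_eq)
      then have "H (\<lambda>j. if j < Suc k then a j else 0) \<le> H ?b + H (\<lambda>j. a k * e k j)"
        using H b e_Rn[of k "a k"] Suc.prems by (simp add: Norms_def)
      also have "H (\<lambda>j. a k * e k j) = \<bar>a k\<bar> * H (e k)"
        using H e_Rn1[of k] Suc.prems by (simp add: Norms_def)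
      finally show ?case using Suc by simp
    qed
    have "(\<lambda>j. if j < n then a j else 0) = a"
      using a by (auto simp: topspace_Euclidean_space)
    then have "H a \<le> (\<Sum>i<n. \<bar>a i\<bar> * H (e i))" using part[of n] by simp
    also have "\<dots> \<le> (\<Sum>i<n. \<bar>a i\<bar> * (\<Sum>i<n. H (e i)))"
    proof (intro sum_mono mult_left_mono)
      fix i assume i: "i \<in> {..<n}"
      show "H (e i) \<le> (\<Sum>i<n. H (e i))"
        using H e_Rn1 i by (intro member_le_sum) (auto simp: Norms_def)
    qed auto
    also have "\<dots> = (\<Sum>i<n. H (e i)) * s a" by (simp add: s_def sum_distrib_right[symmetric] mult.commute)
    finally show ?thesis .
  qed
  define K where "K = Rn n \<inter> {a. s a = 1}"
  have s_pos: "0 < s a" if a: "a \<in> Rn n" and nz: "a \<noteq> (\<lambda>i. 0)" for a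
  proof -
    obtain i where "a i \<noteq> 0" using nz by auto
    moreover have "i < n" using a \<open>a i \<noteq> 0\<close> by (auto simp: topspace_Euclidean_space not_less[symmetric])
    ultimately have "0 < \<bar>a i\<bar>" "\<bar>a i\<bar> \<le> s a"
      by (auto simp: s_def intro: member_le_sum)
    then show ?thesis by linarith
  qed
  have scont: "continuous_on UNIV s"
    unfolding s_def by (intro continuous_intros continuous_on_product_coordinates)
  have "\<exists>c>0. \<forall>a \<in> K. c \<le> G a"
  proof (cases "K = {}")
    case True then show ?thesis by (intro exI[of _ 1]) auto
  next
    case False
    have "compact (PiE (UNIV :: nat set) (\<lambda>i. {-1..1::real}))"
      using compactin_PiE[of "\<lambda>i. euclidean" "UNIV :: nat set" "\<lambda>i. {-1..1::real}"]
      by (simp add: euclidean_product_topology)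
    moreover have "closed K"
    proof -
      have "closed {a. s a = 1}"
        using continuous_closed_preimage_constant[OF scont closed_UNIV, of 1] by simp
      moreover have "Rn n = (\<Inter>i\<in>{n..}. {a. a i = 0})"
        by (auto simp: topspace_Euclidean_space)
      moreover have "closed {a :: nat \<Rightarrow> real. a i = 0}" for i
        using continuous_closed_preimage_constant[OF continuous_on_product_coordinates closed_UNIV, of i "0::real"]
        by simp
      ultimately show ?thesis unfolding K_def by (auto intro!: closed_Int closed_INT)
    qed
    moreover have "K \<subseteq> PiE UNIV (\<lambda>i. {-1..1::real})"
    proof
      fix a assume a: "a \<in> K"
      have "\<bar>a i\<bar> \<le> 1" for i
      proof (cases "i < n")
        case True
        then have "\<bar>a i\<bar> \<le> s a" by (auto simp: s_def intro: member_le_sum)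
        then show ?thesis using a by (simp add: K_def)
      next
        case False then show ?thesis using a by (simp add: K_def topspace_Euclidean_space)
      qed
      then show "a \<in> PiE UNIV (\<lambda>i. {-1..1::real})" by (auto simp: abs_le_iff minus_le_iff)
    qed
    ultimately have "compact K"
      by (metis compact_Int_closed inf.absorb_iff2)
    moreover have "continuous_on K G"
    proof -
      have diff: "\<bar>G a - G b\<bar> \<le> (\<Sum>i<n. G (e i)) * s (\<lambda>i. a i - b i)" if "a \<in> Rn n" "b \<in> Rn n" for a b
      proof -
        have le: "G a - G b \<le> (\<Sum>i<n. G (e i)) * s (\<lambda>i. a i - b i)" if "a \<in> Rn n" "b \<in> Rn n" for a b
        proof -
          have tri: "\<forall>a \<in> Rn n. \<forall>b \<in> Rn n. G (\<lambda>i. a i + b i) \<le> G a + G b"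
            using G by (simp add: Norms_def)
          have d: "(\<lambda>i. a i - b i) \<in> Rn n" using that by (auto simp: topspace_Euclidean_space)
          have "G (\<lambda>i. (a i - b i) + b i) \<le> G (\<lambda>i. a i - b i) + G b"
            using bspec[OF bspec[OF tri d] that(2)] .
          then show ?thesis using upper[OF G d] by simp
        qed
        have "s (\<lambda>i. b i - a i) = s (\<lambda>i. a i - b i)" by (simp add: s_def abs_minus_commute)
        then show ?thesis using le[OF that] le[OF that(2,1)] by (simp add: abs_le_iff)
      qed
      show ?thesis
        unfolding continuous_on_def
      proof
        fix a assume a: "a \<in> K"
        have "continuous_on K (\<lambda>b. (\<Sum>i<n. G (e i)) * s (\<lambda>i. b i - a i))"
          unfolding s_def
          by (intro continuous_intros continuous_on_subset[OF continuous_on_product_coordinates]) auto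
        then have "((\<lambda>b. (\<Sum>i<n. G (e i)) * s (\<lambda>i. b i - a i)) \<longlongrightarrow>
            (\<Sum>i<n. G (e i)) * s (\<lambda>i. a i - a i)) (at a within K)"
          using a unfolding continuous_on_def by (rule bspec)
        then have lim: "((\<lambda>b. (\<Sum>i<n. G (e i)) * s (\<lambda>i. b i - a i)) \<longlongrightarrow> 0) (at a within K)"
          by (simp add: s_def)
        have "((\<lambda>b. G b - G a) \<longlongrightarrow> 0) (at a within K)"
          by (rule Lim_null_comparison[OF _ lim])
            (use diff a in \<open>auto simp: eventually_at_filter K_def\<close>)
        then show "(G \<longlongrightarrow> G a) (at a within K)" by (simp add: Lim_null[symmetric])
      qed
    qed
    ultimately obtain b where b: "b \<in> K" "\<And>a. a \<in> K \<Longrightarrow> G b \<le> G a"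
      using continuous_attains_inf[of K G] False by blast
    have "b \<noteq> (\<lambda>i. 0)" using b(1) by (auto simp: K_def s_def)
    then have "0 < G b" using G b(1) by (auto simp: K_def Norms_def less_le)
    then show ?thesis using b(2) by blast
  qed
  then obtain c where c: "c > 0" "\<And>a. a \<in> K \<Longrightarrow> c \<le> G a" by blast
  define C where "C = (\<Sum>i<n. F (e i)) / c + 1"
  have sumF: "0 \<le> (\<Sum>i<n. F (e i))"
    using F by (intro sum_nonneg) (auto simp: Norms_def e_def topspace_Euclidean_space)
  have "F a \<le> C * G a" if a: "a \<in> Rn n" for a
  proof (cases "a = (\<lambda>i. 0)")
    case True
    then have "F a = 0" "G a = 0" using F G a by (simp_all add: Norms_def)
    then show ?thesis by simp
  next
    case False
    have sa: "0 < s a" by (rule s_pos[OF a False])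
    have "(\<lambda>i. inverse (s a) * a i) \<in> K"
    proof -
      have "s (\<lambda>i. inverse (s a) * a i) = inverse (s a) * s a"
        using sa by (subst (1 3) s_def) (simp add: abs_mult sum_distrib_left)
      then show ?thesis using sa a by (auto simp: K_def topspace_Euclidean_space)
    qed
    from c(2)[OF this] have "c \<le> inverse (s a) * G a" using G a sa by (simp add: Norms_def)
    then have "c * s a \<le> G a" using sa by (simp add: field_simps)
    then have "s a \<le> G a / c" using c(1) by (simp add: field_simps)
    then have "(\<Sum>i<n. F (e i)) * s a \<le> (\<Sum>i<n. F (e i)) * (G a / c)"
      using sumF by (rule mult_left_mono)
    moreover have "0 \<le> G a" using G a by (simp add: Norms_def)
    ultimately show ?thesis using upper[OF F a] by (simp add: C_def algebra_simps)
  qed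
  moreover have "C > 0" using sumF c(1) by (simp add: C_def add_nonneg_pos)
  ultimately show ?thesis by blast
qed

lemma Norms_pos: "\<lbrakk>F \<in> Norms n; a \<in> Rn n; a \<noteq> (\<lambda>i. 0)\<rbrakk> \<Longrightarrow> 0 < F a"
  by (auto simp: Norms_def less_le)

lemma Norms_dist_bdd:
  assumes F: "F \<in> Norms n" and G: "G \<in> Norms n"
  shows "bdd_above (insert 0 ((\<lambda>a. max (ln (F a / G a)) (ln (G a / F a))) ` (Rn n - {\<lambda>i. 0})))"
proof -
  obtain C D where C: "C > 0" "\<And>a. a \<in> Rn n \<Longrightarrow> F a \<le> C * G a"
    and D: "D > 0" "\<And>a. a \<in> Rn n \<Longrightarrow> G a \<le> D * F a"
    using Norms_equivalent[OF F G] Norms_equivalent[OF G F] by metis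
  have "max (ln (F a / G a)) (ln (G a / F a)) \<le> max (ln C) (ln D)"
    if "a \<in> Rn n - {\<lambda>i. 0}" for a
  proof -
    have "0 < F a" "0 < G a" using that Norms_pos F G by auto
    then have "ln (F a / G a) \<le> ln C" "ln (G a / F a) \<le> ln D"
      using C D that by (auto simp: field_simps)
    then show ?thesis by linarith
  qed
  then have "bdd_above ((\<lambda>a. max (ln (F a / G a)) (ln (G a / F a))) ` (Rn n - {\<lambda>i. 0}))"
    by (intro bdd_aboveI2)
  then show ?thesis by simp
qed

lemma Norms_dist_upper:
  assumes "F \<in> Norms n" "G \<in> Norms n" "a \<in> Rn n" "a \<noteq> (\<lambda>i. 0)"
  shows "\<bar>ln (F a) - ln (G a)\<bar> \<le> Norms_dist n F G"
proof -
  have "max (ln (F a / G a)) (ln (G a / F a)) \<le> Norms_dist n F G"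
    unfolding Norms_dist_def if_P[OF conjI[OF assms(1,2)]]
    by (rule cSup_upper[OF _ Norms_dist_bdd[OF assms(1,2)]]) (use assms in blast)
  moreover have "0 < F a" "0 < G a" using assms Norms_pos by auto
  ultimately show ?thesis by (simp add: ln_div abs_le_iff)
qed

lemma Norms_dist_nonneg: "0 \<le> Norms_dist n F G"
  using Norms_dist_bdd[of F n G] by (auto simp: Norms_dist_def intro!: cSup_upper)

lemma Norms_dist_least:
  assumes "F \<in> Norms n" "G \<in> Norms n" "0 \<le> r"
    and "\<And>a. \<lbrakk>a \<in> Rn n; a \<noteq> (\<lambda>i. 0)\<rbrakk> \<Longrightarrow> \<bar>ln (F a) - ln (G a)\<bar> \<le> r"
  shows "Norms_dist n F G \<le> r"
proof -
  have "max (ln (F a / G a)) (ln (G a / F a)) \<le> r" if "a \<in> Rn n" "a \<noteq> (\<lambda>i. 0)" for a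
    using assms(4)[OF that] Norms_pos[of _ n a] that assms(1,2) by (simp add: ln_div abs_le_iff)
  then show ?thesis
    unfolding Norms_dist_def if_P[OF conjI[OF assms(1,2)]]
    by (intro cSup_least) (use assms(3) in blast)+
qed

lemma Metric_space_Norms: "Metric_space (Norms n) (Norms_dist n)"
proof
  show "0 \<le> Norms_dist n F G" for F G by (rule Norms_dist_nonneg)
  show "Norms_dist n F G = Norms_dist n G F" for F G
    by (simp add: Norms_dist_def max.commute conj_commute)
  show "Norms_dist n F G = 0 \<longleftrightarrow> F = G" if F: "F \<in> Norms n" and G: "G \<in> Norms n" for F G
  proof
    assume 0: "Norms_dist n F G = 0"
    have "F a = G a" if a: "a \<in> Rn n" for a
    proof (cases "a = (\<lambda>i. 0)")
      case True then show ?thesis using F G a by (auto simp: Norms_def)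
    next
      case False
      then show ?thesis
        using Norms_dist_upper[OF F G a False] 0 Norms_pos[of _ n a] F G a by simp
    qed
    then show "F = G" using F G by (auto simp: Norms_def intro: extensionalityI)
  next
    assume "F = G"
    then show "Norms_dist n F G = 0"
      using Norms_dist_least[of F n F 0] F Norms_dist_nonneg[of n F F] by simp
  qed
  show "Norms_dist n F H \<le> Norms_dist n F G + Norms_dist n G H"
    if "F \<in> Norms n" "G \<in> Norms n" "H \<in> Norms n" for F G H
  proof (rule Norms_dist_least)
    fix a assume a: "a \<in> Rn n" "a \<noteq> (\<lambda>i. 0)"
    show "\<bar>ln (F a) - ln (H a)\<bar> \<le> Norms_dist n F G + Norms_dist n G H"
      using Norms_dist_upper[OF that(1,2) a] Norms_dist_upper[OF that(2,3) a] by linarith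
  qed (use that Norms_dist_nonneg[of n F G] Norms_dist_nonneg[of n G H] in auto)
qed

definition Norms_borel :: "nat \<Rightarrow> ((nat \<Rightarrow> real) \<Rightarrow> real) measure" where
  "Norms_borel n =
     sigma (Norms n) {U. openin (Metric_space.mtopology (Norms n) (Norms_dist n)) U}"

definition norm_from_scalar_product :: "nat \<Rightarrow> ((nat \<Rightarrow> real) \<Rightarrow> real) \<Rightarrow> bool" where
  "norm_from_scalar_product n F \<longleftrightarrow>
     (\<exists>B :: (nat \<Rightarrow> real) \<Rightarrow> (nat \<Rightarrow> real) \<Rightarrow> real.
        (\<forall>a \<in> Rn n. \<forall>b \<in> Rn n. B a b = B b a) \<and>
        (\<forall>a \<in> Rn n. \<forall>b \<in> Rn n. \<forall>c \<in> Rn n. B (\<lambda>i. a i + b i) c = B a c + B b c) \<and>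
        (\<forall>t. \<forall>a \<in> Rn n. \<forall>b \<in> Rn n. B (\<lambda>i. t * a i) b = t * B a b) \<and>
        (\<forall>a \<in> Rn n. a \<noteq> (\<lambda>i. 0) \<longrightarrow> 0 < B a a) \<and>
        (\<forall>a \<in> Rn n. F a = sqrt (B a a)))"


section \<open>Products of vector-valued Lebesgue spaces\<close>

definition vector_Lp ::
    "ennreal \<Rightarrow> 'a measure \<Rightarrow> 'a set \<Rightarrow> nat \<Rightarrow> ('a \<Rightarrow> (nat \<Rightarrow> real) \<Rightarrow> real) \<Rightarrow> ('a \<Rightarrow> nat \<Rightarrow> real) set"
  where
  "vector_Lp p m E n F = {u.
     (\<forall>x\<in>E. u x \<in> Rn n) \<and>
     (\<forall>i<n. (\<lambda>x. u x i) \<in> borel_measurable (restrict_space m E)) \<and>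
     (\<lambda>x. F x (u x)) \<in> Lp_space p (restrict_space m E)}"

text \<open>Modules over subsets are modules over the whole space through extension by zero.\<close>

definition vector_Lp_pn ::
    "'a set \<Rightarrow> ('a \<Rightarrow> (nat \<Rightarrow> real) \<Rightarrow> real) \<Rightarrow> ('a \<Rightarrow> nat \<Rightarrow> real) \<Rightarrow> 'a \<Rightarrow> real" where
  "vector_Lp_pn E F u x = (if x \<in> E then F x (u x) else 0)"

definition lp_finite :: "ennreal \<Rightarrow> (nat \<Rightarrow> real) \<Rightarrow> bool" where
  "lp_finite p a \<longleftrightarrow>
     (if p = \<infinity> then bdd_above (range a) else summable (\<lambda>n. a n powr enn2real p))"

definition lp_sum :: "ennreal \<Rightarrow> (nat \<Rightarrow> real) \<Rightarrow> real" where
  "lp_sum p a =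
     (if p = \<infinity> then (SUP n. a n) else (\<Sum>n. a n powr enn2real p) powr (1 / enn2real p))"

definition Lp_product_pn ::
    "ennreal \<Rightarrow> (nat \<Rightarrow> 'a set) \<Rightarrow> (nat \<Rightarrow> 'a \<Rightarrow> (nat \<Rightarrow> real) \<Rightarrow> real) \<Rightarrow>
      (nat \<Rightarrow> 'a \<Rightarrow> nat \<Rightarrow> real) \<Rightarrow> 'a \<Rightarrow> real" where
  "Lp_product_pn p E F u x = lp_sum p (\<lambda>n. vector_Lp_pn (E n) (F n) (u n) x)"

text \<open>The $L^p$-product over all \<open>n\<close> of the spaces $L^p(E_n, \mathbb{R}^n, F_n)$, first on the level
  of representatives and then modulo equality almost everywhere on each \<open>E n\<close>.\<close>

definition Lp_product_reps ::
    "ennreal \<Rightarrow> 'a measure \<Rightarrow> (nat \<Rightarrow> 'a set) \<Rightarrow> (nat \<Rightarrow> 'a \<Rightarrow> (nat \<Rightarrow> real) \<Rightarrow> real) \<Rightarrow>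
      (nat \<Rightarrow> 'a \<Rightarrow> nat \<Rightarrow> real) set" where
  "Lp_product_reps p m E F = {u.
     (\<forall>n. u n \<in> vector_Lp p m (E n) n (F n)) \<and>
     (AE x in m. lp_finite p (\<lambda>n. vector_Lp_pn (E n) (F n) (u n) x)) \<and>
     Lp_product_pn p E F u \<in> Lp_space p m}"

definition Lp_product ::
    "ennreal \<Rightarrow> 'a measure \<Rightarrow> (nat \<Rightarrow> 'a set) \<Rightarrow> (nat \<Rightarrow> 'a \<Rightarrow> (nat \<Rightarrow> real) \<Rightarrow> real) \<Rightarrow>
      (nat \<Rightarrow> 'a \<Rightarrow> nat \<Rightarrow> real) set set" where
  "Lp_product p m E F =
     Lp_product_reps p m E F //
       {(u, w). u \<in> Lp_product_reps p m E F \<and> w \<in> Lp_product_reps p m E F \<and>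
                (\<forall>n. AE x in m. x \<in> E n \<longrightarrow> u n x = w n x)}"

definition Lp_product_isometry ::
    "ennreal \<Rightarrow> 'a measure \<Rightarrow> (('a \<Rightarrow> real) \<Rightarrow> 'v::real_vector \<Rightarrow> 'v) \<Rightarrow> ('v \<Rightarrow> 'a \<Rightarrow> real) \<Rightarrow>
      (nat \<Rightarrow> 'a set) \<Rightarrow> (nat \<Rightarrow> 'a \<Rightarrow> (nat \<Rightarrow> real) \<Rightarrow> real) \<Rightarrow>
      ('v \<Rightarrow> (nat \<Rightarrow> 'a \<Rightarrow> nat \<Rightarrow> real) set) \<Rightarrow> bool" where
  "Lp_product_isometry p m act pn E F T \<longleftrightarrow>
     bij_betw T UNIV (Lp_product p m E F) \<and>
     (\<forall>v w. \<forall>u \<in> T v. \<forall>u' \<in> T w. (\<lambda>n x i. u n x i + u' n x i) \<in> T (v + w)) \<and>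
     (\<forall>f \<in> Linf m. \<forall>v. \<forall>u \<in> T v. (\<lambda>n x i. f x * u n x i) \<in> T (act f v)) \<and>
     (\<forall>v. \<forall>u \<in> T v. AE x in m. pn v x = Lp_product_pn p E F u x)"


section \<open>Reflexivity\<close>

definition reflexive_space :: "'v::banach itself \<Rightarrow> bool" where
  "reflexive_space _ \<longleftrightarrow>
     (\<forall>\<phi> :: ('v \<Rightarrow>\<^sub>L real) \<Rightarrow>\<^sub>L real. \<exists>v. \<forall>f. blinfun_apply \<phi> f = blinfun_apply f v)"

text \<open>\<open>finitely_representable TYPE('w) TYPE('v)\<close>: every finite dimensional subspace of \<open>'w\<close> embeds
  into \<open>'v\<close> with distortion arbitrarily close to one. The linear map may be taken on all of \<open>'w\<close>,
  since linear maps extend from subspaces.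
  A Banach space \<open>'v\<close> is super-reflexive if every Banach space \<open>'w\<close> finitely representable in it
  is reflexive. As HOL has no quantification over types inside formulas, that property is
  expressed with a free type variable \<open>'w\<close>.\<close>

definition finitely_representable :: "'w::banach itself \<Rightarrow> 'v::banach itself \<Rightarrow> bool" where
  "finitely_representable _ _ \<longleftrightarrow>
     (\<forall>B :: 'w set. \<forall>\<epsilon>>0. finite B \<longrightarrow>
        (\<exists>T :: 'w \<Rightarrow> 'v. linear T \<and>
           (\<forall>y \<in> span B. norm y \<le> norm (T y) \<and> norm (T y) \<le> (1 + \<epsilon>) * norm y)))"

end

theory Submission
  imports Defs
begin

text \<open>Let \<open>b\<^sub>1, \<dots>, b\<^sub>k\<close> be independent on a set. The distance of \<open>b\<^sub>k\<close> to the span of its predecessors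
  cannot vanish on a part of positive measure: almost best rational combinations would converge
  to measurable coefficients, which are bounded on a smaller set and give a dependence there. So an
  independent set of \<open>n\<close> elements on \<open>E n\<close>, which exists by Zorn's lemma, is a basis of the span at almost every
  point. For the same reason every module element has measurable coordinates in this basis on all
  of \<open>E n\<close>; since the coordinates are pointwise limits, no exhaustion and no \<open>\<sigma>\<close>-finiteness is involved.
  Conversely, glueing produces an element with given coordinates.

  A measurable Gram-Schmidt procedure replaces the pointwise norms by Euclidean ones, with constants
  depending on the dimension only. For \<open>1 < p < \<infinity>\<close> the new norm is uniformly convex, so high dyadic trees in a
  ball, all of whose siblings are separated, do not exist. This property passes to finitely representable
  spaces, and it implies reflexivity, because trees can be built from points approximating an element
  of the bidual.\<close>

text \<open>Pointwise statements hold only outside null sets that depend on the elements involved,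
  and the module axioms bound sums only through \<open>nrm\<close>: even the triangle inequality at
  almost every point has to be extracted from the global one. Therefore linear combinations are
  formed with rational coefficients, which involves countably many null sets, and real coefficients
  are reached through continuity of norms on \<open>Rn n\<close>. A second obstacle is that
  coordinates are in general unbounded, while only bounded functions act on the module. So
  \<open>represents\<close> describes coordinates by distances to rational combinations rather than
  by a sum, and bounded pieces appear only where an actual element is needed. Gram-Schmidt is
  preferred to optimal ellipsoids because its choices are least indices subject to countably many
  conditions, so measurability is visible; the resulting constant \<open>2 * 3 ^ n - 1\<close> is
  crude, but depends on \<open>n\<close> alone. Trees are adapted to the last claim because they
  consist of finitely many points: finite representability transports them, and an equivalent norm
  changes only their separation.\<close>

declare infinity_ennreal_def [simp del]

section \<open>Lebesgue spaces\<close>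

lemma Lp_space_measurable [measurable_dest]: "f \<in> Lp_space p m \<Longrightarrow> f \<in> borel_measurable m"
  by (simp add: Lp_space_def)

lemma enn2real_ge_1: "\<lbrakk>1 \<le> p; p \<noteq> \<infinity>\<rbrakk> \<Longrightarrow> 1 \<le> enn2real p"
  using enn2real_mono[of 1 p] by (simp add: less_top infinity_ennreal_def)

lemma Linf_iff: "f \<in> Linf m \<longleftrightarrow> f \<in> borel_measurable m \<and> (\<exists>c. AE x in m. \<bar>f x\<bar> \<le> c)"
proof (intro iffI conjI)
  assume f: "f \<in> Linf m"
  then show meas: "f \<in> borel_measurable m" by (simp add: Lp_space_def)
  define e where "e = esssup m (\<lambda>x. ennreal \<bar>f x\<bar>)"
  have fin: "e < top" using f by (simp add: Lp_space_def e_def infinity_ennreal_def)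
  have "AE x in m. ennreal \<bar>f x\<bar> \<le> e"
    unfolding e_def by (rule esssup_AE)
  then have "AE x in m. \<bar>f x\<bar> \<le> enn2real e"
  proof eventually_elim
    case (elim x)
    then have "ennreal \<bar>f x\<bar> \<le> ennreal (enn2real e)" using fin by simp
    then show ?case by (simp del: ennreal_enn2real)
  qed
  then show "\<exists>c. AE x in m. \<bar>f x\<bar> \<le> c" by blast
next
  assume "f \<in> borel_measurable m \<and> (\<exists>c. AE x in m. \<bar>f x\<bar> \<le> c)"
  then obtain c where f: "f \<in> borel_measurable m" and c: "AE x in m. \<bar>f x\<bar> \<le> c" by blast
  have "esssup m (\<lambda>x. ennreal \<bar>f x\<bar>) \<le> ennreal c"
    by (rule esssup_I) (use f c in \<open>auto simp: ennreal_leI elim: AE_mp\<close>)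
  then show "f \<in> Linf m" using f le_less_trans[OF _ ennreal_less_top] by (auto simp: Lp_space_def infinity_ennreal_def)
qed

text \<open>With \<open>0 \<le> c\<close> the equivalence survives the null measure, for which every
  bound holds almost everywhere while the norm is 0.\<close>

lemma Linf_norm_le:
  assumes f: "f \<in> Linf m" and c: "0 \<le> c"
  shows "Lp_norm \<infinity> m f \<le> c \<longleftrightarrow> (AE x in m. \<bar>f x\<bar> \<le> c)"
proof -
  define e where "e = esssup m (\<lambda>x. ennreal \<bar>f x\<bar>)"
  have fin: "e < top" and [measurable]: "f \<in> borel_measurable m"
    using f by (auto simp: Lp_space_def e_def infinity_ennreal_def)
  have AE: "AE x in m. ennreal \<bar>f x\<bar> \<le> e"
    unfolding e_def by (rule esssup_AE)
  \<comment> \<open>\<open>enn2real\<close> sends infinity to 0, so finiteness of \<open>e\<close>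
    has to enter here.\<close>
  have "enn2real e \<le> c \<longleftrightarrow> e \<le> ennreal c"
    using fin c by (metis enn2real_leI ennreal_enn2real ennreal_le_iff)
  also have "\<dots> \<longleftrightarrow> (AE x in m. ennreal \<bar>f x\<bar> \<le> ennreal c)"
  proof
    assume "e \<le> ennreal c"
    with AE show "AE x in m. ennreal \<bar>f x\<bar> \<le> ennreal c"
      by (auto elim!: AE_mp intro: order_trans)
  next
    assume "AE x in m. ennreal \<bar>f x\<bar> \<le> ennreal c"
    then show "e \<le> ennreal c" unfolding e_def by (intro esssup_I) auto
  qed
  also have "\<dots> \<longleftrightarrow> (AE x in m. \<bar>f x\<bar> \<le> c)" using c by simp
  finally show ?thesis by (simp add: Lp_norm_def e_def)
qed

lemma Lp_norm_nonneg: "0 \<le> Lp_norm p m f"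
  by (simp add: Lp_norm_def)

lemma Lp_norm_le_iff:
  assumes "1 \<le> p" "p \<noteq> \<infinity>" "0 \<le> c"
  shows "Lp_norm p m f \<le> c \<longleftrightarrow> (\<integral>x. \<bar>f x\<bar> powr enn2real p \<partial>m) \<le> c powr enn2real p"
proof -
  let ?I = "\<integral>x. \<bar>f x\<bar> powr enn2real p \<partial>m"
  have q: "1 \<le> enn2real p" using assms enn2real_ge_1 by blast
  have I: "0 \<le> ?I" by simp
  have eq: "(?I powr (1 / enn2real p)) powr enn2real p = ?I"
    using q I by (simp add: powr_powr)
  show ?thesis
  proof
    assume "Lp_norm p m f \<le> c"
    then have "(?I powr (1 / enn2real p)) powr enn2real p \<le> c powr enn2real p"
      using assms q by (intro powr_mono2) (auto simp: Lp_norm_def)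
    then show "?I \<le> c powr enn2real p" unfolding eq .
  next
    assume "?I \<le> c powr enn2real p"
    then have "?I powr (1 / enn2real p) \<le> (c powr enn2real p) powr (1 / enn2real p)"
      using q I by (intro powr_mono2) auto
    then show "Lp_norm p m f \<le> c" using assms q by (simp add: Lp_norm_def powr_powr)
  qed
qed

lemma Lp_norm_powr:
  assumes "1 \<le> p" "p \<noteq> \<infinity>"
  shows "Lp_norm p m f powr enn2real p = (\<integral>x. \<bar>f x\<bar> powr enn2real p \<partial>m)"
  using enn2real_ge_1[OF assms] assms by (simp add: Lp_norm_def powr_powr)

lemma Lp_dominated:
  assumes g: "g \<in> Lp_space p m" and f [measurable]: "f \<in> borel_measurable m"
    and le: "AE x in m. \<bar>f x\<bar> \<le> \<bar>g x\<bar>"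
  shows "f \<in> Lp_space p m"
proof (cases "p = \<infinity>")
  case True
  from g obtain c where c: "AE x in m. \<bar>g x\<bar> \<le> c" unfolding True by (auto simp: Linf_iff)
  from c le have "AE x in m. \<bar>f x\<bar> \<le> c" by (auto elim!: AE_mp)
  then show ?thesis unfolding True Linf_iff using f by blast
next
  case False
  from g False have "integrable m (\<lambda>x. \<bar>g x\<bar> powr enn2real p)" by (simp add: Lp_space_def)
  then have "integrable m (\<lambda>x. \<bar>f x\<bar> powr enn2real p)"
    by (rule Bochner_Integration.integrable_bound) (use le in \<open>auto elim!: AE_mp intro!: powr_mono2\<close>)
  then show ?thesis using False f by (simp add: Lp_space_def)
qed

lemma Lp_norm_mono:
  assumes p: "1 \<le> p" and g: "g \<in> Lp_space p m" and f: "f \<in> borel_measurable m"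
    and le: "AE x in m. \<bar>f x\<bar> \<le> \<bar>g x\<bar>"
  shows "Lp_norm p m f \<le> Lp_norm p m g"
proof -
  have f': "f \<in> Lp_space p m" by (rule Lp_dominated[OF g f le])
  show ?thesis
  proof (cases "p = \<infinity>")
    case True
    have "AE x in m. \<bar>g x\<bar> \<le> Lp_norm \<infinity> m g"
      using Linf_norm_le[OF g[unfolded True] Lp_norm_nonneg] by blast
    then have "AE x in m. \<bar>f x\<bar> \<le> Lp_norm \<infinity> m g" using le by (auto elim!: AE_mp)
    then show ?thesis using Linf_norm_le[OF f'[unfolded True] Lp_norm_nonneg] True by blast
  next
    case False
    have "(\<integral>x. \<bar>f x\<bar> powr enn2real p \<partial>m) \<le> (\<integral>x. \<bar>g x\<bar> powr enn2real p \<partial>m)"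
      using f' g False le by (intro integral_mono_AE) (auto simp: Lp_space_def elim!: AE_mp intro!: powr_mono2)
    then show ?thesis using Lp_norm_le_iff[OF p False Lp_norm_nonneg] Lp_norm_powr[OF p False] by metis
  qed
qed

lemma Lp_norm_cong:
  assumes p: "1 \<le> p" and g: "g \<in> Lp_space p m" and f: "f \<in> borel_measurable m"
    and eq: "AE x in m. \<bar>f x\<bar> = \<bar>g x\<bar>"
  shows "Lp_norm p m f = Lp_norm p m g"
proof (rule antisym)
  have f': "f \<in> Lp_space p m" by (rule Lp_dominated[OF g f]) (use eq in \<open>auto elim!: AE_mp\<close>)
  show "Lp_norm p m f \<le> Lp_norm p m g"
    by (rule Lp_norm_mono[OF p g f]) (use eq in \<open>auto elim!: AE_mp\<close>)
  show "Lp_norm p m g \<le> Lp_norm p m f"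
    by (rule Lp_norm_mono[OF p f' Lp_space_measurable[OF g]]) (use eq in \<open>auto elim!: AE_mp\<close>)
qed

lemma Lp_scale:
  assumes f: "f \<in> Lp_space p m"
  shows "(\<lambda>x. c * f x) \<in> Lp_space p m"
proof (cases "p = \<infinity>")
  case True
  from f obtain d where "f \<in> borel_measurable m" "AE x in m. \<bar>f x\<bar> \<le> d" unfolding True by (auto simp: Linf_iff)
  moreover from this(2) have "AE x in m. \<bar>c * f x\<bar> \<le> \<bar>c\<bar> * d"
    by (auto elim!: AE_mp simp: abs_mult intro!: mult_left_mono)
  ultimately show ?thesis unfolding True Linf_iff by (auto intro: borel_measurable_times)
next
  case False
  then show ?thesis using f by (auto simp: Lp_space_def abs_mult powr_mult)
qed

lemma Lp_norm_scale_le: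
  assumes p: "1 \<le> p" and f: "f \<in> Lp_space p m"
  shows "Lp_norm p m (\<lambda>x. c * f x) \<le> \<bar>c\<bar> * Lp_norm p m f"
proof (cases "p = \<infinity>")
  case True
  have "AE x in m. \<bar>f x\<bar> \<le> Lp_norm \<infinity> m f"
    using Linf_norm_le[OF f[unfolded True] Lp_norm_nonneg] by blast
  then have "AE x in m. \<bar>c * f x\<bar> \<le> \<bar>c\<bar> * Lp_norm \<infinity> m f"
    by (auto elim!: AE_mp simp: abs_mult intro!: mult_left_mono)
  then show ?thesis
    using Linf_norm_le[OF Lp_scale[OF f[unfolded True]], of "\<bar>c\<bar> * Lp_norm \<infinity> m f" c]
      Lp_norm_nonneg[of \<infinity> m f] unfolding True by simp
next
  case False
  show ?thesis
    using Lp_norm_nonneg[of p m f] p False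
    by (subst Lp_norm_le_iff) (auto simp: abs_mult powr_mult Lp_norm_powr)
qed

lemma Lp_norm_scale:
  assumes p: "1 \<le> p" and f: "f \<in> Lp_space p m"
  shows "Lp_norm p m (\<lambda>x. c * f x) = \<bar>c\<bar> * Lp_norm p m f"
proof (rule antisym[OF Lp_norm_scale_le[OF p f]])
  show "\<bar>c\<bar> * Lp_norm p m f \<le> Lp_norm p m (\<lambda>x. c * f x)"
  proof (cases "c = 0")
    case True then show ?thesis using Lp_norm_nonneg by simp
  next
    case False
    then show ?thesis using Lp_norm_scale_le[OF p Lp_scale[OF f, of c], of "1/c"]
      by (simp add: field_simps)
  qed
qed

lemma Lp_norm_eq_0_iff:
  assumes p: "1 \<le> p" and f: "f \<in> Lp_space p m"
  shows "Lp_norm p m f = 0 \<longleftrightarrow> (AE x in m. f x = 0)"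
proof (cases "p = \<infinity>")
  case True
  have "Lp_norm p m f = 0 \<longleftrightarrow> Lp_norm p m f \<le> 0" using Lp_norm_nonneg[of p m f] by linarith
  then show ?thesis using Linf_norm_le[OF f[unfolded True], of 0] True by simp
next
  case False
  have "Lp_norm p m f = 0 \<longleftrightarrow> (\<integral>x. \<bar>f x\<bar> powr enn2real p \<partial>m) = 0"
    using False by (simp add: Lp_norm_def)
  also have "\<dots> \<longleftrightarrow> (AE x in m. \<bar>f x\<bar> powr enn2real p = 0)"
    using f False by (intro integral_nonneg_eq_0_iff_AE) (auto simp: Lp_space_def)
  finally show ?thesis by simp
qed

text \<open>On the positive half-line this is convexity of the power; if one of the numbers is 0, it
  reduces to \<open>r powr q \<le> r\<close> on [0,1].\<close>

lemma powr_convex_combination: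
  fixes a b s t q :: real
  assumes "0 \<le> a" "0 \<le> b" "0 \<le> s" "0 \<le> t" "s + t = 1" "1 \<le> q"
  shows "(s * a + t * b) powr q \<le> s * a powr q + t * b powr q"
proof -
  have s: "s = 1 - t" using assms by simp
  have le: "r powr q \<le> r" if "0 \<le> r" "r \<le> 1" for r
    using powr_mono'[of 1 q r] that assms(6) by (cases "r = 0") auto
  consider "a = 0" | "b = 0" | "0 < a" "0 < b" using assms by force
  then show ?thesis
  proof cases
    case 1
    then show ?thesis using le[of t] assms by (simp add: powr_mult mult_right_mono)
  next
    case 2
    then show ?thesis using le[of s] assms by (simp add: powr_mult mult_right_mono)
  next
    case 3
    then show ?thesis
      using convex_onD[OF powr_convex[OF assms(6)], of t a b] assms unfolding s by simp
  qed
qed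

text \<open>Minkowski's inequality by convexity, without conjugate exponents: for upper bounds a, b
  of the two norms, |f| + |g| is a + b times the convex combination of |f| / a and |g| / b with
  weights a / (a + b) and b / (a + b). Positive bounds instead of the norms themselves keep the
  denominators away from 0; letting them decrease to the norms gives the claim.\<close>

lemma Lp_add:
  assumes p: "1 \<le> p" and f: "f \<in> Lp_space p m" and g: "g \<in> Lp_space p m"
  shows "(\<lambda>x. f x + g x) \<in> Lp_space p m"
    and "Lp_norm p m (\<lambda>x. f x + g x) \<le> Lp_norm p m f + Lp_norm p m g"
proof -
  have [measurable]: "f \<in> borel_measurable m" "g \<in> borel_measurable m" using f g by (auto simp: Lp_space_def)
  have *: "(\<lambda>x. f x + g x) \<in> Lp_space p m \<and> Lp_norm p m (\<lambda>x. f x + g x) \<le> a + b"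
    if a: "Lp_norm p m f \<le> a" "0 < a" and b: "Lp_norm p m g \<le> b" "0 < b" for a b
  proof (cases "p = \<infinity>")
    case True
    have "AE x in m. \<bar>f x\<bar> \<le> a" "AE x in m. \<bar>g x\<bar> \<le> b"
      using Linf_norm_le[of f m a] Linf_norm_le[of g m b] a b f g True by auto
    then have ae: "AE x in m. \<bar>f x + g x\<bar> \<le> a + b" by eventually_elim linarith
    then have "(\<lambda>x. f x + g x) \<in> Linf m" by (auto simp: Linf_iff)
    with ae a b True show ?thesis using Linf_norm_le[of "\<lambda>x. f x + g x" m "a + b"] by auto
  next
    case False
    define q where "q = enn2real p"
    have q: "1 \<le> q" using enn2real_ge_1[OF p False] by (simp add: q_def)
    have F: "integrable m (\<lambda>x. \<bar>f x\<bar> powr q)" and G: "integrable m (\<lambda>x. \<bar>g x\<bar> powr q)"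
      using f g False by (auto simp: Lp_space_def q_def)
    define h where "h x = (a + b) powr q * (a / (a + b) * (\<bar>f x\<bar> powr q / a powr q) + b / (a + b) * (\<bar>g x\<bar> powr q / b powr q))" for x
    have h: "\<bar>f x + g x\<bar> powr q \<le> h x" for x
    proof -
      have "\<bar>f x + g x\<bar> powr q \<le> (\<bar>f x\<bar> + \<bar>g x\<bar>) powr q" using q by (intro powr_mono2) auto
      also have "\<bar>f x\<bar> + \<bar>g x\<bar> = (a + b) * (a / (a + b) * (\<bar>f x\<bar> / a) + b / (a + b) * (\<bar>g x\<bar> / b))"
      proof -
        have "a / (a + b) * (\<bar>f x\<bar> / a) + b / (a + b) * (\<bar>g x\<bar> / b) = (\<bar>f x\<bar> + \<bar>g x\<bar>) / (a + b)"
          using a b by (simp add: add_divide_distrib)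
        then show ?thesis using a b by simp
      qed
      also have "\<dots> powr q = (a + b) powr q * (a / (a + b) * (\<bar>f x\<bar> / a) + b / (a + b) * (\<bar>g x\<bar> / b)) powr q"
        using a b by (simp add: powr_mult)
      also have "\<dots> \<le> (a + b) powr q * (a / (a + b) * (\<bar>f x\<bar> / a) powr q + b / (a + b) * (\<bar>g x\<bar> / b) powr q)"
        using a b q by (intro mult_left_mono powr_convex_combination) (auto simp: add_divide_distrib[symmetric])
      also have "\<dots> = h x" using a b by (simp add: h_def powr_divide)
      finally show ?thesis .
    qed
    have hi: "integrable m h" unfolding h_def using F G by auto
    have int: "integrable m (\<lambda>x. \<bar>f x + g x\<bar> powr q)"
      by (rule Bochner_Integration.integrable_bound[OF hi])
        (simp_all add: order_trans[OF h abs_ge_self])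
    have "(\<integral>x. \<bar>f x + g x\<bar> powr q \<partial>m) \<le> (\<integral>x. h x \<partial>m)"
      by (rule integral_mono[OF int hi]) (rule h)
    also have "\<dots> = (a + b) powr q * (a / (a + b) * ((\<integral>x. \<bar>f x\<bar> powr q \<partial>m) / a powr q) + b / (a + b) * ((\<integral>x. \<bar>g x\<bar> powr q \<partial>m) / b powr q))"
      unfolding h_def using F G by simp
    also have "\<dots> \<le> (a + b) powr q * (a / (a + b) * 1 + b / (a + b) * 1)"
    proof (intro mult_left_mono add_mono)
      show "(\<integral>x. \<bar>f x\<bar> powr q \<partial>m) / a powr q \<le> 1"
        using Lp_norm_le_iff[OF p False, of a m f] a by (simp add: q_def)
      show "(\<integral>x. \<bar>g x\<bar> powr q \<partial>m) / b powr q \<le> 1"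
        using Lp_norm_le_iff[OF p False, of b m g] b by (simp add: q_def)
    qed (use a b in auto)
    also have "\<dots> = (a + b) powr q" using a b by (simp add: add_divide_distrib[symmetric])
    finally have "Lp_norm p m (\<lambda>x. f x + g x) \<le> a + b"
      using Lp_norm_le_iff[OF p False, of "a + b" m "\<lambda>x. f x + g x"] a b by (simp add: q_def)
    with int False show ?thesis by (simp add: Lp_space_def q_def)
  qed
  have pos: "0 < Lp_norm p m f' + e" if "0 < e" for e f' using Lp_norm_nonneg[of p m f'] that by linarith
  show "(\<lambda>x. f x + g x) \<in> Lp_space p m"
    using *[of "Lp_norm p m f + 1" "Lp_norm p m g + 1"] pos[of 1] by auto
  show "Lp_norm p m (\<lambda>x. f x + g x) \<le> Lp_norm p m f + Lp_norm p m g"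
  proof (rule field_le_epsilon)
    fix e :: real assume "0 < e"
    then show "Lp_norm p m (\<lambda>x. f x + g x) \<le> Lp_norm p m f + Lp_norm p m g + e"
      using *[of "Lp_norm p m f + e/2" "Lp_norm p m g + e/2"] pos[of "e/2"] by auto
  qed
qed

text \<open>Monotone convergence of the p-th powers, or a countable union of null sets if the
  exponent is infinite; membership of \<open>h\<close> in the space is part of the conclusion. This
  supplies the lower semicontinuity that glueing demands of the Euclidean norm.\<close>

lemma Lp_norm_increasing_sets:
  assumes p: "1 \<le> p" and h [measurable]: "h \<in> borel_measurable m"
    and B [measurable]: "\<And>n. B n \<in> sets m" and inc: "incseq B"
    and supp: "AE x in m. x \<notin> (\<Union>n. B n) \<longrightarrow> h x = 0"
    and Lp: "\<And>n. (\<lambda>x. indicator (B n) x * h x) \<in> Lp_space p m"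
    and c: "\<And>n. Lp_norm p m (\<lambda>x. indicator (B n) x * h x) \<le> c"
  shows "h \<in> Lp_space p m" and "Lp_norm p m h \<le> c"
proof -
  have c0: "0 \<le> c" using c[of 0] Lp_norm_nonneg[of p m "\<lambda>x. indicator (B 0) x * h x"] by linarith
  have "h \<in> Lp_space p m \<and> Lp_norm p m h \<le> c"
  proof (cases "p = \<infinity>")
    case True
    have "AE x in m. \<bar>indicator (B n) x * h x\<bar> \<le> c" for n
      using Linf_norm_le[of "\<lambda>x. indicator (B n) x * h x" m c] Lp[of n] c[of n] c0 True by auto
    then have "AE x in m. \<forall>n. \<bar>indicator (B n) x * h x\<bar> \<le> c" by (simp add: AE_all_countable)
    with supp have "AE x in m. \<bar>h x\<bar> \<le> c"
    proof eventually_elim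
      case (elim x)
      show ?case
      proof (cases "\<exists>n. x \<in> B n")
        case True
        then obtain n where "x \<in> B n" by blast
        then show ?thesis using elim(2)[rule_format, of n] by simp
      qed (use elim c0 in auto)
    qed
    then show ?thesis using True Linf_norm_le[of h m c] c0 h by (auto simp: Linf_iff)
  next
    case False
    define q where "q = enn2real p"
    have q: "1 \<le> q" using enn2real_ge_1[OF p False] by (simp add: q_def)
    let ?f = "\<lambda>n x. \<bar>indicator (B n) x * h x\<bar> powr q"
    have int: "integrable m (?f n)" for n using Lp[of n] False by (simp add: Lp_space_def q_def)
    have bnd: "(\<integral>x. ?f n x \<partial>m) \<le> c powr q" for n
      unfolding q_def by (rule iffD1[OF Lp_norm_le_iff[OF p False c0] c])
    have incx: "x \<in> B n \<Longrightarrow> n \<le> k \<Longrightarrow> x \<in> B k" for x n k using inc by (auto simp: incseq_def)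
    have f_mono: "?f n x \<le> ?f k x" if "n \<le> k" for n k x
      using incx[of x n k] that by (cases "x \<in> B n") auto
    have mono: "incseq (\<lambda>n. (\<integral>x. ?f n x \<partial>m))"
      unfolding incseq_def by (intro allI impI integral_mono[OF int int] f_mono)
    obtain L where L: "(\<lambda>n. (\<integral>x. ?f n x \<partial>m)) \<longlonglongrightarrow> L"
      using incseq_convergent[OF mono, of "c powr q"] bnd by metis
    have lim: "AE x in m. (\<lambda>n. ?f n x) \<longlonglongrightarrow> \<bar>h x\<bar> powr q"
      using supp
    proof eventually_elim
      case (elim x)
      show ?case
      proof (cases "\<exists>n. x \<in> B n")
        case True
        then obtain n where n: "x \<in> B n" by blast
        show ?thesis
          by (rule tendsto_eventually)
            (use incx[OF n] in \<open>simp add: eventually_sequentially, intro exI[of _ n], simp\<close>)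
      qed (use elim in auto)
    qed
    have monoAE: "AE x in m. mono (\<lambda>n. ?f n x)"
      unfolding mono_def using f_mono by auto
    have hm: "(\<lambda>x. \<bar>h x\<bar> powr q) \<in> borel_measurable m" by simp
    have "integrable m (\<lambda>x. \<bar>h x\<bar> powr q)" "(\<integral>x. \<bar>h x\<bar> powr q \<partial>m) = L"
      using integrable_monotone_convergence[OF int monoAE lim L hm]
        integral_monotone_convergence[OF int monoAE lim L hm] by auto
    moreover have "L \<le> c powr q" by (rule LIMSEQ_le_const2[OF L]) (use bnd in blast)
    ultimately show ?thesis
      using Lp_norm_le_iff[OF p False c0, of m h] False by (simp add: Lp_space_def q_def)
  qed
  then show "h \<in> Lp_space p m" "Lp_norm p m h \<le> c" by auto
qed

lemma Linf_const [simp]: "(\<lambda>x. c) \<in> Linf m"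
  by (auto simp: Linf_iff)

lemma Linf_indicator [simp]: "A \<in> sets m \<Longrightarrow> indicator A \<in> Linf m"
  unfolding Linf_iff by (auto intro!: exI[of _ 1] simp: indicator_def)

lemma Linf_add: "\<lbrakk>f \<in> Linf m; g \<in> Linf m\<rbrakk> \<Longrightarrow> (\<lambda>x. f x + g x) \<in> Linf m"
  by (rule Lp_add) (auto simp: infinity_ennreal_def)

lemma Linf_sum: "(\<And>i. i \<in> I \<Longrightarrow> f i \<in> Linf m) \<Longrightarrow> (\<lambda>x. \<Sum>i\<in>I. f i x) \<in> Linf m"
  by (induction I rule: infinite_finite_induct) (auto intro: Linf_add)

section \<open>Pointwise norms\<close>

text \<open>The premodule axioms leave the exponent arbitrary; from here on \<open>Lp_norm\<close>
  satisfies the triangle inequality.\<close>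

locale premodule_ge_1 = Lp_normed_premodule p m nrm act pn
  for p :: ennreal
    and m :: "'a measure"
    and nrm :: "'v::real_vector \<Rightarrow> real"
    and act :: "('a \<Rightarrow> real) \<Rightarrow> 'v \<Rightarrow> 'v"
    and pn :: "'v \<Rightarrow> 'a \<Rightarrow> real" +
  assumes p: "1 \<le> p"
begin

lemma pn_measurable [measurable]: "pn v \<in> borel_measurable m"
  using pn_Lp by (rule Lp_space_measurable)

lemma nrm_triangle: "nrm (v + w) \<le> nrm v + nrm w"
  using banach by (simp add: Banach_norm_def)

lemma nrm_eq_0_iff: "nrm v = 0 \<longleftrightarrow> v = 0"
  using banach by (simp add: Banach_norm_def)

lemma act_const: "act (\<lambda>x. c) v = c *\<^sub>R v"
  using act_scale_left[of "\<lambda>x. 1" c v] by (simp add: act_one)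

lemma act_zero_right [simp]: "f \<in> Linf m \<Longrightarrow> act f 0 = 0"
  using act_scale_right[of f 0 0] by simp

lemma act_diff_right: "f \<in> Linf m \<Longrightarrow> act f (v - w) = act f v - act f w"
  using act_add_right[of f v "- 1 *\<^sub>R w"] act_scale_right[of f "- 1" w] by simp

lemma act_sum_right: "f \<in> Linf m \<Longrightarrow> act f (\<Sum>i\<in>I. v i) = (\<Sum>i\<in>I. act f (v i))"
  by (induction I rule: infinite_finite_induct) (auto simp: act_add_right)

lemma act_commute: "\<lbrakk>f \<in> Linf m; g \<in> Linf m\<rbrakk> \<Longrightarrow> act f (act g v) = act g (act f v)"
  by (simp add: act_mult[symmetric] mult.commute)

lemma act_sum_left:
  "(\<And>i. i \<in> I \<Longrightarrow> f i \<in> Linf m) \<Longrightarrow> act (\<lambda>x. \<Sum>i\<in>I. f i x) v = (\<Sum>i\<in>I. act (f i) v)"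
proof (induction I rule: infinite_finite_induct)
  case (insert i I)
  then show ?case by (simp add: act_add_left Linf_sum)
qed (simp_all add: act_const)

lemma pn_scale: "AE x in m. pn (c *\<^sub>R v) x = \<bar>c\<bar> * pn v x"
  using pn_act[of "\<lambda>x. c" v] by (simp add: act_const)

lemma eq_0_iff_pn: "v = 0 \<longleftrightarrow> (AE x in m. pn v x = 0)"
  using nrm_eq_0_iff[of v] Lp_norm_eq_0_iff[OF p pn_Lp, of v] by (simp add: nrm_eq)

lemma pn_zero: "AE x in m. pn 0 x = 0"
  using eq_0_iff_pn[of 0] by simp

text \<open>The dictionary between equations with truncated elements, in which independence,
  locality and glueing are phrased, and the vanishing of pointwise norms.\<close>

lemma act_indicator_eq_0_iff:
  assumes "A \<in> sets m"
  shows "act (indicator A) v = 0 \<longleftrightarrow> (AE x in m. x \<in> A \<longrightarrow> pn v x = 0)"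
proof -
  have "(AE x in m. pn (act (indicator A) v) x = 0) \<longleftrightarrow> (AE x in m. x \<in> A \<longrightarrow> pn v x = 0)"
  proof (rule eventually_subst)
    show "AE x in m. (pn (act (indicator A) v) x = 0) = (x \<in> A \<longrightarrow> pn v x = 0)"
      using pn_act[OF Linf_indicator[OF assms], of v] by eventually_elim (auto simp: indicator_def)
  qed
  then show ?thesis unfolding eq_0_iff_pn[of "act (indicator A) v"] .
qed

lemma pn_indicator: 
  assumes "A \<in> sets m"
  shows "AE x in m. pn (act (indicator A) v) x = indicator A x * pn v x"
  using pn_act[OF Linf_indicator[OF assms], of v] by simp

text \<open>Truncate to the set \<open>A\<close> where the inequality fails by a definite amount.
  There \<open>c\<close> is a lower bound for the pointwise norm of the sum, so the indicator of
  \<open>A\<close> lies in the Lebesgue space even if nothing is known about the measure of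
  \<open>A\<close>, and the triangle inequality for \<open>nrm\<close> gives c |1| \<le> (a + b) |1|
  for its norm |1|, which must therefore be 0.\<close>

lemma pn_triangle_sets:
  assumes "0 \<le> a" "0 \<le> b" "a + b < c"
  shows "AE x in m. \<not> (pn v x \<le> a \<and> pn w x \<le> b \<and> c \<le> pn (v + w) x)"
proof -
  define A where "A = {x \<in> space m. pn v x \<le> a \<and> pn w x \<le> b \<and> c \<le> pn (v + w) x}"
  have A [measurable]: "A \<in> sets m" unfolding A_def by measurable
  have cA: "AE x in m. \<bar>c * indicator A x\<bar> \<le> \<bar>pn (act (indicator A) (v + w)) x\<bar>"
    using pn_indicator[OF A, of "v + w"]
    by eventually_elim (use assms in \<open>auto simp: A_def indicator_def\<close>)
  have "(\<lambda>x. c * indicator A x) \<in> Lp_space p m"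
    by (rule Lp_dominated[OF pn_Lp _ cA]) simp
  from Lp_scale[OF this, of "1 / c"] have LA: "indicator A \<in> Lp_space p m" 
    using assms by simp
  have le: "nrm (act (indicator A) u) \<le> d * Lp_norm p m (indicator A)"
    if "0 \<le> d" "\<And>x. x \<in> A \<Longrightarrow> pn u x \<le> d" for u d
  proof -
    have "AE x in m. \<bar>pn (act (indicator A) u) x\<bar> \<le> \<bar>d * indicator A x\<bar>"
      using pn_indicator[OF A, of u] pn_nonneg[of u]
      by eventually_elim (use that in \<open>auto simp: indicator_def\<close>)
    from Lp_norm_mono[OF p Lp_scale[OF LA] pn_measurable this]
    show ?thesis using Lp_norm_scale[OF p LA, of d] that(1) by (simp add: nrm_eq)
  qed
  have "c * Lp_norm p m (indicator A) = Lp_norm p m (\<lambda>x. c * indicator A x)"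
    using Lp_norm_scale[OF p LA, of c] assms by simp
  also have "\<dots> \<le> nrm (act (indicator A) (v + w))"
    using Lp_norm_mono[OF p pn_Lp _ cA] by (simp add: nrm_eq)
  also have "\<dots> \<le> nrm (act (indicator A) v) + nrm (act (indicator A) w)"
    by (simp add: act_add_right nrm_triangle)
  also have "\<dots> \<le> a * Lp_norm p m (indicator A) + b * Lp_norm p m (indicator A)"
    using assms by (intro add_mono le) (auto simp: A_def)
  finally have "0 \<le> (a + b - c) * Lp_norm p m (indicator A)" by (simp add: algebra_simps)
  moreover have "a + b - c < 0" using assms by simp
  ultimately have "Lp_norm p m (indicator A) = 0"
    using Lp_norm_nonneg[of p m "indicator A"] by (simp add: zero_le_mult_iff)
  then have "AE x in m. indicator A x = (0::real)" using Lp_norm_eq_0_iff[OF p LA] by simp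
  with AE_space show ?thesis by eventually_elim (auto simp: A_def indicator_def)
qed

text \<open>Every violation is witnessed by rational \<open>a\<close>, \<open>b\<close>,
  \<open>c\<close> with \<open>a + b < c\<close>, so the exceptional set is a countable union of
  null sets of the previous kind.\<close>

lemma pn_triangle: "AE x in m. pn (v + w) x \<le> pn v x + pn w x"
proof -
  let ?P = "\<lambda>a b c x. 0 \<le> a \<and> 0 \<le> b \<and> a + b < c \<longrightarrow> \<not> (pn v x \<le> a \<and> pn w x \<le> b \<and> c \<le> pn (v + w) x)"
  have "AE x in m. ?P (of_rat a) (of_rat b) (of_rat c) x" for a b c :: rat
    using pn_triangle_sets[of "of_rat a" "of_rat b" "of_rat c" v w] by (auto simp: AE_conj_iff)
  then have "AE x in m. \<forall>a b c :: rat. ?P (of_rat a) (of_rat b) (of_rat c) x"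
    by (simp add: AE_all_countable)
  with pn_nonneg[of v] pn_nonneg[of w] show ?thesis
  proof eventually_elim
    case (elim x)
    show ?case
    proof (rule ccontr)
      assume "\<not> ?thesis"
      then have lt: "0 < pn (v + w) x - (pn v x + pn w x)" by simp
      \<comment> \<open>A third of the gap leaves room for \<open>a\<close> and \<open>b\<close>
        above the two norms and for \<open>c\<close> between \<open>a + b\<close> and the norm of
        the sum.\<close>
      define e where "e = (pn (v + w) x - (pn v x + pn w x)) / 3"
      have e: "0 < e" using lt by (simp add: e_def)
      have e': "pn (v + w) x = pn v x + pn w x + 3 * e" 
      proof -
        have "3 * e = pn (v + w) x - (pn v x + pn w x)" unfolding e_def by simp
        then show ?thesis by simp
      qed
      obtain a b c where a: "pn v x < of_rat a" "of_rat a < pn v x + e"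
        and b: "pn w x < of_rat b" "of_rat b < pn w x + e"
        and c: "pn v x + pn w x + 2 * e < of_rat c" "of_rat c < pn (v + w) x"
        using of_rat_dense[of "pn v x" "pn v x + e"] of_rat_dense[of "pn w x" "pn w x + e"]
          of_rat_dense[of "pn v x + pn w x + 2 * e" "pn (v + w) x"] e e' by auto
      have "0 \<le> (of_rat a :: real)" "0 \<le> (of_rat b :: real)" "of_rat a + of_rat b < (of_rat c :: real)"
        using a b c elim by linarith+
      then show False using elim(3)[rule_format, of a b c] a b c by linarith
    qed
  qed
qed

lemma pn_minus: "AE x in m. pn (v - w) x = pn (w - v) x"
  using pn_scale[of "- 1" "w - v"] by simp

lemma pn_sum: "AE x in m. pn (\<Sum>i\<in>I. v i) x \<le> (\<Sum>i\<in>I. pn (v i) x)"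
proof (induction I rule: infinite_finite_induct)
  case (insert i I)
  with pn_triangle[of "v i" "\<Sum>i\<in>I. v i"] show ?case by (auto elim!: AE_mp)
qed (use pn_zero in \<open>auto elim!: AE_mp\<close>)

lemma act_indicator_Int:
  assumes "A \<in> sets m" "B \<in> sets m"
  shows "act (indicator A) (act (indicator B) v) = act (indicator (A \<inter> B)) v"
  using act_mult[of "indicator A" "indicator B" v] assms by (simp add: indicator_inter_arith[symmetric])

end

section \<open>Norms on $\mathbb{R}^n$\<close>

definition l1 :: "nat \<Rightarrow> (nat \<Rightarrow> real) \<Rightarrow> real" where
  "l1 n a = (\<Sum>i<n. \<bar>a i\<bar>)"

definition unit_vec :: "nat \<Rightarrow> nat \<Rightarrow> real" where
  "unit_vec i = (\<lambda>j. if j = i then 1 else 0)"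

text \<open>Countable, dense and closed under sums and rational multiples: all almost everywhere
  statements about linear combinations are made for these vectors.\<close>

definition Qn :: "nat \<Rightarrow> (nat \<Rightarrow> real) set" where
  "Qn n = {q \<in> Rn n. \<forall>i. q i \<in> \<rat>}"

lemma Rn_iff: "a \<in> Rn n \<longleftrightarrow> (\<forall>i\<ge>n. a i = 0)"
  by (simp add: topspace_Euclidean_space)

lemma Rn_add: "\<lbrakk>a \<in> Rn n; b \<in> Rn n\<rbrakk> \<Longrightarrow> (\<lambda>i. a i + b i) \<in> Rn n"
  and Rn_diff: "\<lbrakk>a \<in> Rn n; b \<in> Rn n\<rbrakk> \<Longrightarrow> (\<lambda>i. a i - b i) \<in> Rn n"
  and Rn_scale: "a \<in> Rn n \<Longrightarrow> (\<lambda>i. c * a i) \<in> Rn n"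
  and Rn_zero: "(\<lambda>i. 0) \<in> Rn n"
  and Rn_unit_vec: "k < n \<Longrightarrow> unit_vec k \<in> Rn n"
  by (simp_all add: Rn_iff unit_vec_def)

lemma Qn_Rn: "q \<in> Qn n \<Longrightarrow> q \<in> Rn n"
  by (simp add: Qn_def)

lemma Qn_add: "\<lbrakk>a \<in> Qn n; b \<in> Qn n\<rbrakk> \<Longrightarrow> (\<lambda>i. a i + b i) \<in> Qn n"
  and Qn_diff: "\<lbrakk>a \<in> Qn n; b \<in> Qn n\<rbrakk> \<Longrightarrow> (\<lambda>i. a i - b i) \<in> Qn n"
  and Qn_scale: "\<lbrakk>c \<in> \<rat>; a \<in> Qn n\<rbrakk> \<Longrightarrow> (\<lambda>i. c * a i) \<in> Qn n"
  and Qn_zero: "(\<lambda>i. 0) \<in> Qn n"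
  and Qn_unit_vec: "k < n \<Longrightarrow> unit_vec k \<in> Qn n"
  by (simp_all add: Qn_def Rn_iff unit_vec_def)

lemma Qn_mono: "\<lbrakk>k \<le> n; q \<in> Qn k\<rbrakk> \<Longrightarrow> q \<in> Qn n"
  and Rn_mono: "\<lbrakk>k \<le> n; q \<in> Rn k\<rbrakk> \<Longrightarrow> q \<in> Rn n"
  by (auto simp: Qn_def Rn_iff)

lemma countable_Qn: "countable (Qn n)"
proof (rule countable_subset)
  let ?f = "\<lambda>xs i. if i < n then of_rat (xs ! i) else (0::real)"
  show "Qn n \<subseteq> range (?f :: rat list \<Rightarrow> _)"
  proof
    fix q assume q: "q \<in> Qn n"
    then have "\<forall>i. \<exists>r. q i = of_rat r" by (auto simp: Qn_def Rats_def)
    then obtain r where r: "\<And>i. q i = of_rat (r i)" by metis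
    have "q = ?f (map r [0..<n])"
      using q r by (auto simp: Qn_def Rn_iff fun_eq_iff)
    then show "q \<in> range ?f" by blast
  qed
qed simp

lemma Qn_dense:
  assumes a: "a \<in> Rn n" and e: "0 < e"
  shows "\<exists>q\<in>Qn n. l1 n (\<lambda>i. a i - q i) < e"
proof -
  define d where "d = e / (real n + 1)"
  have d: "0 < d" using e by (simp add: d_def)
  have "\<exists>r\<in>\<rat>. \<bar>a i - r\<bar> < d" for i
    using Rats_dense_in_real[of "a i - d" "a i + d"] d by (auto simp: abs_less_iff) (metis diff_less_eq less_diff_eq add.commute minus_diff_eq)
  then obtain r where r: "\<And>i. r i \<in> \<rat>" "\<And>i. \<bar>a i - r i\<bar> < d" by metis
  define q where "q i = (if i < n then r i else 0)" for i
  have "q \<in> Qn n" using r by (simp add: Qn_def Rn_iff q_def)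
  moreover have "l1 n (\<lambda>i. a i - q i) \<le> (\<Sum>i<n. d)"
    unfolding l1_def using r by (intro sum_mono) (auto simp: q_def less_imp_le)
  moreover have "(\<Sum>i<n. d) < e" using e by (simp add: d_def field_simps)
  ultimately show ?thesis by force
qed

lemma Qn_sequence:
  assumes "a \<in> Rn n"
  obtains q where "\<And>j. q j \<in> Qn n" "(\<lambda>j. l1 n (\<lambda>i. a i - q j i)) \<longlonglongrightarrow> 0"
proof -
  have "\<exists>q\<in>Qn n. l1 n (\<lambda>i. a i - q i) < inverse (Suc j)" for j
    using Qn_dense[OF assms] by simp
  then obtain q where q: "\<And>j. q j \<in> Qn n" "\<And>j. l1 n (\<lambda>i. a i - q j i) < inverse (Suc j)" by metis
  have "(\<lambda>j. l1 n (\<lambda>i. a i - q j i)) \<longlonglongrightarrow> 0"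
    by (rule tendsto_sandwich[OF _ _ tendsto_const LIMSEQ_inverse_real_of_nat])
      (use less_imp_le[OF q(2)] in \<open>auto simp: l1_def sum_nonneg\<close>)
  with q(1) show ?thesis by (rule that)
qed

lemma l1_nonneg: "0 \<le> l1 n a"
  by (simp add: l1_def sum_nonneg)

lemma l1_triangle: "l1 n (\<lambda>i. a i + b i) \<le> l1 n a + l1 n b"
  by (simp add: l1_def sum.distrib[symmetric] sum_mono abs_triangle_ineq)

lemma l1_scale: "l1 n (\<lambda>i. c * a i) = \<bar>c\<bar> * l1 n a"
  by (simp add: l1_def abs_mult sum_distrib_left)

lemma l1_minus: "l1 n (\<lambda>i. a i - b i) = l1 n (\<lambda>i. b i - a i)"
  by (simp add: l1_def abs_minus_commute)

lemma coord_le_l1: "i < n \<Longrightarrow> \<bar>a i\<bar> \<le> l1 n a"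
  unfolding l1_def by (rule member_le_sum[of i "{..<n}" "\<lambda>i. \<bar>a i\<bar>"]) auto

lemma l1_eq_0_iff: "a \<in> Rn n \<Longrightarrow> l1 n a = 0 \<longleftrightarrow> a = (\<lambda>i. 0)"
proof
  assume a: "a \<in> Rn n" "l1 n a = 0"
  have "a i = 0" for i using coord_le_l1[of i n a] a by (cases "i < n") (auto simp: Rn_iff)
  then show "a = (\<lambda>i. 0)" by auto
qed (simp add: l1_def)

lemma l1_Norms: "restrict (l1 n) (Rn n) \<in> Norms n"
proof -
  have "\<forall>a\<in>Rn n. 0 \<le> l1 n a \<and> (l1 n a = 0 \<longleftrightarrow> a = (\<lambda>i. 0))"
    using l1_nonneg l1_eq_0_iff by blast
  then show ?thesis
    by (simp add: Norms_def Rn_add Rn_scale l1_triangle l1_scale)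
qed

lemma
  assumes F: "F \<in> Norms n"
  shows Norms_nonneg: "a \<in> Rn n \<Longrightarrow> 0 \<le> F a"
    and Norms_eq_0_iff: "a \<in> Rn n \<Longrightarrow> F a = 0 \<longleftrightarrow> a = (\<lambda>i. 0)"
    and Norms_scale: "a \<in> Rn n \<Longrightarrow> F (\<lambda>i. c * a i) = \<bar>c\<bar> * F a"
    and Norms_triangle: "\<lbrakk>a \<in> Rn n; b \<in> Rn n\<rbrakk> \<Longrightarrow> F (\<lambda>i. a i + b i) \<le> F a + F b"
  using F by (simp_all add: Norms_def)

lemma Norms_zero: "F \<in> Norms n \<Longrightarrow> F (\<lambda>i. 0) = 0"
  using Norms_eq_0_iff[OF _ Rn_zero] by blast

lemma Norms_minus:
  assumes F: "F \<in> Norms n" and a: "a \<in> Rn n" and b: "b \<in> Rn n"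
  shows "F (\<lambda>i. a i - b i) = F (\<lambda>i. b i - a i)"
  using Norms_scale[OF F Rn_diff[OF a b], of "- 1"] by simp

lemma Norms_diff:
  assumes F: "F \<in> Norms n" and a: "a \<in> Rn n" and b: "b \<in> Rn n"
  shows "F a \<le> F b + F (\<lambda>i. a i - b i)"
  using Norms_triangle[OF F b Rn_diff[OF a b]] by simp

lemma Norms_abs_diff:
  assumes F: "F \<in> Norms n" and a: "a \<in> Rn n" and b: "b \<in> Rn n"
  shows "\<bar>F a - F b\<bar> \<le> F (\<lambda>i. a i - b i)"
  using Norms_diff[OF F a b] Norms_diff[OF F b a] Norms_minus[OF F a b] by linarith

lemma Norms_sum:
  assumes F: "F \<in> Norms n" and w: "\<And>i. i \<in> I \<Longrightarrow> w i \<in> Rn n"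
  shows "F (\<lambda>j. \<Sum>i\<in>I. c i * w i j) \<le> (\<Sum>i\<in>I. \<bar>c i\<bar> * F (w i))"
  using w
proof (induction I rule: infinite_finite_induct)
  case (insert i I)
  have "(\<lambda>j. \<Sum>i\<in>I. c i * w i j) \<in> Rn n" using insert.prems by (simp add: Rn_iff)
  from Norms_triangle[OF F Rn_scale[of "w i" n "c i"] this] insert
  show ?case by (simp add: Norms_scale[OF F])
qed (simp_all add: Norms_zero[OF F])

lemma Rn_expand: "a \<in> Rn n \<Longrightarrow> a = (\<lambda>j. \<Sum>i<n. a i * unit_vec i j)"
  by (auto simp: Rn_iff unit_vec_def fun_eq_iff if_distrib sum.delta cong: if_cong)

lemma Norms_le_l1:
  assumes F: "F \<in> Norms n" and a: "a \<in> Rn n"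
  shows "F a \<le> (\<Sum>i<n. F (unit_vec i)) * l1 n a"
proof -
  have "F a \<le> (\<Sum>i<n. \<bar>a i\<bar> * F (unit_vec i))"
    by (subst (1) Rn_expand[OF a], rule Norms_sum[OF F]) (simp add: Rn_unit_vec)
  also have "\<dots> \<le> (\<Sum>i<n. l1 n a * F (unit_vec i))"
    by (intro sum_mono mult_right_mono coord_le_l1 Norms_nonneg[OF F] Rn_unit_vec) auto
  finally show ?thesis by (simp add: sum_distrib_left mult.commute)
qed

lemma l1_le_Norms:
  assumes F: "F \<in> Norms n"
  obtains c where "0 < c" "\<And>a. a \<in> Rn n \<Longrightarrow> c * l1 n a \<le> F a"
proof -
  obtain C where C: "C > 0" "\<And>a. a \<in> Rn n \<Longrightarrow> restrict (l1 n) (Rn n) a \<le> C * F a"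
    using Norms_equivalent[OF l1_Norms F] by blast
  show ?thesis
    by (rule that[of "1 / C"]) (use C in \<open>auto simp: field_simps\<close>)
qed

lemma Norms_dense:
  assumes F: "F \<in> Norms n" and k: "k \<le> n" and a: "a \<in> Rn k" and e: "0 < e"
  obtains q where "q \<in> Qn k" "F (\<lambda>i. a i - q i) < e"
proof -
  define K where "K = (\<Sum>i<n. F (unit_vec i))"
  have K: "0 \<le> K" unfolding K_def by (intro sum_nonneg Norms_nonneg[OF F] Rn_unit_vec) auto
  \<comment> \<open>\<open>K\<close> vanishes for \<open>n = 0\<close>, hence the summand 1 in the
    denominator.\<close>
  obtain q where q: "q \<in> Qn k" "l1 k (\<lambda>i. a i - q i) < e / (K + 1)"
    using Qn_dense[OF a, of "e / (K + 1)"] e K by auto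
  have d: "(\<lambda>i. a i - q i) \<in> Rn k" by (rule Rn_diff[OF a Qn_Rn[OF q(1)]])
  have "F (\<lambda>i. a i - q i) \<le> K * l1 n (\<lambda>i. a i - q i)"
    unfolding K_def by (rule Norms_le_l1[OF F Rn_mono[OF k d]])
  also have "l1 n (\<lambda>i. a i - q i) = l1 k (\<lambda>i. a i - q i)"
    unfolding l1_def using d k by (intro sum.mono_neutral_right) (auto simp: Rn_iff)
  also have "K * l1 k (\<lambda>i. a i - q i) \<le> K * (e / (K + 1))" using q(2) K by (intro mult_left_mono) auto
  also have "\<dots> < e" using K e by (simp add: field_simps)
  finally show ?thesis using that q(1) by blast
qed

text \<open>Subadditivity and the upper bound make \<open>g\<close> Lipschitz for \<open>l1\<close>
  on rational vectors. \<open>F\<close> is its largest extension with the same constant, an infimal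
  convolution, and it is the limit of \<open>g\<close> along every approximating rational sequence,
  so the norm axioms pass to the limit. The lower bound keeps \<open>F\<close> positive at
  irrational vectors, where positivity of \<open>g\<close> alone could be lost.\<close>

lemma seminorm_extension:
  fixes g :: "(nat \<Rightarrow> real) \<Rightarrow> real"
  assumes c: "0 < c" "\<And>q. q \<in> Qn n \<Longrightarrow> c * l1 n q \<le> g q"
    and K: "\<And>q. q \<in> Qn n \<Longrightarrow> g q \<le> K * l1 n q"
    and tri: "\<And>q r. \<lbrakk>q \<in> Qn n; r \<in> Qn n\<rbrakk> \<Longrightarrow> g (\<lambda>i. q i + r i) \<le> g q + g r"
    and scale: "\<And>t q. \<lbrakk>t \<in> \<rat>; q \<in> Qn n\<rbrakk> \<Longrightarrow> g (\<lambda>i. t * q i) = \<bar>t\<bar> * g q"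
  shows "\<exists>F\<in>Norms n. \<forall>q\<in>Qn n. F q = g q"
proof -
  have K': "g q \<le> g r + \<bar>K\<bar> * l1 n (\<lambda>i. q i - r i)" if "q \<in> Qn n" "r \<in> Qn n" for q r
  proof -
    have "K * l1 n (\<lambda>i. q i - r i) \<le> \<bar>K\<bar> * l1 n (\<lambda>i. q i - r i)"
      by (intro mult_right_mono l1_nonneg) simp
    then show ?thesis
      using tri[OF that(2) Qn_diff[OF that]] K[OF Qn_diff[OF that]] by simp
  qed
  \<comment> \<open>For \<open>n = 0\<close> the hypotheses do not exclude a negative
    \<open>K\<close>, hence the absolute value.\<close>
  define F where "F = restrict (\<lambda>a. INF q\<in>Qn n. g q + \<bar>K\<bar> * l1 n (\<lambda>i. a i - q i)) (Rn n)"
  have g0: "0 \<le> g q" if "q \<in> Qn n" for q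
  proof -
    have "0 \<le> c * l1 n q" using c(1) l1_nonneg[of n q] by simp
    then show ?thesis using c(2)[OF that] by linarith
  qed
  have bdd: "bdd_below ((\<lambda>q. g q + \<bar>K\<bar> * l1 n (\<lambda>i. a i - q i)) ` Qn n)" for a
    by (rule bdd_belowI2[of _ 0]) (auto intro!: add_nonneg_nonneg g0 mult_nonneg_nonneg l1_nonneg)
  have Fle: "F a \<le> g q + \<bar>K\<bar> * l1 n (\<lambda>i. a i - q i)" if "a \<in> Rn n" "q \<in> Qn n" for a q
    using cINF_lower[OF bdd that(2)] that(1) by (simp add: F_def)
  have Fge: "g q - \<bar>K\<bar> * l1 n (\<lambda>i. a i - q i) \<le> F a" if a: "a \<in> Rn n" and q: "q \<in> Qn n" for a q
  proof -
    have "g q - \<bar>K\<bar> * l1 n (\<lambda>i. a i - q i) \<le> g r + \<bar>K\<bar> * l1 n (\<lambda>i. a i - r i)" if r: "r \<in> Qn n" for r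
    proof -
      have "l1 n (\<lambda>i. q i - r i) \<le> l1 n (\<lambda>i. a i - q i) + l1 n (\<lambda>i. a i - r i)"
        using l1_triangle[of n "\<lambda>i. q i - a i" "\<lambda>i. a i - r i"] by (simp add: l1_minus[of n q a])
      then have "\<bar>K\<bar> * l1 n (\<lambda>i. q i - r i) \<le> \<bar>K\<bar> * (l1 n (\<lambda>i. a i - q i) + l1 n (\<lambda>i. a i - r i))"
        by (intro mult_left_mono) auto
      then show ?thesis using K'[OF q r] by (simp add: algebra_simps)
    qed
    then show ?thesis using a Qn_zero by (auto simp: F_def intro!: cINF_greatest)
  qed
  have lim: "(\<lambda>j. g (q j)) \<longlonglongrightarrow> F a"
    if a: "a \<in> Rn n" and q: "\<And>j. q j \<in> Qn n" "(\<lambda>j. l1 n (\<lambda>i. a i - q j i)) \<longlonglongrightarrow> 0" for a q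
  proof -
    have "(\<lambda>j. \<bar>K\<bar> * l1 n (\<lambda>i. a i - q j i)) \<longlonglongrightarrow> 0" using tendsto_mult_left[OF q(2), of "\<bar>K\<bar>"] by simp
    moreover have "norm (g (q j) - F a) \<le> \<bar>K\<bar> * l1 n (\<lambda>i. a i - q j i)" for j
      using Fle[OF a q(1), of j] Fge[OF a q(1), of j] by (simp add: abs_le_iff)
    ultimately have "(\<lambda>j. g (q j) - F a) \<longlonglongrightarrow> 0"
      by (rule Lim_null_comparison[OF always_eventually, rotated, OF _ allI])
    then show ?thesis by (simp add: LIM_zero_iff)
  qed
  have Fq: "F q = g q" if "q \<in> Qn n" for q
    using LIMSEQ_unique[OF lim[OF Qn_Rn[OF that], of "\<lambda>j. q"] tendsto_const] that by (simp add: l1_def)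
  have Fc: "c * l1 n a \<le> F a" if a: "a \<in> Rn n" for a
  proof -
    obtain q where q: "\<And>j. q j \<in> Qn n" "(\<lambda>j. l1 n (\<lambda>i. a i - q j i)) \<longlonglongrightarrow> 0" using Qn_sequence[OF a] by blast
    have "c * l1 n a \<le> g (q j) + c * l1 n (\<lambda>i. a i - q j i)" for j
    proof -
      have "l1 n a \<le> l1 n (q j) + l1 n (\<lambda>i. a i - q j i)"
        using l1_triangle[of n "q j" "\<lambda>i. a i - q j i"] by simp
      then have "c * l1 n a \<le> c * (l1 n (q j) + l1 n (\<lambda>i. a i - q j i))"
        using c(1) by (intro mult_left_mono) auto
      then show ?thesis using c(2)[OF q(1), of j] by (simp add: algebra_simps)
    qed
    moreover have "(\<lambda>j. g (q j) + c * l1 n (\<lambda>i. a i - q j i)) \<longlonglongrightarrow> F a + c * 0"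
      by (intro tendsto_add tendsto_mult tendsto_const lim[OF a q] q(2))
    ultimately show ?thesis by (intro LIMSEQ_le_const[of _ "F a"]) auto
  qed
  have "F \<in> Norms n"
    unfolding Norms_def
  proof (intro CollectI conjI ballI allI)
    show "F \<in> extensional (Rn n)" by (simp add: F_def)
    fix a assume a: "a \<in> Rn n"
    show "0 \<le> F a" using Fc[OF a] mult_nonneg_nonneg[OF less_imp_le[OF c(1)] l1_nonneg[of n a]] by linarith
    show "F a = 0 \<longleftrightarrow> a = (\<lambda>i. 0)"
    proof
      assume "F a = 0"
      then have "c * l1 n a \<le> 0" using Fc[OF a] by simp
      then have "l1 n a \<le> 0" using c(1) by (simp add: mult_le_0_iff)
      then show "a = (\<lambda>i. 0)" using l1_nonneg[of n a] l1_eq_0_iff[OF a] by linarith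
    next
      assume "a = (\<lambda>i. 0)"
      then show "F a = 0" using Fq[OF Qn_zero] scale[of 0 "\<lambda>i. 0"] Qn_zero by simp
    qed
    obtain q where q: "\<And>j. q j \<in> Qn n" "(\<lambda>j. l1 n (\<lambda>i. a i - q j i)) \<longlonglongrightarrow> 0" using Qn_sequence[OF a] by blast
    {
      fix t :: real
      have "\<exists>s\<in>\<rat>. t - inverse (Suc j) < s \<and> s < t" for j
        using Rats_dense_in_real[of "t - inverse (Suc j)" t] by auto
      then obtain s where s: "\<And>j. s j \<in> \<rat>" "\<And>j::nat. t - inverse (Suc j) < s j" "\<And>j. s j < t" by metis
      have st: "s \<longlonglongrightarrow> t"
        by (rule tendsto_sandwich[OF _ _ LIMSEQ_inverse_real_of_nat_add_minus tendsto_const])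
          (use less_imp_le[OF s(2)] less_imp_le[OF s(3)] in auto)
      have "(\<lambda>j. l1 n (\<lambda>i. t * a i - s j * q j i)) \<longlonglongrightarrow> 0"
      proof (rule tendsto_sandwich[OF _ _ tendsto_const])
        show "\<forall>\<^sub>F j in sequentially. l1 n (\<lambda>i. t * a i - s j * q j i) \<le> \<bar>t - s j\<bar> * l1 n a + \<bar>s j\<bar> * l1 n (\<lambda>i. a i - q j i)"
        proof (intro always_eventually allI)
          fix j
          have "(\<lambda>i. t * a i - s j * q j i) = (\<lambda>i. (t - s j) * a i + s j * (a i - q j i))"
            by (simp add: algebra_simps)
          then show "l1 n (\<lambda>i. t * a i - s j * q j i) \<le> \<bar>t - s j\<bar> * l1 n a + \<bar>s j\<bar> * l1 n (\<lambda>i. a i - q j i)"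
            using l1_triangle[of n "\<lambda>i. (t - s j) * a i" "\<lambda>i. s j * (a i - q j i)"] by (simp add: l1_scale)
        qed
        have "(\<lambda>j. \<bar>t - s j\<bar> * l1 n a + \<bar>s j\<bar> * l1 n (\<lambda>i. a i - q j i)) \<longlonglongrightarrow> \<bar>t - t\<bar> * l1 n a + \<bar>t\<bar> * 0"
          by (intro tendsto_intros st q(2))
        then show "(\<lambda>j. \<bar>t - s j\<bar> * l1 n a + \<bar>s j\<bar> * l1 n (\<lambda>i. a i - q j i)) \<longlonglongrightarrow> 0" by simp
      qed (simp add: l1_nonneg)
      then have "(\<lambda>j. g (\<lambda>i. s j * q j i)) \<longlonglongrightarrow> F (\<lambda>i. t * a i)"
        by (intro lim Rn_scale a Qn_scale s q)
      moreover have "(\<lambda>j. g (\<lambda>i. s j * q j i)) \<longlonglongrightarrow> \<bar>t\<bar> * F a"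
        unfolding scale[OF s(1) q(1)] by (intro tendsto_intros st lim[OF a q])
      ultimately show "F (\<lambda>i. t * a i) = \<bar>t\<bar> * F a" by (rule LIMSEQ_unique)
    }
    fix b assume b: "b \<in> Rn n"
    obtain r where r: "\<And>j. r j \<in> Qn n" "(\<lambda>j. l1 n (\<lambda>i. b i - r j i)) \<longlonglongrightarrow> 0" using Qn_sequence[OF b] by blast
    have "(\<lambda>j. l1 n (\<lambda>i. (a i + b i) - (q j i + r j i))) \<longlonglongrightarrow> 0"
    proof (rule tendsto_sandwich[OF _ _ tendsto_const])
      show "\<forall>\<^sub>F j in sequentially. l1 n (\<lambda>i. (a i + b i) - (q j i + r j i)) \<le> l1 n (\<lambda>i. a i - q j i) + l1 n (\<lambda>i. b i - r j i)"
        using l1_triangle[of n "\<lambda>i. a i - q _ i" "\<lambda>i. b i - r _ i"] by (intro always_eventually allI) (simp add: algebra_simps)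
      show "(\<lambda>j. l1 n (\<lambda>i. a i - q j i) + l1 n (\<lambda>i. b i - r j i)) \<longlonglongrightarrow> 0"
        using tendsto_add[OF q(2) r(2)] by simp
    qed (simp add: l1_nonneg)
    then have "(\<lambda>j. g (\<lambda>i. q j i + r j i)) \<longlonglongrightarrow> F (\<lambda>i. a i + b i)"
      by (intro lim Rn_add a b Qn_add q r)
    moreover have "(\<lambda>j. g (q j) + g (r j)) \<longlonglongrightarrow> F a + F b"
      by (intro tendsto_add lim a b q r)
    ultimately show "F (\<lambda>i. a i + b i) \<le> F a + F b"
      by (rule LIMSEQ_le) (use tri q r in blast)
  qed
  with Fq show ?thesis by blast
qed

section \<open>Borel sets of the space of norms and measurable evaluation\<close>

text \<open>Norms that are bounded on the unit vectors are equicontinuous. So closeness on a fine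
  grid of the cube, which contains the \<open>l1\<close> sphere, spreads to the sphere, and
  homogeneity turns a uniform error there into a bound for the logarithmic distance.\<close>

lemma Norms_dist_less_if_close_on_grid:
  assumes G: "G \<in> Norms n" and r: "0 < r"
  obtains J \<delta> where "finite J" "J \<subseteq> Qn n" "0 < \<delta>"
    "\<And>F. \<lbrakk>F \<in> Norms n; \<And>q. q \<in> J \<Longrightarrow> \<bar>F q - G q\<bar> < \<delta>\<rbrakk> \<Longrightarrow> Norms_dist n G F < r"
proof -
  obtain c where c: "0 < c" "\<And>a. a \<in> Rn n \<Longrightarrow> c * l1 n a \<le> G a" using l1_le_Norms[OF G] by blast
  \<comment> \<open>A norm within distance 1 of \<open>G\<close> at the \<open>n\<close> unit
    vectors still has sum at most \<open>K\<close>, so \<open>K\<close> is a common Lipschitz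
    constant of both norms.\<close>
  define K where "K = (\<Sum>i<n. G (unit_vec i)) + real n"
  have K: "0 \<le> K" unfolding K_def by (intro add_nonneg_nonneg sum_nonneg Norms_nonneg[OF G] Rn_unit_vec) auto
  \<comment> \<open>On the \<open>l1\<close> sphere \<open>G\<close> is at least \<open>c\<close>.
    An error of \<open>c / 2\<close> keeps the other norm above \<open>c / 2\<close>, and an error
    of \<open>c * r / 4\<close> divided by \<open>c / 2\<close> is \<open>r / 2\<close>.\<close>
  define \<eta> where "\<eta> = min (c / 2) (c * r / 4)"
  have \<eta>: "0 < \<eta>" "\<eta> \<le> c / 2" "\<eta> \<le> c * r / 4" using c r by (auto simp: \<eta>_def)
  \<comment> \<open>Rounding down to the grid costs at most \<open>K * (n / N)\<close> for each of
    the two norms, together half of \<eta>; the other half is left to \<delta>.\<close>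
  obtain N :: nat where N: "4 * K * real n / \<eta> < real N" using reals_Archimedean2 by blast
  have N0: "0 < real N" using N K \<eta> by (intro le_less_trans[OF _ N]) auto
  have N1: "2 * K * (real n / real N) \<le> \<eta> / 2" using N N0 \<eta> by (simp add: field_simps)
  define grid where "grid k = (\<lambda>i. if i < n then of_int (k i) / real N else 0)" for k :: "nat \<Rightarrow> int"
  define J where "J = grid ` (PiE {..<n} (\<lambda>i. {- int N..int N}))"
  define \<delta> where "\<delta> = min 1 (\<eta> / 2)"
  have \<delta>: "0 < \<delta>" "\<delta> \<le> 1" "\<delta> \<le> \<eta> / 2" using \<eta> by (auto simp: \<delta>_def)
  have gridI: "grid k \<in> J" if "\<And>i. i < n \<Longrightarrow> k i \<in> {- int N..int N}" for k
  proof -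
    have "grid k = grid (restrict k {..<n})" by (auto simp: grid_def)
    then show ?thesis unfolding J_def using that by (intro image_eqI[of _ _ "restrict k {..<n}"]) auto
  qed
  have unitJ: "unit_vec i \<in> J" if "i < n" for i
  proof -
    have "unit_vec i = grid (\<lambda>j. if j = i then int N else 0)"
      using that N0 by (auto simp: unit_vec_def grid_def fun_eq_iff)
    then show ?thesis by (simp add: gridI)
  qed
  show ?thesis
  proof (rule that[of J \<delta>])
    show "finite J" unfolding J_def by (intro finite_imageI finite_PiE) auto
    have "grid k \<in> Qn n" for k by (simp add: grid_def Qn_def Rn_iff)
    then show J: "J \<subseteq> Qn n" unfolding J_def by blast
    show "0 < \<delta>" by fact
    fix F assume F: "F \<in> Norms n" and close: "\<And>q. q \<in> J \<Longrightarrow> \<bar>F q - G q\<bar> < \<delta>"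
    have "F (unit_vec i) \<le> G (unit_vec i) + 1" if "i < n" for i
      using close[OF unitJ[OF that]] \<delta>(2) by linarith
    then have FK: "(\<Sum>i<n. F (unit_vec i)) \<le> K"
      unfolding K_def using sum_mono[of "{..<n}" "\<lambda>i. F (unit_vec i)" "\<lambda>i. G (unit_vec i) + 1"]
      by (simp add: sum.distrib)
    have GK: "(\<Sum>i<n. G (unit_vec i)) \<le> K" by (simp add: K_def)
    have unit: "\<bar>F a - G a\<bar> \<le> \<eta>" if a: "a \<in> Rn n" "l1 n a = 1" for a
    proof -
      define q where "q = grid (\<lambda>i. \<lfloor>a i * real N\<rfloor>)"
      have ai: "\<bar>a i * real N\<bar> \<le> real N" if "i < n" for i
        using coord_le_l1[OF that, of a] a N0 by (simp add: abs_mult mult_left_le_one_le)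
      have qJ: "q \<in> J" unfolding q_def
      proof (rule gridI)
        fix i assume "i < n"
        with ai[of i] show "\<lfloor>a i * real N\<rfloor> \<in> {- int N..int N}"
          by (auto simp: le_floor_iff floor_le_iff abs_le_iff)
      qed
      then have qR: "q \<in> Rn n" using J Qn_Rn by blast
      have "l1 n (\<lambda>i. a i - q i) \<le> (\<Sum>i<n. 1 / real N)"
        unfolding l1_def
      proof (intro sum_mono)
        fix i assume i: "i \<in> {..<n}"
        have "a i - q i = (a i * real N - of_int \<lfloor>a i * real N\<rfloor>) / real N"
          using i N0 by (simp add: q_def grid_def field_simps)
        moreover have "\<bar>a i * real N - of_int \<lfloor>a i * real N\<rfloor>\<bar> \<le> 1" by linarith
        ultimately show "\<bar>a i - q i\<bar> \<le> 1 / real N" using N0 by (simp add: divide_right_mono)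
      qed
      then have l: "l1 n (\<lambda>i. a i - q i) \<le> real n / real N" by simp
      have *: "\<bar>H a - H q\<bar> \<le> K * (real n / real N)" if H: "H \<in> Norms n" "(\<Sum>i<n. H (unit_vec i)) \<le> K" for H
      proof -
        have "\<bar>H a - H q\<bar> \<le> H (\<lambda>i. a i - q i)" by (rule Norms_abs_diff[OF H(1) a(1) qR])
        also have "\<dots> \<le> (\<Sum>i<n. H (unit_vec i)) * l1 n (\<lambda>i. a i - q i)"
          by (rule Norms_le_l1[OF H(1) Rn_diff[OF a(1) qR]])
        also have "\<dots> \<le> K * (real n / real N)"
          using H(2) l K by (intro mult_mono l1_nonneg) auto
        finally show ?thesis .
      qed
      have "\<bar>F a - G a\<bar> \<le> 2 * K * (real n / real N) + \<delta>"
        using *[OF F FK] *[OF G GK] close[OF qJ] by linarith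
      then show ?thesis using N1 \<delta>(3) by linarith
    qed
    have "Norms_dist n G F \<le> r / 2"
    proof (rule Norms_dist_least[OF G F])
      show "0 \<le> r / 2" using r by simp
      fix a assume a: "a \<in> Rn n" "a \<noteq> (\<lambda>i. 0)"
      define s where "s = l1 n a"
      have s: "0 < s" using l1_nonneg[of n a] l1_eq_0_iff[OF a(1)] a(2) by (auto simp: s_def less_le)
      define b where "b = (\<lambda>i. inverse s * a i)"
      have b: "b \<in> Rn n" "l1 n b = 1" unfolding b_def using a s by (auto simp: Rn_scale l1_scale s_def)
      have ab: "H a = s * H b" if "H \<in> Norms n" for H
        unfolding b_def using Norms_scale[OF that a(1)] s by simp
      have Gb: "c \<le> G b" using c(2)[OF b(1)] b(2) by simp
      have Fb: "\<bar>F b - G b\<bar> \<le> \<eta>" by (rule unit[OF b])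
      have Fb2: "c / 2 \<le> F b" using Fb Gb \<eta>(2) by linarith
      have ln_le: "ln x - ln y \<le> r / 2" if "c / 2 \<le> x" "c / 2 \<le> y" "\<bar>x - y\<bar> \<le> \<eta>" for x y
      proof -
        have pos: "0 < x" "0 < y" using that c(1) by linarith+
        have "ln x - ln y = ln (x / y)" using pos by (simp add: ln_div)
        also have "\<dots> \<le> x / y - 1" using pos by (intro ln_le_minus_one) simp
        also have "\<dots> = (x - y) / y" using pos by (simp add: field_simps)
        also have "\<dots> \<le> \<eta> / (c / 2)" using that c(1) \<eta> pos by (intro frac_le) auto
        also have "\<dots> \<le> r / 2" using \<eta>(3) c(1) by (simp add: field_simps)
        finally show ?thesis .
      qed
      have "\<bar>ln (G b) - ln (F b)\<bar> \<le> r / 2"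
      proof -
        have "c / 2 \<le> G b" "\<bar>G b - F b\<bar> \<le> \<eta>" using Gb Fb c(1) by linarith+
        then have "ln (G b) - ln (F b) \<le> r / 2" "ln (F b) - ln (G b) \<le> r / 2"
          using ln_le[of "G b" "F b"] ln_le[of "F b" "G b"] Fb Fb2 by blast+
        then show ?thesis by linarith
      qed
      moreover have "ln (G a) - ln (F a) = ln (G b) - ln (F b)"
        using ab[OF F] ab[OF G] s Gb Fb2 c(1) by (simp add: ln_mult)
      ultimately show "\<bar>ln (G a) - ln (F a)\<bar> \<le> r / 2" by simp
    qed
    then show "Norms_dist n G F < r" using r by linarith
  qed
qed

text \<open>Evaluation at an enumeration of \<open>Qn n\<close> maps norms to real sequences, for
  which measurability is coordinatewise. By the preceding lemma, every open set of norms is the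
  preimage of an open set of sequences.\<close>

lemma measurable_Norms_borel:
  assumes F: "\<And>x. x \<in> space M \<Longrightarrow> F x \<in> Norms n"
    and meas [measurable]: "\<And>q. q \<in> Qn n \<Longrightarrow> (\<lambda>x. F x q) \<in> borel_measurable M"
  shows "F \<in> M \<rightarrow>\<^sub>M Norms_borel n"
  unfolding Norms_borel_def
proof (rule measurable_measure_of)
  interpret Metric_space "Norms n" "Norms_dist n" by (rule Metric_space_Norms)
  show "{U. openin mtopology U} \<subseteq> Pow (Norms n)" using openin_subset by fastforce
  show "F \<in> space M \<rightarrow> Norms n" using F by auto
  fix U assume "U \<in> {U. openin mtopology U}"
  then have U: "openin mtopology U" by simp
  have Qne: "Qn n \<noteq> {}" using Qn_zero by blast
  define en where "en = from_nat_into (Qn n)"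
  have en: "en j \<in> Qn n" for j unfolding en_def by (rule from_nat_into[OF Qne])
  have en_surj: "\<exists>j. en j = q" if "q \<in> Qn n" for q
    using from_nat_into_surj[OF countable_Qn that] by (simp add: en_def)
  define \<Phi> where "\<Phi> H = (\<lambda>j. H (en j))" for H :: "(nat \<Rightarrow> real) \<Rightarrow> real"
  \<comment> \<open>The largest candidate, a union of open sets, so that no neighbourhood has to be
    chosen for each norm.\<close>
  define W where "W = \<Union>{W. open W \<and> Norms n \<inter> \<Phi> -` W \<subseteq> U}"
  have "open W" unfolding W_def by auto
  have eq: "H \<in> U \<longleftrightarrow> \<Phi> H \<in> W" if H: "H \<in> Norms n" for H
  proof
    assume "H \<in> U"
    then obtain r where r: "0 < r" "mball H r \<subseteq> U" using U by (auto simp: openin_mtopology)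
    obtain J \<delta> where J: "finite J" "J \<subseteq> Qn n" "0 < \<delta>"
      "\<And>F. \<lbrakk>F \<in> Norms n; \<And>q. q \<in> J \<Longrightarrow> \<bar>F q - H q\<bar> < \<delta>\<rbrakk> \<Longrightarrow> Norms_dist n H F < r"
      using Norms_dist_less_if_close_on_grid[OF H r(1)] by metis
    obtain I where I: "finite I" "J = en ` I"
      using finite_subset_image[OF J(1), of en UNIV] J(2) en_surj by (metis image_eqI subsetI subsetD UNIV_I)
    define V where "V = (\<Inter>j\<in>I. {y. \<bar>y j - H (en j)\<bar> < \<delta>})"
    have "open V" unfolding V_def
      by (intro open_INT I(1) ballI open_Collect_less continuous_intros continuous_on_product_coordinates)
    moreover have "Norms n \<inter> \<Phi> -` V \<subseteq> U"
    proof
      fix F assume "F \<in> Norms n \<inter> \<Phi> -` V"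
      then have "F \<in> Norms n" "Norms_dist n H F < r" using J(4)[of F] I by (auto simp: V_def \<Phi>_def)
      then show "F \<in> U" using r(2) H by auto
    qed
    moreover have "\<Phi> H \<in> V" using J(3) by (simp add: V_def \<Phi>_def)
    ultimately show "\<Phi> H \<in> W" unfolding W_def by blast
  next
    assume "\<Phi> H \<in> W"
    then show "H \<in> U" using H unfolding W_def by blast
  qed
  have "(\<lambda>x. \<Phi> (F x)) \<in> borel_measurable M"
    unfolding \<Phi>_def by (rule measurable_coordinatewise_then_product) (simp add: meas[OF en])
  then have "(\<lambda>x. \<Phi> (F x)) -` W \<inter> space M \<in> sets M" using \<open>open W\<close> by (auto intro: measurable_sets)
  also have "(\<lambda>x. \<Phi> (F x)) -` W \<inter> space M = F -` U \<inter> space M" using eq F by auto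
  finally show "F -` U \<inter> space M \<in> sets M" .
qed

text \<open>Since \<open>F x\<close> has Lipschitz constant \<open>K x\<close> with respect to
  \<open>l1\<close>, its value at \<open>u x\<close> is an infimum of countably many functions in
  which \<open>F x\<close> is evaluated at fixed rational vectors only.\<close>

lemma measurable_Norms_eval:
  assumes F: "\<And>x. x \<in> space M \<Longrightarrow> F x \<in> Norms n"
    and meas [measurable]: "\<And>q. q \<in> Qn n \<Longrightarrow> (\<lambda>x. F x q) \<in> borel_measurable M"
    and u: "\<And>x. x \<in> space M \<Longrightarrow> u x \<in> Rn n"
    and [measurable]: "\<And>i. i < n \<Longrightarrow> (\<lambda>x. u x i) \<in> borel_measurable M"
  shows "(\<lambda>x. F x (u x)) \<in> borel_measurable M"
proof -
  define K where "K x = (\<Sum>i<n. F x (unit_vec i))" for x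
  have [measurable]: "K \<in> borel_measurable M" unfolding K_def by (intro borel_measurable_sum meas Qn_unit_vec) simp
  have K0: "0 \<le> K x" if "x \<in> space M" for x
    unfolding K_def by (intro sum_nonneg Norms_nonneg[OF F[OF that]] Rn_unit_vec) auto
  let ?g = "\<lambda>q x. F x q + K x * l1 n (\<lambda>i. u x i - q i)"
  have bdd: "bdd_below ((\<lambda>q. ?g q x) ` Qn n)" if "x \<in> space M" for x
    by (rule bdd_belowI2[of _ 0])
      (auto intro!: add_nonneg_nonneg mult_nonneg_nonneg K0 that l1_nonneg Norms_nonneg[OF F[OF that]] Qn_Rn)
  have "(\<lambda>x. INF q\<in>Qn n. ?g q x) \<in> borel_measurable M"
  proof (rule borel_measurable_cINF[OF countable_Qn])
    show "?g q \<in> borel_measurable M" if "q \<in> Qn n" for q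
      using that unfolding l1_def by measurable
  qed (rule bdd)
  moreover have "(INF q\<in>Qn n. ?g q x) = F x (u x)" if x: "x \<in> space M" for x
  proof (rule antisym)
    note Fx = F[OF x] and ux = u[OF x]
    show "F x (u x) \<le> (INF q\<in>Qn n. ?g q x)"
    proof (rule cINF_greatest)
      show "Qn n \<noteq> {}" using Qn_zero by blast
      fix q assume q: "q \<in> Qn n"
      show "F x (u x) \<le> ?g q x"
        using Norms_diff[OF Fx ux Qn_Rn[OF q]] Norms_le_l1[OF Fx Rn_diff[OF ux Qn_Rn[OF q]]]
        by (simp add: K_def)
    qed
    show "(INF q\<in>Qn n. ?g q x) \<le> F x (u x)"
    proof (rule field_le_epsilon)
      fix e :: real assume e: "0 < e"
      have K1: "0 < 2 * K x + 1" using K0[OF x] by simp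
      obtain q where q: "q \<in> Qn n" "l1 n (\<lambda>i. u x i - q i) < e / (2 * K x + 1)"
        using Qn_dense[OF ux, of "e / (2 * K x + 1)"] e K1 by auto
      have "(INF q\<in>Qn n. ?g q x) \<le> ?g q x" by (rule cINF_lower[OF bdd[OF x] q(1)])
      also have "F x q \<le> F x (u x) + K x * l1 n (\<lambda>i. u x i - q i)"
        using Norms_abs_diff[OF Fx ux Qn_Rn[OF q(1)]] Norms_le_l1[OF Fx Rn_diff[OF ux Qn_Rn[OF q(1)]]]
        by (simp add: K_def)
      finally have "(INF q\<in>Qn n. ?g q x) \<le> F x (u x) + 2 * K x * l1 n (\<lambda>i. u x i - q i)" by simp
      also have "\<dots> \<le> F x (u x) + 2 * K x * (e / (2 * K x + 1))"
        using q(2) K0[OF x] by (intro add_left_mono mult_left_mono) auto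
      also have "\<dots> \<le> F x (u x) + e" using e K1 by (simp add: field_simps)
      finally show "(INF q\<in>Qn n. ?g q x) \<le> F x (u x) + e" .
    qed
  qed
  ultimately show ?thesis by (subst measurable_cong[of _ _ "\<lambda>x. INF q\<in>Qn n. ?g q x"]) simp_all
qed

section \<open>Measurable choice of an equivalent scalar product\<close>

text \<open>A Gram-Schmidt procedure: the coordinate vector \<open>unit_vec k\<close> is sheared along an almost best
  approximation of it in the span of the previous ones. Taking the approximation from the countable
  set \<^term>\<open>Qn k\<close> makes the construction measurable in the norm.\<close>

definition best_approx :: "((nat \<Rightarrow> real) \<Rightarrow> real) \<Rightarrow> nat \<Rightarrow> nat \<Rightarrow> real" where
  "best_approx F k = from_nat_into (Qn k) (LEAST j. \<forall>r\<in>Qn k.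
     F (\<lambda>i. unit_vec k i - from_nat_into (Qn k) j i) \<le> 2 * F (\<lambda>i. unit_vec k i - r i))"

text \<open>For \<open>a\<close> in \<open>Rn (Suc k)\<close>, this is what remains of
  \<open>a\<close> in \<open>Rn k\<close> after subtracting \<open>a k\<close> times the vector
  \<open>unit_vec k - best_approx F k\<close>.\<close>

definition shear :: "((nat \<Rightarrow> real) \<Rightarrow> real) \<Rightarrow> nat \<Rightarrow> (nat \<Rightarrow> real) \<Rightarrow> nat \<Rightarrow> real" where
  "shear F k a = (\<lambda>i. if i < k then a i + a k * best_approx F k i else 0)"

text \<open>The scalar product for which the vectors \<open>unit_vec k - best_approx F k\<close> are
  orthogonal and keep their length with respect to \<open>F\<close>.\<close>

primrec euclid_form :: "((nat \<Rightarrow> real) \<Rightarrow> real) \<Rightarrow> nat \<Rightarrow> (nat \<Rightarrow> real) \<Rightarrow> (nat \<Rightarrow> real) \<Rightarrow> real" where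
  "euclid_form F 0 = (\<lambda>a b. 0)"
| "euclid_form F (Suc k) = (\<lambda>a b. euclid_form F k (shear F k a) (shear F k b) +
     a k * b k * (F (\<lambda>i. unit_vec k i - best_approx F k i))\<^sup>2)"

definition euclid :: "nat \<Rightarrow> ((nat \<Rightarrow> real) \<Rightarrow> real) \<Rightarrow> (nat \<Rightarrow> real) \<Rightarrow> real" where
  "euclid n F = restrict (\<lambda>a. sqrt (euclid_form F n a a)) (Rn n)"

lemma best_approx_Qn: "best_approx F k \<in> Qn k"
  unfolding best_approx_def by (rule from_nat_into) (use Qn_zero in blast)

lemma shear_Rn: "shear F k a \<in> Rn k"
  by (simp add: Rn_iff shear_def)

lemma shear_add: "shear F k (\<lambda>i. a i + b i) = (\<lambda>i. shear F k a i + shear F k b i)"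
  by (auto simp: shear_def algebra_simps)

lemma shear_scale: "shear F k (\<lambda>i. t * a i) = (\<lambda>i. t * shear F k a i)"
  by (auto simp: shear_def algebra_simps)

lemma euclid_form_sym: "euclid_form F k a b = euclid_form F k b a"
  by (induction k arbitrary: a b) (auto simp: mult.commute)

lemma euclid_form_add: "euclid_form F k (\<lambda>i. a i + b i) c = euclid_form F k a c + euclid_form F k b c"
  by (induction k arbitrary: a b c) (simp_all add: shear_add algebra_simps)

lemma euclid_form_scale: "euclid_form F k (\<lambda>i. t * a i) c = t * euclid_form F k a c"
  by (induction k arbitrary: a c) (simp_all add: shear_scale algebra_simps)

lemma euclid_form_nonneg: "0 \<le> euclid_form F k a a"
  by (induction k arbitrary: a) simp_all

lemma sqrt_euclid_form_Suc:
  "sqrt (euclid_form F (Suc k) a a) = sqrt ((sqrt (euclid_form F k (shear F k a) (shear F k a)))\<^sup>2 +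
     (a k * F (\<lambda>i. unit_vec k i - best_approx F k i))\<^sup>2)"
  by (simp add: euclid_form_nonneg power_mult_distrib power2_eq_square[of "a k"])

lemma sqrt_euclid_form_triangle:
  "sqrt (euclid_form F k (\<lambda>i. a i + b i) (\<lambda>i. a i + b i)) \<le>
     sqrt (euclid_form F k a a) + sqrt (euclid_form F k b b)"
proof (induction k arbitrary: a b)
  case (Suc k)
  let ?d = "F (\<lambda>i. unit_vec k i - best_approx F k i)"
  let ?e = "\<lambda>a. sqrt (euclid_form F k (shear F k a) (shear F k a))"
  have "?e (\<lambda>i. a i + b i) \<le> ?e a + ?e b" unfolding shear_add by (rule Suc)
  then have "(?e (\<lambda>i. a i + b i))\<^sup>2 \<le> (?e a + ?e b)\<^sup>2"
    by (rule power_mono) (simp add: euclid_form_nonneg)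
  then have "sqrt (euclid_form F (Suc k) (\<lambda>i. a i + b i) (\<lambda>i. a i + b i))
      \<le> sqrt ((?e a + ?e b)\<^sup>2 + (a k * ?d + b k * ?d)\<^sup>2)"
    unfolding sqrt_euclid_form_Suc by (simp only: distrib_right real_sqrt_le_iff add_le_cancel_right)
  also have "\<dots> \<le> sqrt ((?e a)\<^sup>2 + (a k * ?d)\<^sup>2) + sqrt ((?e b)\<^sup>2 + (b k * ?d)\<^sup>2)"
    by (rule real_sqrt_sum_squares_triangle_ineq)
  finally show ?case unfolding sqrt_euclid_form_Suc .
qed simp

context
  fixes F :: "(nat \<Rightarrow> real) \<Rightarrow> real" and n :: nat
  assumes F: "F \<in> Norms n"
begin

text \<open>The distance of \<open>unit_vec k\<close> from the span is positive, because the
  coordinate with index \<open>k\<close> of every difference is 1. The infimum over rational vectors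
  need not be attained, but a value below twice a positive infimum is; so the least index
  exists.\<close>

lemma best_approx_le_Qn:
  assumes k: "k < n" and r: "r \<in> Qn k"
  shows "F (\<lambda>i. unit_vec k i - best_approx F k i) \<le> 2 * F (\<lambda>i. unit_vec k i - r i)"
proof -
  let ?f = "\<lambda>q. F (\<lambda>i. unit_vec k i - q i)"
  have Rn: "(\<lambda>i. unit_vec k i - q i) \<in> Rn n" if "q \<in> Qn k" for q
    using that k by (intro Rn_diff Rn_unit_vec Qn_Rn Qn_mono[of k n]) auto
  have "\<exists>c>0. \<forall>q\<in>Qn k. c \<le> ?f q"
  proof -
    obtain c where c: "0 < c" "\<And>a. a \<in> Rn n \<Longrightarrow> c * l1 n a \<le> F a" using l1_le_Norms[OF F] by blast
    have "c \<le> ?f q" if q: "q \<in> Qn k" for q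
    proof -
      have "1 \<le> l1 n (\<lambda>i. unit_vec k i - q i)"
        using coord_le_l1[OF k, of "\<lambda>i. unit_vec k i - q i"] q by (simp add: Qn_def Rn_iff unit_vec_def)
      then have "c * 1 \<le> c * l1 n (\<lambda>i. unit_vec k i - q i)" using c(1) by (intro mult_left_mono) auto
      then show ?thesis using c(2)[OF Rn[OF q]] by simp
    qed
    with c(1) show ?thesis by blast
  qed
  then obtain c where c: "0 < c" "\<And>q. q \<in> Qn k \<Longrightarrow> c \<le> ?f q" by blast
  define D where "D = (INF q\<in>Qn k. ?f q)"
  have ne: "Qn k \<noteq> {}" using Qn_zero by blast
  have bdd: "bdd_below (?f ` Qn k)" using c(2) by (rule bdd_belowI2)
  have "c \<le> D" unfolding D_def by (rule cINF_greatest[OF ne c(2)])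
  then have "D < 2 * D" using c(1) by linarith
  then obtain q where q: "q \<in> Qn k" "?f q < 2 * D"
    using cINF_less_iff[OF ne bdd] unfolding D_def[symmetric] by blast
  have "?f q \<le> 2 * ?f r" if "r \<in> Qn k" for r
    using cINF_lower[OF bdd that] q(2) unfolding D_def[symmetric] by linarith
  moreover obtain j where "from_nat_into (Qn k) j = q"
    using from_nat_into_surj[OF countable_Qn q(1)] by blast
  ultimately have "\<exists>j. \<forall>r\<in>Qn k. ?f (from_nat_into (Qn k) j) \<le> 2 * ?f r" by blast
  from LeastI_ex[OF this] show ?thesis using r unfolding best_approx_def by blast
qed

lemma best_approx_le:
  assumes k: "k < n" and a: "a \<in> Rn k"
  shows "F (\<lambda>i. unit_vec k i - best_approx F k i) \<le> 2 * F (\<lambda>i. unit_vec k i - a i)"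
proof (rule field_le_epsilon)
  fix e :: real assume e: "0 < e"
  obtain q where q: "q \<in> Qn k" "F (\<lambda>i. a i - q i) < e / 2"
    using Norms_dense[OF F less_imp_le[OF k] a, of "e / 2"] e by auto
  have Rn: "a \<in> Rn n" "q \<in> Rn n" "unit_vec k \<in> Rn n"
    using a Qn_Rn[OF q(1)] k by (auto intro: Rn_mono[of k n] Rn_unit_vec)
  have "F (\<lambda>i. unit_vec k i - q i) \<le> F (\<lambda>i. unit_vec k i - a i) + F (\<lambda>i. a i - q i)"
    using Norms_triangle[OF F Rn_diff[OF Rn(3,1)] Rn_diff[OF Rn(1,2)]] by simp
  then show "F (\<lambda>i. unit_vec k i - best_approx F k i) \<le> 2 * F (\<lambda>i. unit_vec k i - a i) + e"
    using best_approx_le_Qn[OF k q(1)] q(2) by linarith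
qed

text \<open>\<open>a\<close> and \<open>shear F k a\<close> differ by \<open>a k\<close> times a
  vector of length \<open>d\<close>. For the second estimate, \<open>a\<close> is \<open>a k\<close>
  times the difference of \<open>unit_vec k\<close> and a vector of the span, and an almost best
  approximation costs the factor 2.\<close>

lemma shear_estimates:
  assumes k: "k < n" and a: "a \<in> Rn (Suc k)"
  defines "d \<equiv> F (\<lambda>i. unit_vec k i - best_approx F k i)"
  shows "F a \<le> F (shear F k a) + \<bar>a k\<bar> * d" "\<bar>a k\<bar> * d \<le> 2 * F a" "F (shear F k a) \<le> F a + \<bar>a k\<bar> * d"
proof -
  have P: "(\<lambda>i. unit_vec k i - best_approx F k i) \<in> Rn n"
    using k best_approx_Qn[of F k] by (intro Rn_diff Rn_unit_vec Qn_Rn Qn_mono[of k n]) auto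
  have an: "a \<in> Rn n" using Rn_mono[OF _ a] k by simp
  have sn: "shear F k a \<in> Rn n" using Rn_mono[OF less_imp_le[OF k] shear_Rn] .
  have ak: "a i = 0" if "k < i" for i using a that by (simp add: Rn_iff)
  have Pk: "best_approx F k i = 0" if "k \<le> i" for i using best_approx_Qn[of F k] that by (simp add: Qn_def Rn_iff)
  have eq: "a i - shear F k a i = a k * (unit_vec k i - best_approx F k i)" for i
    using ak[of i] Pk[of i] by (cases "i < k"; cases "i = k") (auto simp: shear_def unit_vec_def algebra_simps)
  have Fd: "F (\<lambda>i. a i - shear F k a i) = \<bar>a k\<bar> * d"
    unfolding eq d_def by (rule Norms_scale[OF F P])
  show "F a \<le> F (shear F k a) + \<bar>a k\<bar> * d" using Norms_diff[OF F an sn] Fd by simp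
  show "F (shear F k a) \<le> F a + \<bar>a k\<bar> * d"
    using Norms_diff[OF F sn an] Fd Norms_minus[OF F an sn] by simp
  show "\<bar>a k\<bar> * d \<le> 2 * F a"
  proof (cases "a k = 0")
    case True
    then show ?thesis using Norms_nonneg[OF F an] by simp
  next
    case False
    define r where "r i = (if i < k then - a i / a k else 0)" for i
    have r: "r \<in> Rn k" by (simp add: Rn_iff r_def)
    have "a = (\<lambda>i. a k * (unit_vec k i - r i))"
      using False ak by (auto simp: r_def unit_vec_def fun_eq_iff not_less le_less)
    moreover have "(\<lambda>i. unit_vec k i - r i) \<in> Rn n"
      using r k by (intro Rn_diff Rn_unit_vec Rn_mono[of k n]) auto
    ultimately have "F a = \<bar>a k\<bar> * F (\<lambda>i. unit_vec k i - r i)"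
      using Norms_scale[OF F, of "\<lambda>i. unit_vec k i - r i" "a k"] by simp
    then show ?thesis
      using mult_left_mono[OF best_approx_le[OF k r], of "\<bar>a k\<bar>"] by (simp add: d_def)
  qed
qed

text \<open>The constants solve C(0) = 1, C(k+1) = 3 C(k) + 2: the sheared vector has norm at most 3
  F(a), which accounts for 3 C(k), and the last coordinate contributes at most 2 F(a).\<close>

lemma euclid_form_equivalent:
  "\<lbrakk>k \<le> n; a \<in> Rn k\<rbrakk> \<Longrightarrow> F a \<le> (2 * 3 ^ k - 1) * sqrt (euclid_form F k a a) \<and>
     sqrt (euclid_form F k a a) \<le> (2 * 3 ^ k - 1) * F a"
proof (induction k arbitrary: a)
  case 0
  then have "a = (\<lambda>i. 0)" by (auto simp: Rn_iff)
  then show ?case by (simp add: Norms_zero[OF F])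
next
  case (Suc k)
  define d where "d = F (\<lambda>i. unit_vec k i - best_approx F k i)"
  define N where "N = sqrt (euclid_form F k (shear F k a) (shear F k a))"
  define t where "t = \<bar>a k\<bar> * d"
  define C where "C = 2 * 3 ^ k - (1::real)"
  have C: "1 \<le> C" by (simp add: C_def)
  have C': "2 * 3 ^ Suc k - (1::real) = 3 * C + 2" by (simp add: C_def)
  have k: "k < n" using Suc.prems by simp
  note est = shear_estimates[OF k Suc.prems(2), folded d_def, folded t_def]
  have IH: "F (shear F k a) \<le> C * N" "N \<le> C * F (shear F k a)"
    using Suc.IH[OF less_imp_le[OF k] shear_Rn] by (simp_all add: C_def N_def)
  have N0: "0 \<le> N" by (simp add: N_def euclid_form_nonneg)
  have d0: "0 \<le> d" unfolding d_def
    using k best_approx_Qn[of F k] by (intro Norms_nonneg[OF F] Rn_diff Rn_unit_vec Qn_Rn Qn_mono[of k n]) auto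
  have t0: "0 \<le> t" using d0 by (simp add: t_def)
  have Fa0: "0 \<le> F a" by (rule Norms_nonneg[OF F Rn_mono[OF Suc.prems]])
  have e: "sqrt (euclid_form F (Suc k) a a) = sqrt (N\<^sup>2 + t\<^sup>2)"
    unfolding sqrt_euclid_form_Suc by (simp add: N_def t_def d_def power_mult_distrib)
  have Ne: "N \<le> sqrt (N\<^sup>2 + t\<^sup>2)" and te: "t \<le> sqrt (N\<^sup>2 + t\<^sup>2)"
    by (rule real_le_rsqrt, simp)+
  have eN: "sqrt (N\<^sup>2 + t\<^sup>2) \<le> N + t"
    by (rule real_le_lsqrt) (use N0 t0 in \<open>auto simp: power2_sum\<close>)
  have "F a \<le> C * sqrt (N\<^sup>2 + t\<^sup>2) + sqrt (N\<^sup>2 + t\<^sup>2)"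
    using est(1) IH(1) te mult_left_mono[OF Ne, of C] C by linarith
  also have "\<dots> \<le> (3 * C + 2) * sqrt (N\<^sup>2 + t\<^sup>2)"
    using C by (simp add: distrib_right[of _ 1, simplified, symmetric] mult_right_mono algebra_simps)
  finally have 1: "F a \<le> (3 * C + 2) * sqrt (N\<^sup>2 + t\<^sup>2)" .
  have "F (shear F k a) \<le> 3 * F a" using est(2,3) by linarith
  from mult_left_mono[OF this, of C] have "N \<le> C * (3 * F a)" using IH(2) C by linarith
  then have 2: "sqrt (N\<^sup>2 + t\<^sup>2) \<le> (3 * C + 2) * F a"
    using eN est(2) by (simp add: algebra_simps)
  from 1 2 show ?case unfolding e C' by blast
qed

lemma euclid_Norms: "euclid n F \<in> Norms n"
proof -
  have pos: "sqrt (euclid_form F n a a) = 0 \<longleftrightarrow> a = (\<lambda>i. 0)" if a: "a \<in> Rn n" for a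
  proof -
    have C: "0 < 2 * 3 ^ n - (1::real)"
      using one_le_power[of "3::real" n] by linarith
    show ?thesis
      using euclid_form_equivalent[OF order_refl a] Norms_nonneg[OF F a] Norms_eq_0_iff[OF F a] C
        real_sqrt_ge_zero[OF euclid_form_nonneg[of F n a]]
      by (auto simp: mult_le_0_iff)
  qed
  show ?thesis
    unfolding Norms_def
  proof (intro CollectI conjI ballI allI)
    show "euclid n F \<in> extensional (Rn n)" by (simp add: euclid_def)
    fix a assume a: "a \<in> Rn n"
    show "0 \<le> euclid n F a" using a by (simp add: euclid_def euclid_form_nonneg)
    show "euclid n F a = 0 \<longleftrightarrow> a = (\<lambda>i. 0)" using a pos[OF a] by (simp add: euclid_def)
    show "euclid n F (\<lambda>i. c * a i) = \<bar>c\<bar> * euclid n F a" for c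
    proof -
      have "euclid_form F n (\<lambda>i. c * a i) (\<lambda>i. c * a i) = c * euclid_form F n (\<lambda>i. c * a i) a"
        unfolding euclid_form_scale[of F n c a "\<lambda>i. c * a i"] by (simp only: euclid_form_sym)
      also have "\<dots> = c\<^sup>2 * euclid_form F n a a" unfolding euclid_form_scale by (simp add: power2_eq_square)
      finally show ?thesis using a Rn_scale[OF a] by (simp add: euclid_def real_sqrt_mult)
    qed
    fix b assume b: "b \<in> Rn n"
    show "euclid n F (\<lambda>i. a i + b i) \<le> euclid n F a + euclid n F b"
      using a b Rn_add[OF a b] by (simp add: euclid_def sqrt_euclid_form_triangle)
  qed
qed

lemma euclid_scalar_product: "norm_from_scalar_product n (euclid n F)"
  unfolding norm_from_scalar_product_def
proof (intro exI[of _ "euclid_form F n"] conjI ballI allI impI)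
  fix a assume a: "a \<in> Rn n"
  show "euclid n F a = sqrt (euclid_form F n a a)" using a by (simp add: euclid_def)
  assume "a \<noteq> (\<lambda>i. 0)"
  then show "0 < euclid_form F n a a"
    using Norms_pos[OF euclid_Norms a] a by (simp add: euclid_def)
qed (simp_all add: euclid_form_add euclid_form_scale euclid_form_sym)

lemma euclid_equivalent:
  assumes "a \<in> Rn n"
  shows "F a \<le> (2 * 3 ^ n - 1) * euclid n F a" "euclid n F a \<le> (2 * 3 ^ n - 1) * F a"
  using euclid_form_equivalent[OF order_refl assms] assms by (simp_all add: euclid_def)

end

text \<open>\<open>best_approx\<close> has values in a countable set and is selected by a least
  index subject to countably many measurable conditions, so it is measurable into a discrete space.
  The recursion defining the form then preserves measurability.\<close>

lemma measurable_euclid: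
  assumes F: "\<And>x. x \<in> space M \<Longrightarrow> F x \<in> Norms n"
    and meas [measurable]: "\<And>q. q \<in> Qn n \<Longrightarrow> (\<lambda>x. F x q) \<in> borel_measurable M"
    and q: "q \<in> Qn n"
  shows "(\<lambda>x. euclid n (F x) q) \<in> borel_measurable M"
proof -
  have ba: "(\<lambda>x. best_approx (F x) k) \<in> M \<rightarrow>\<^sub>M count_space (Qn k)" if k: "k < n" for k
  proof -
    have diff: "(\<lambda>i. unit_vec k i - r i) \<in> Qn n" if "r \<in> Qn k" for r
      using k that by (intro Qn_diff Qn_unit_vec Qn_mono[of k n]) auto
    have en: "from_nat_into (Qn k) j \<in> Qn k" for j by (rule from_nat_into) (use Qn_zero in blast)
    have "{x \<in> space M. \<forall>r\<in>Qn k. F x (\<lambda>i. unit_vec k i - from_nat_into (Qn k) j i) \<le> 2 * F x (\<lambda>i. unit_vec k i - r i)} \<in> sets M" for j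
      using meas[OF diff[OF en]] meas[OF diff] countable_Qn
      by (intro sets.sets_Collect_countable_All' borel_measurable_le borel_measurable_times) auto
    then have "(\<lambda>x. LEAST j. \<forall>r\<in>Qn k. F x (\<lambda>i. unit_vec k i - from_nat_into (Qn k) j i) \<le> 2 * F x (\<lambda>i. unit_vec k i - r i))
      \<in> M \<rightarrow>\<^sub>M count_space UNIV"
      by (intro measurable_Least) (simp add: pred_def)
    then show ?thesis unfolding best_approx_def
      by (rule measurable_compose) (use en in \<open>auto simp: measurable_count_space_eq1\<close>)
  qed
  have bai: "(\<lambda>x. best_approx (F x) k i) \<in> borel_measurable M" if k: "k < n" for k i
    by (rule measurable_compose[OF ba[OF k]]) simp
  \<comment> \<open>The argument must be allowed to depend on \<open>x\<close>: shearing makes even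
    a constant vector do so.\<close>
  have "(\<lambda>x. euclid_form (F x) k (u x) (u x)) \<in> borel_measurable M"
    if "k \<le> n" "\<And>i. (\<lambda>x. u x i) \<in> borel_measurable M" for k u
    using that
  proof (induction k arbitrary: u)
    case (Suc k)
    have k: "k < n" using Suc.prems by simp
    note [measurable] = bai[OF k] Suc.prems(2)
    have [measurable]: "(\<lambda>x. euclid_form (F x) k (shear (F x) k (u x)) (shear (F x) k (u x))) \<in> borel_measurable M"
    proof (rule Suc.IH)
      show "(\<lambda>x. shear (F x) k (u x) i) \<in> borel_measurable M" for i
        unfolding shear_def by measurable
    qed (use k in simp)
    have [measurable]: "(\<lambda>x. F x (\<lambda>i. unit_vec k i - best_approx (F x) k i)) \<in> borel_measurable M"
    proof (rule measurable_Norms_eval[OF F meas])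
      show "(\<lambda>i. unit_vec k i - best_approx (F x) k i) \<in> Rn n" for x
        using k best_approx_Qn[of "F x" k] by (intro Rn_diff Rn_unit_vec Qn_Rn Qn_mono[of k n]) auto
    qed (use k in auto)
    show ?case by simp
  qed simp
  from this[of n "\<lambda>x. q"] show ?thesis using Qn_Rn[OF q] by (simp add: euclid_def)
qed

section \<open>Coordinates\<close>

definition lincomb :: "(nat \<Rightarrow> 'v::real_vector) \<Rightarrow> nat \<Rightarrow> (nat \<Rightarrow> real) \<Rightarrow> 'v" where
  "lincomb b k q = (\<Sum>i<k. q i *\<^sub>R b i)"

lemma lincomb_add: "lincomb b k (\<lambda>i. q i + r i) = lincomb b k q + lincomb b k r"
  by (simp add: lincomb_def scaleR_add_left sum.distrib)

lemma lincomb_diff: "lincomb b k (\<lambda>i. q i - r i) = lincomb b k q - lincomb b k r"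
  by (simp add: lincomb_def scaleR_diff_left sum_subtractf)

lemma lincomb_scale: "lincomb b k (\<lambda>i. c * q i) = c *\<^sub>R lincomb b k q"
  by (simp add: lincomb_def scaleR_sum_right)

lemma lincomb_zero [simp]: "lincomb b k (\<lambda>i. 0) = 0"
  by (simp add: lincomb_def)

lemma lincomb_unit_vec: "i < k \<Longrightarrow> lincomb b k (unit_vec i) = b i"
  by (simp add: lincomb_def unit_vec_def if_distrib[of "\<lambda>t. t *\<^sub>R _"] cong: if_cong)

lemma AE_Qn: "(\<And>q. q \<in> Qn k \<Longrightarrow> AE x in M. P q x) \<Longrightarrow> AE x in M. \<forall>q\<in>Qn k. P q x"
  by (simp add: AE_ball_countable[OF countable_Qn])

context premodule_ge_1
begin

text \<open>A lower bound is required, since mere positivity at nonzero rational vectors would not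
  notice a linear relation with irrational coefficients.\<close>

definition nondegenerate :: "'a set \<Rightarrow> nat \<Rightarrow> (nat \<Rightarrow> 'v) \<Rightarrow> bool" where
  "nondegenerate A k b \<longleftrightarrow>
     (AE x in m. x \<in> A \<longrightarrow> (\<exists>c>0. \<forall>q\<in>Qn k. c * l1 k q \<le> pn (lincomb b k q) x))"

text \<open>Independence of a family instead of a set, which permits induction on \<open>k\<close>
  and appending an element; \<open>locally_independent_tuple\<close> translates.\<close>

definition independent_tuple :: "'a set \<Rightarrow> nat \<Rightarrow> (nat \<Rightarrow> 'v) \<Rightarrow> bool" where
  "independent_tuple A k b \<longleftrightarrow>
     (\<forall>f. (\<forall>i<k. f i \<in> Linf m) \<and> act (indicator A) (\<Sum>i<k. act (f i) (b i)) = 0 \<longrightarrow>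
        (\<forall>i<k. AE x in m. x \<in> A \<longrightarrow> f i x = 0))"

lemma pn_lincomb_triangle:
  "AE x in m. \<forall>q\<in>Qn k. \<forall>r\<in>Qn k. pn (lincomb b k (\<lambda>i. q i + r i)) x \<le> pn (lincomb b k q) x + pn (lincomb b k r) x"
  unfolding lincomb_add by (intro AE_Qn pn_triangle)

lemma pn_lincomb_diff_le:
  "AE x in m. \<forall>q\<in>Qn k. \<forall>s\<in>Qn k.
     pn (lincomb b k (\<lambda>i. q i - s i)) x \<le> pn (v - lincomb b k q) x + pn (v - lincomb b k s) x"
proof (intro AE_Qn)
  fix q s
  show "AE x in m. pn (lincomb b k (\<lambda>i. q i - s i)) x \<le> pn (v - lincomb b k q) x + pn (v - lincomb b k s) x"
    using pn_triangle[of "lincomb b k q - v" "v - lincomb b k s"] pn_minus[of v "lincomb b k q"]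
    by eventually_elim (simp add: lincomb_diff)
qed

lemma AE_Rats: "(\<And>t. t \<in> \<rat> \<Longrightarrow> AE x in m. P t x) \<Longrightarrow> AE x in m. \<forall>t\<in>\<rat>. P t x"
  by (simp add: AE_ball_countable[OF countable_rat])

lemma pn_lincomb_scale:
  "AE x in m. \<forall>t\<in>\<rat>. \<forall>q\<in>Qn k. pn (lincomb b k (\<lambda>i. t * q i)) x = \<bar>t\<bar> * pn (lincomb b k q) x"
  unfolding lincomb_scale by (intro AE_Qn AE_Rats pn_scale)

lemma pn_lincomb_le:
  "AE x in m. \<forall>q\<in>Qn k. pn (lincomb b k q) x \<le> (\<Sum>i<k. pn (b i) x) * l1 k q"
proof (rule AE_Qn)
  fix q
  have "AE x in m. \<forall>i\<in>{..<k}. pn (q i *\<^sub>R b i) x = \<bar>q i\<bar> * pn (b i) x"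
    by (subst AE_ball_countable) (auto intro: pn_scale)
  moreover have "AE x in m. \<forall>i\<in>{..<k}. 0 \<le> pn (b i) x"
    by (subst AE_ball_countable) (auto intro: pn_nonneg)
  moreover have "AE x in m. pn (lincomb b k q) x \<le> (\<Sum>i<k. pn (q i *\<^sub>R b i) x)"
    unfolding lincomb_def by (rule pn_sum)
  ultimately show "AE x in m. pn (lincomb b k q) x \<le> (\<Sum>i<k. pn (b i) x) * l1 k q"
  proof eventually_elim
    case (elim x)
    have "(\<Sum>i<k. pn (q i *\<^sub>R b i) x) = (\<Sum>i<k. \<bar>q i\<bar> * pn (b i) x)" using elim(1) by (intro sum.cong) auto
    also have "\<dots> \<le> (\<Sum>i<k. l1 k q * pn (b i) x)"
      using elim(2) by (intro sum_mono mult_right_mono coord_le_l1) auto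
    also have "\<dots> = (\<Sum>i<k. pn (b i) x) * l1 k q" by (simp add: sum_distrib_left mult.commute)
    finally show ?case using elim(3) by linarith
  qed
qed

end

text \<open>On \<open>A\<close>, the norm \<open>F x\<close> is the pointwise norm at \<open>x\<close> of linear combinations of the \<open>b i\<close>. Only rational
  coefficients, hence countably many null sets, occur.\<close>

locale coordinate_frame = premodule_ge_1 p m nrm act pn
  for p :: ennreal
    and m :: "'a measure"
    and nrm :: "'v::real_vector \<Rightarrow> real"
    and act :: "('a \<Rightarrow> real) \<Rightarrow> 'v \<Rightarrow> 'v"
    and pn :: "'v \<Rightarrow> 'a \<Rightarrow> real" +
  fixes A :: "'a set" and k :: nat and b :: "nat \<Rightarrow> 'v" and F :: "'a \<Rightarrow> (nat \<Rightarrow> real) \<Rightarrow> real"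
  assumes A [measurable]: "A \<in> sets m"
    and F: "F x \<in> Norms k"
    and F_measurable: "q \<in> Qn k \<Longrightarrow> (\<lambda>x. F x q) \<in> borel_measurable m"
    and F_eq: "AE x in m. x \<in> A \<longrightarrow> (\<forall>q\<in>Qn k. pn (lincomb b k q) x = F x q)"
begin

text \<open>The intended meaning is that \<open>v\<close> is the sum of the \<open>b i\<close> with
  coefficients \<open>u x i\<close>, but this sum is not an element of the module if
  \<open>u\<close> is unbounded. Distances to rational combinations express it without forming the
  sum. One inequality determines \<open>u\<close>; it improves to an equality in
  \<open>represents_eq\<close>.\<close>

definition represents :: "'v \<Rightarrow> ('a \<Rightarrow> nat \<Rightarrow> real) \<Rightarrow> bool" where
  "represents v u \<longleftrightarrow> (AE x in m. x \<in> A \<longrightarrow>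
     u x \<in> Rn k \<and> (\<forall>q\<in>Qn k. pn (v - lincomb b k q) x \<le> F x (\<lambda>i. u x i - q i)))"

lemma represents_Rn: "represents v u \<Longrightarrow> AE x in m. x \<in> A \<longrightarrow> u x \<in> Rn k"
  unfolding represents_def by (auto elim!: AE_mp)

lemma represents_cong:
  assumes "represents v u" "AE x in m. x \<in> A \<longrightarrow> u x = w x"
  shows "represents v w"
  using assms unfolding represents_def by eventually_elim auto

text \<open>If \<open>q\<close> is close to \<open>u x\<close>, then \<open>v\<close> is close to
  the combination with coefficients \<open>q\<close> at \<open>x\<close>, whose distance to the one
  with coefficients \<open>s\<close> is the \<open>F x\<close>-length of
  \<open>q - s\<close>.\<close>

lemma represents_eq:
  assumes "represents v u"
  shows "AE x in m. x \<in> A \<longrightarrow> (\<forall>s\<in>Qn k. pn (v - lincomb b k s) x = F x (\<lambda>i. u x i - s i))"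
proof -
  from F_eq assms[unfolded represents_def] pn_lincomb_diff_le[of k b v] show ?thesis
  proof eventually_elim
    case (elim x)
    show ?case
    proof (intro impI ballI antisym)
      fix s assume x: "x \<in> A" and s: "s \<in> Qn k"
      have u: "u x \<in> Rn k" using elim x by blast
      show "pn (v - lincomb b k s) x \<le> F x (\<lambda>i. u x i - s i)" using elim x s by blast
      show "F x (\<lambda>i. u x i - s i) \<le> pn (v - lincomb b k s) x"
      proof (rule field_le_epsilon)
        fix e :: real assume "0 < e"
        then obtain q where q: "q \<in> Qn k" "F x (\<lambda>i. u x i - q i) < e / 2"
          using Norms_dense[OF F order_refl u, of "e / 2"] by auto
        have "F x (\<lambda>i. u x i - s i) \<le> F x (\<lambda>i. u x i - q i) + F x (\<lambda>i. q i - s i)"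
          using Norms_triangle[OF F Rn_diff[OF u Qn_Rn[OF q(1)]] Qn_Rn[OF Qn_diff[OF q(1) s]]] by simp
        moreover have "F x (\<lambda>i. q i - s i) \<le> pn (v - lincomb b k q) x + pn (v - lincomb b k s) x"
          using elim(1,3) x q(1) s Qn_diff[OF q(1) s] by metis
        moreover have "pn (v - lincomb b k q) x \<le> F x (\<lambda>i. u x i - q i)" using elim x q by blast
        ultimately show "F x (\<lambda>i. u x i - s i) \<le> pn (v - lincomb b k s) x + e" using q(2) by linarith
      qed
    qed
  qed
qed

lemma represents_pn:
  assumes "represents v u"
  shows "AE x in m. x \<in> A \<longrightarrow> pn v x = F x (u x)"
  using represents_eq[OF assms] by eventually_elim (use Qn_zero in fastforce)

text \<open>Both coordinate vectors have the same distance to every rational vector, so a vector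
  close to one of them is equally close to the other.\<close>

lemma represents_unique:
  assumes u: "represents v u" and w: "represents v w"
  shows "AE x in m. x \<in> A \<longrightarrow> u x = w x"
  using represents_eq[OF u] represents_eq[OF w] represents_Rn[OF u] represents_Rn[OF w]
proof eventually_elim
  case (elim x)
  show ?case
  proof
    assume x: "x \<in> A"
    with elim have ux: "u x \<in> Rn k" and wx: "w x \<in> Rn k" by auto
    have "F x (\<lambda>i. u x i - w x i) \<le> 0"
    proof (rule field_le_epsilon)
      fix e :: real assume "0 < e"
      then obtain q where q: "q \<in> Qn k" "F x (\<lambda>i. u x i - q i) < e / 2"
        using Norms_dense[OF F order_refl ux, of "e / 2"] by auto
      note qR = Qn_Rn[OF q(1)]
      have "F x (\<lambda>i. w x i - q i) = F x (\<lambda>i. u x i - q i)" using elim(1,2) x q(1) by metis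
      then show "F x (\<lambda>i. u x i - w x i) \<le> 0 + e"
        using Norms_triangle[OF F[of x] Rn_diff[OF ux qR] Rn_diff[OF qR wx]] Norms_minus[OF F[of x] wx qR] q(2) by simp
    qed
    then have "F x (\<lambda>i. u x i - w x i) = 0" using Norms_nonneg[OF F Rn_diff[OF ux wx]] by (rule antisym)
    then have "(\<lambda>i. u x i - w x i) = (\<lambda>i. 0)" using Norms_eq_0_iff[OF F Rn_diff[OF ux wx]] by blast
    then show "u x = w x" by (auto simp: fun_eq_iff)
  qed
qed

text \<open>Splitting \<open>s\<close> into \<open>q\<close> and \<open>s - q\<close> with
  \<open>q\<close> close to \<open>u x\<close> compares each summand with a rational combination of
  its own.\<close>

lemma represents_add:
  assumes u: "represents v u" and w: "represents v' w"
  shows "represents (v + v') (\<lambda>x i. u x i + w x i)"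
proof -
  have "AE x in m. \<forall>q\<in>Qn k. \<forall>s\<in>Qn k. pn (v + v' - lincomb b k s) x \<le> pn (v - lincomb b k q) x + pn (v' - lincomb b k (\<lambda>i. s i - q i)) x"
  proof (intro AE_Qn)
    fix q s
    show "AE x in m. pn (v + v' - lincomb b k s) x \<le> pn (v - lincomb b k q) x + pn (v' - lincomb b k (\<lambda>i. s i - q i)) x"
      using pn_triangle[of "v - lincomb b k q" "v' - lincomb b k (\<lambda>i. s i - q i)"] by (simp add: lincomb_diff algebra_simps)
  qed
  with u[unfolded represents_def] w[unfolded represents_def] show ?thesis
    unfolding represents_def
  proof eventually_elim
    case (elim x)
    show ?case
    proof (intro impI conjI ballI)
      assume x: "x \<in> A"
      with elim have ux: "u x \<in> Rn k" and wx: "w x \<in> Rn k" by auto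
      show "(\<lambda>i. u x i + w x i) \<in> Rn k" by (rule Rn_add[OF ux wx])
      fix s assume s: "s \<in> Qn k"
      show "pn (v + v' - lincomb b k s) x \<le> F x (\<lambda>i. u x i + w x i - s i)"
      proof (rule field_le_epsilon)
        fix e :: real assume "0 < e"
        then obtain q where q: "q \<in> Qn k" "F x (\<lambda>i. u x i - q i) < e / 2"
          using Norms_dense[OF F order_refl ux, of "e / 2"] by auto
        note qR = Qn_Rn[OF q(1)] and sR = Qn_Rn[OF s]
        have "pn (v + v' - lincomb b k s) x \<le> F x (\<lambda>i. u x i - q i) + F x (\<lambda>i. w x i - (s i - q i))"
          using elim x q(1) s Qn_diff[OF s q(1)] by fastforce
        also have "F x (\<lambda>i. w x i - (s i - q i)) \<le> F x (\<lambda>i. u x i + w x i - s i) + F x (\<lambda>i. u x i - q i)"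
          using Norms_triangle[OF F Rn_diff[OF Rn_add[OF ux wx] sR] Rn_diff[OF qR ux]] Norms_minus[OF F ux qR]
          by (simp add: algebra_simps)
        finally show "pn (v + v' - lincomb b k s) x \<le> F x (\<lambda>i. u x i + w x i - s i) + e" using q(2) by simp
      qed
    qed
  qed
qed

text \<open>The factor \<open>f x\<close> varies with \<open>x\<close> and need not be rational. It
  is replaced by rational constants \<open>r\<close>: the error acts with pointwise norm |f - r|
  |v|, and for a constant factor the claim is homogeneity.\<close>

lemma represents_act:
  assumes f: "f \<in> Linf m" and u: "represents v u"
  shows "represents (act f v) (\<lambda>x i. f x * u x i)"
proof -
  have "AE x in m. \<forall>r\<in>\<rat>. \<forall>s\<in>Qn k. r \<noteq> 0 \<longrightarrow>
    pn (act f v - lincomb b k s) x \<le> \<bar>f x - r\<bar> * pn v x + \<bar>r\<bar> * pn (v - lincomb b k (\<lambda>i. (1 / r) * s i)) x"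
  proof (intro AE_Qn AE_Rats)
    fix r s
    have "act (\<lambda>x. f x + (- r)) v = act f v - r *\<^sub>R v"
      using act_add_left[OF f Linf_const[of "- r"], of v] by (simp add: act_const)
    moreover have "AE x in m. pn (act (\<lambda>x. f x + (- r)) v) x = \<bar>f x - r\<bar> * pn v x"
      using pn_act[OF Linf_add[OF f Linf_const[of "- r"]], of v] by simp
    ultimately have 1: "AE x in m. pn (act f v - r *\<^sub>R v) x = \<bar>f x - r\<bar> * pn v x" by simp
    show "AE x in m. r \<noteq> 0 \<longrightarrow> pn (act f v - lincomb b k s) x \<le> \<bar>f x - r\<bar> * pn v x + \<bar>r\<bar> * pn (v - lincomb b k (\<lambda>i. (1 / r) * s i)) x"
    proof (cases "r = 0")
      case False
      have "act f v - r *\<^sub>R v + r *\<^sub>R (v - lincomb b k (\<lambda>i. (1 / r) * s i)) = act f v - lincomb b k s"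
        using False unfolding lincomb_scale by (simp add: scaleR_diff_right)
      from pn_triangle[of "act f v - r *\<^sub>R v" "r *\<^sub>R (v - lincomb b k (\<lambda>i. (1 / r) * s i))", unfolded this]
        1 pn_scale[of r "v - lincomb b k (\<lambda>i. (1 / r) * s i)"]
      show ?thesis by eventually_elim linarith
    qed simp
  qed
  with pn_nonneg[of v] u[unfolded represents_def] show ?thesis
    unfolding represents_def
  proof eventually_elim
    case (elim x)
    show ?case
    proof (intro impI conjI ballI)
      assume x: "x \<in> A"
      with elim have ux: "u x \<in> Rn k" by auto
      show "(\<lambda>i. f x * u x i) \<in> Rn k" by (rule Rn_scale[OF ux])
      fix s assume s: "s \<in> Qn k"
      note sR = Qn_Rn[OF s]
      show "pn (act f v - lincomb b k s) x \<le> F x (\<lambda>i. f x * u x i - s i)"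
      proof (rule field_le_epsilon)
        fix e :: real assume e: "0 < e"
        define K where "K = pn v x + F x (u x) + 1"
        have K: "0 < K" using elim(1) Norms_nonneg[OF F ux] by (simp add: K_def add_nonneg_pos)
        \<comment> \<open>\<open>s\<close> will be divided by \<open>r\<close>; approximating from
          the side away from 0 keeps \<open>r\<close> nonzero.\<close>
        obtain r where r: "r \<in> \<rat>" "r \<noteq> 0" "\<bar>f x - r\<bar> < e / K"
        proof -
          have "\<exists>r\<in>\<rat>. f x < r \<and> r < f x + e / K" "\<exists>r\<in>\<rat>. f x - e / K < r \<and> r < f x"
            using Rats_dense_in_real e K by simp_all
          then show ?thesis
            using that by (cases "f x < 0") (force simp: abs_less_iff)+
        qed
        define s' where "s' = (\<lambda>i. (1 / r) * s i)"
        have s': "s' \<in> Qn k" unfolding s'_def using r s by (intro Qn_scale) simp_all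
        have "pn (act f v - lincomb b k s) x \<le> \<bar>f x - r\<bar> * pn v x + \<bar>r\<bar> * pn (v - lincomb b k s') x"
          using elim(3) r s unfolding s'_def by blast
        also have "\<bar>r\<bar> * pn (v - lincomb b k s') x \<le> \<bar>r\<bar> * F x (\<lambda>i. u x i - s' i)"
          using elim(2) x s' by (intro mult_left_mono) auto
        also have "\<dots> = F x (\<lambda>i. r * u x i - s i)"
          using Norms_scale[OF F Rn_diff[OF ux Qn_Rn[OF s']], of _ r] r(2) by (simp add: s'_def algebra_simps)
        also have "\<dots> \<le> F x (\<lambda>i. f x * u x i - s i) + F x (\<lambda>i. (r - f x) * u x i)"
          using Norms_triangle[OF F Rn_diff[OF Rn_scale[OF ux] sR] Rn_scale[OF ux], of _ "f x" "r - f x"]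
          by (simp add: algebra_simps)
        also have "F x (\<lambda>i. (r - f x) * u x i) = \<bar>f x - r\<bar> * F x (u x)"
          using Norms_scale[OF F ux] by (simp add: abs_minus_commute)
        finally have "pn (act f v - lincomb b k s) x \<le> F x (\<lambda>i. f x * u x i - s i) + \<bar>f x - r\<bar> * (pn v x + F x (u x))"
          by (simp add: algebra_simps)
        also have "\<bar>f x - r\<bar> * (pn v x + F x (u x)) \<le> (e / K) * K"
          using r(3) elim(1) Norms_nonneg[OF F ux] by (intro mult_mono) (auto simp: K_def)
        finally show "pn (act f v - lincomb b k s) x \<le> F x (\<lambda>i. f x * u x i - s i) + e" using K by simp
      qed
    qed
  qed
qed

lemma represents_lincomb:
  assumes q: "q \<in> Qn k"
  shows "represents (lincomb b k q) (\<lambda>x. q)"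
  using F_eq unfolding represents_def
proof eventually_elim
  case (elim x)
  then show ?case
    using q by (simp add: lincomb_diff[symmetric] Qn_Rn Qn_diff)
qed

lemma represents_sum:
  assumes "\<And>i. i \<in> I \<Longrightarrow> represents (v i) (u i)"
  shows "represents (\<Sum>i\<in>I. v i) (\<lambda>x j. \<Sum>i\<in>I. u i x j)"
  using assms
proof (induction I rule: infinite_finite_induct)
  case (insert i I)
  then show ?case using represents_add[of "v i" "u i" "\<Sum>i\<in>I. v i" "\<lambda>x j. \<Sum>i\<in>I. u i x j"] by simp
qed (use represents_lincomb[OF Qn_zero] in simp_all)

lemma represents_act_sum:
  assumes f: "\<And>i. i < k \<Longrightarrow> f i \<in> Linf m"
  shows "represents (\<Sum>i<k. act (f i) (b i)) (\<lambda>x i. if i < k then f i x else 0)"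
proof -
  have "represents (act (f i) (b i)) (\<lambda>x j. f i x * unit_vec i j)" if "i < k" for i
    using represents_act[OF f[OF that] represents_lincomb[OF Qn_unit_vec[OF that]]] that
    by (simp add: lincomb_unit_vec)
  then have "represents (\<Sum>i<k. act (f i) (b i)) (\<lambda>x j. \<Sum>i<k. f i x * unit_vec i j)"
    by (intro represents_sum) auto
  moreover have "(\<Sum>i<k. f i x * unit_vec i j) = (if j < k then f j x else 0)" for x j
    by (auto simp: unit_vec_def if_distrib cong: if_cong)
  ultimately show ?thesis by simp
qed

text \<open>At each point take the first rational vector whose combination is within
  \<open>inverse (Suc j)\<close> of \<open>v\<close>. As \<open>F x\<close> controls the
  coordinates, these vectors form a Cauchy sequence at almost every point of \<open>A\<close>; their
  limit is measurable because least indices are.\<close>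

lemma represents_exists:
  assumes approx: "AE x in m. x \<in> A \<longrightarrow> (\<forall>e>0. \<exists>q\<in>Qn k. pn (v - lincomb b k q) x < e)"
  obtains u where "represents v u" "\<And>x. u x \<in> Rn k" "\<And>i. (\<lambda>x. u x i) \<in> borel_measurable m"
proof -
  define en where "en = from_nat_into (Qn k)"
  have en: "en j \<in> Qn k" for j unfolding en_def by (rule from_nat_into) (use Qn_zero in blast)
  define c where "c j x = (LEAST l. pn (v - lincomb b k (en l)) x < inverse (Suc j))" for j x
  define q where "q j x = en (c j x)" for j x
  \<comment> \<open>\<open>lim\<close> is total, so \<open>u\<close> is measurable on the whole
    space, whatever happens off \<open>A\<close> and at exceptional points.\<close>
  define u where "u x i = lim (\<lambda>j. q j x i)" for x i
  have q: "q j x \<in> Qn k" for j x unfolding q_def by (rule en)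
  have [measurable]: "c j \<in> m \<rightarrow>\<^sub>M count_space UNIV" for j
    unfolding c_def by measurable
  have qm: "(\<lambda>x. q j x i) \<in> borel_measurable m" for j i
    unfolding q_def by (rule measurable_compose[of "c j" _ "count_space UNIV"]) simp_all
  have "represents v u"
  proof -
    note pn_lincomb_diff_le[of k b v]
    moreover have "AE x in m. \<forall>q\<in>Qn k. \<forall>s\<in>Qn k. pn (v - lincomb b k s) x \<le> pn (v - lincomb b k q) x + pn (lincomb b k (\<lambda>i. q i - s i)) x"
    proof (intro AE_Qn)
      fix q s
      show "AE x in m. pn (v - lincomb b k s) x \<le> pn (v - lincomb b k q) x + pn (lincomb b k (\<lambda>i. q i - s i)) x"
        using pn_triangle[of "v - lincomb b k q" "lincomb b k (\<lambda>i. q i - s i)"] by (simp add: lincomb_diff)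
    qed
    ultimately show ?thesis
      using F_eq approx unfolding represents_def
    proof eventually_elim
      case (elim x)
      show ?case
      proof (intro impI conjI)
        assume x: "x \<in> A"
        have qx: "pn (v - lincomb b k (q j x)) x < inverse (Suc j)" for j
        proof -
          obtain r where "r \<in> Qn k" "pn (v - lincomb b k r) x < inverse (Suc j)"
            using elim(4) x by (metis inverse_positive_iff_positive of_nat_0_less_iff zero_less_Suc)
          moreover from this(1) obtain l where "en l = r"
            using from_nat_into_surj[OF countable_Qn] unfolding en_def by metis
          ultimately have "\<exists>l. pn (v - lincomb b k (en l)) x < inverse (Suc j)" by blast
          from LeastI_ex[OF this] show ?thesis by (simp add: q_def c_def)
        qed
        obtain d where d: "0 < d" "\<And>a. a \<in> Rn k \<Longrightarrow> d * l1 k a \<le> F x a" using l1_le_Norms[OF F] by blast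
        have Fq: "F x (\<lambda>i. q j x i - q l x i) \<le> inverse (Suc j) + inverse (Suc l)" for j l
        proof -
          have "F x (\<lambda>i. q j x i - q l x i) = pn (lincomb b k (\<lambda>i. q j x i - q l x i)) x"
            using elim(3) x Qn_diff[OF q q] by metis
          also have "\<dots> \<le> pn (v - lincomb b k (q j x)) x + pn (v - lincomb b k (q l x)) x"
            using elim(1) q by blast
          finally show ?thesis using qx[of j] qx[of l] by linarith
        qed
        have lim: "(\<lambda>j. q j x i) \<longlonglongrightarrow> u x i" for i
        proof (cases "i < k")
          case True
          have "Cauchy (\<lambda>j. q j x i)"
          proof (rule metric_CauchyI)
            fix e :: real assume "0 < e"
            then have "0 < d * e / 2" using d(1) by simp
            then obtain M where M: "inverse (real (Suc M)) < d * e / 2" using reals_Archimedean by blast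
            show "\<exists>M. \<forall>j\<ge>M. \<forall>l\<ge>M. dist (q j x i) (q l x i) < e"
            proof (intro exI[of _ M] allI impI)
              fix j l assume "M \<le> j" "M \<le> l"
              then have "inverse (real (Suc j)) \<le> inverse (real (Suc M))" "inverse (real (Suc l)) \<le> inverse (real (Suc M))"
                by (auto intro!: le_imp_inverse_le)
              with Fq[of j l] M have Fe: "F x (\<lambda>i. q j x i - q l x i) < d * e" by linarith
              have "d * \<bar>q j x i - q l x i\<bar> \<le> d * l1 k (\<lambda>i. q j x i - q l x i)"
                using d(1) coord_le_l1[OF True, of "\<lambda>i. q j x i - q l x i"] by (intro mult_left_mono) auto
              also have "\<dots> < d * e" using d(2)[OF Qn_Rn[OF Qn_diff[OF q q]], of j x l x] Fe by linarith
              finally show "dist (q j x i) (q l x i) < e" using d(1) by (simp add: dist_real_def)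
            qed
          qed
          then show ?thesis unfolding u_def by (simp add: Cauchy_convergent_iff convergent_LIMSEQ_iff)
        next
          case False
          then have "q j x i = 0" for j using q[of j x] by (simp add: Qn_def Rn_iff)
          then show ?thesis unfolding u_def by simp
        qed
        have "u x i = 0" if "k \<le> i" for i
        proof -
          have "q j x i = 0" for j using q[of j x] that by (simp add: Qn_def Rn_iff)
          then show ?thesis unfolding u_def by simp
        qed
        then show ux: "u x \<in> Rn k" by (simp add: Rn_iff)
        define K where "K = (\<Sum>i<k. F x (unit_vec i))"
        have "(\<lambda>j. K * l1 k (\<lambda>i. q j x i - u x i)) \<longlonglongrightarrow> K * l1 k (\<lambda>i. u x i - u x i)"
          unfolding l1_def by (intro tendsto_intros lim)
        then have l0: "(\<lambda>j. inverse (Suc j) + K * l1 k (\<lambda>i. q j x i - u x i)) \<longlonglongrightarrow> 0"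
          using tendsto_add[OF LIMSEQ_inverse_real_of_nat] by (fastforce simp: l1_def)
        show "\<forall>s\<in>Qn k. pn (v - lincomb b k s) x \<le> F x (\<lambda>i. u x i - s i)"
        proof
          fix s assume s: "s \<in> Qn k"
          have "pn (v - lincomb b k s) x - F x (\<lambda>i. u x i - s i) \<le> inverse (Suc j) + K * l1 k (\<lambda>i. q j x i - u x i)" for j
          proof -
            have "pn (v - lincomb b k s) x \<le> pn (v - lincomb b k (q j x)) x + pn (lincomb b k (\<lambda>i. q j x i - s i)) x"
              using elim(2) q s by blast
            also have "pn (lincomb b k (\<lambda>i. q j x i - s i)) x = F x (\<lambda>i. q j x i - s i)"
              using elim(3) x Qn_diff[OF q s] by metis
            also have "\<dots> \<le> F x (\<lambda>i. q j x i - u x i) + F x (\<lambda>i. u x i - s i)"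
              using Norms_triangle[OF F Rn_diff[OF Qn_Rn[OF q] ux] Rn_diff[OF ux Qn_Rn[OF s]]] by simp
            also have "F x (\<lambda>i. q j x i - u x i) \<le> K * l1 k (\<lambda>i. q j x i - u x i)"
              unfolding K_def by (rule Norms_le_l1[OF F Rn_diff[OF Qn_Rn[OF q] ux]])
            finally show ?thesis using qx[of j] by linarith
          qed
          then have "pn (v - lincomb b k s) x - F x (\<lambda>i. u x i - s i) \<le> 0"
            by (intro LIMSEQ_le_const[OF l0]) blast
          then show "pn (v - lincomb b k s) x \<le> F x (\<lambda>i. u x i - s i)" by simp
        qed
      qed
    qed
  qed
  moreover have "u x \<in> Rn k" for x
  proof -
    have "u x i = 0" if "k \<le> i" for i
    proof -
      have "q j x i = 0" for j using q[of j x] that by (simp add: Qn_def Rn_iff)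
      then show ?thesis unfolding u_def by simp
    qed
    then show ?thesis by (simp add: Rn_iff)
  qed
  moreover have "(\<lambda>x. u x i) \<in> borel_measurable m" for i
    unfolding u_def by (rule borel_measurable_lim_metric[OF qm])
  ultimately show ?thesis by (rule that)
qed

end

section \<open>Independence and nondegeneracy\<close>

context premodule_ge_1
begin

lemma nondegenerate_imp_frame:
  assumes A [measurable]: "A \<in> sets m" and nd: "nondegenerate A k b"
  obtains F where "coordinate_frame p m nrm act pn A k b F"
proof -
  let ?g = "\<lambda>x q. pn (lincomb b k q) x"
  have "AE x in m. x \<in> A \<longrightarrow> (\<exists>H\<in>Norms k. \<forall>q\<in>Qn k. H q = ?g x q)"
    using nd[unfolded nondegenerate_def] pn_lincomb_triangle[of k b] pn_lincomb_scale[of k b] pn_lincomb_le[of k b]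
  proof eventually_elim
    case (elim x)
    show ?case
    proof
      assume "x \<in> A"
      then obtain c where c: "0 < c" "\<And>q. q \<in> Qn k \<Longrightarrow> c * l1 k q \<le> ?g x q" using elim(1) by blast
      show "\<exists>H\<in>Norms k. \<forall>q\<in>Qn k. H q = ?g x q"
        by (rule seminorm_extension[OF c, where K = "\<Sum>i<k. pn (b i) x"]) (use elim in blast)+
    qed
  qed
  then obtain N where N: "\<And>x. x \<in> space m - N \<Longrightarrow> x \<in> A \<longrightarrow> (\<exists>H\<in>Norms k. \<forall>q\<in>Qn k. H q = ?g x q)"
    and [measurable]: "N \<in> null_sets m"
    by (auto elim!: AE_E3)
  \<comment> \<open>The \<open>l1\<close> norm fills the remaining points, so that
    \<open>F x\<close> is a norm for every \<open>x\<close>. The choice does not endanger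
    measurability, since the values at rational vectors are prescribed.\<close>
  define F where "F x = (if x \<in> A - N then SOME H. H \<in> Norms k \<and> (\<forall>q\<in>Qn k. H q = ?g x q)
    else restrict (l1 k) (Rn k))" for x
  have good: "F x \<in> Norms k \<and> (\<forall>q\<in>Qn k. F x q = ?g x q)" if "x \<in> A - N" for x
  proof -
    have "x \<in> space m" using that sets.sets_into_space[OF A] by blast
    with N[of x] that have "\<exists>H. H \<in> Norms k \<and> (\<forall>q\<in>Qn k. H q = ?g x q)" by blast
    from someI_ex[OF this] that show ?thesis by (simp add: F_def)
  qed
  have "coordinate_frame p m nrm act pn A k b F"
  proof
    show "A \<in> sets m" by fact
    show "F x \<in> Norms k" for x
      using good[of x] l1_Norms[of k] by (cases "x \<in> A - N") (auto simp: F_def)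
    show "(\<lambda>x. F x q) \<in> borel_measurable m" if q: "q \<in> Qn k" for q
    proof -
      have "F x q = (if x \<in> A - N then ?g x q else l1 k q)" for x
        using good[of x] q Qn_Rn[OF q] by (cases "x \<in> A - N") (auto simp: F_def)
      moreover have "N \<in> sets m" using \<open>N \<in> null_sets m\<close> by blast
      ultimately show ?thesis by simp
    qed
    show "AE x in m. x \<in> A \<longrightarrow> (\<forall>q\<in>Qn k. ?g x q = F x q)"
      using AE_not_in[OF \<open>N \<in> null_sets m\<close>] by eventually_elim (use good in auto)
  qed
  then show ?thesis by (rule that)
qed

lemma nondegenerate_mono: "\<lbrakk>nondegenerate A k b; B \<subseteq> A\<rbrakk> \<Longrightarrow> nondegenerate B k b"
  unfolding nondegenerate_def by (auto elim!: AE_mp)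

lemma nondegenerate_cong:
  assumes "nondegenerate A k b" "\<And>i. i < k \<Longrightarrow> b i = b' i"
  shows "nondegenerate A k b'"
  using assms by (simp add: nondegenerate_def lincomb_def)

text \<open>The coefficients are the coordinates of the combination, and a norm vanishes at 0
  only.\<close>

lemma nondegenerate_independent:
  assumes A: "A \<in> sets m" and nd: "nondegenerate A k b"
  shows "independent_tuple A k b"
  unfolding independent_tuple_def
proof (intro allI impI)
  fix f i assume "(\<forall>i<k. f i \<in> Linf m) \<and> act (indicator A) (\<Sum>i<k. act (f i) (b i)) = 0" and i: "i < k"
  then have f: "\<And>i. i < k \<Longrightarrow> f i \<in> Linf m" and 0: "act (indicator A) (\<Sum>i<k. act (f i) (b i)) = 0" by auto
  obtain F where "coordinate_frame p m nrm act pn A k b F" using nondegenerate_imp_frame[OF A nd] .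
  then interpret coordinate_frame p m nrm act pn A k b F .
  have "AE x in m. x \<in> A \<longrightarrow> pn (\<Sum>i<k. act (f i) (b i)) x = F x (\<lambda>i. if i < k then f i x else 0)"
    by (rule represents_pn[OF represents_act_sum[OF f]])
  with 0[unfolded act_indicator_eq_0_iff[OF A]] show "AE x in m. x \<in> A \<longrightarrow> f i x = 0"
  proof eventually_elim
    case (elim x)
    show ?case
    proof
      assume "x \<in> A"
      then have "F x (\<lambda>i. if i < k then f i x else 0) = 0" using elim by simp
      moreover have "(\<lambda>i. if i < k then f i x else 0) \<in> Rn k" by (simp add: Rn_iff)
      ultimately have "(\<lambda>i. if i < k then f i x else 0) = (\<lambda>i. 0)" using Norms_eq_0_iff[OF F] by blast
      then show "f i x = 0" using i by meson
    qed
  qed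
qed

text \<open>The points where \<open>v\<close> lies in the closure of the span for the seminorm at
  \<open>x\<close>; rational coefficients and the radii \<open>inverse (Suc j)\<close> make this a
  measurable set.\<close>

definition near_span :: "nat \<Rightarrow> (nat \<Rightarrow> 'v) \<Rightarrow> 'v \<Rightarrow> 'a set" where
  "near_span k b v = {x \<in> space m. \<forall>j::nat. \<exists>q\<in>Qn k. pn (v - lincomb b k q) x < inverse (Suc j)}"

lemma near_span_sets [measurable]: "near_span k b v \<in> sets m"
proof -
  have "{x \<in> space m. pn (v - lincomb b k q) x < c} \<in> sets m" for q c by measurable
  then show ?thesis unfolding near_span_def
    by (intro sets.sets_Collect_countable_All sets.sets_Collect_countable_Ex' countable_Qn)
qed

lemma near_spanD: "\<lbrakk>x \<in> near_span k b v; 0 < e\<rbrakk> \<Longrightarrow> \<exists>q\<in>Qn k. pn (v - lincomb b k q) x < e"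
  unfolding near_span_def using reals_Archimedean[of e] by (force intro: less_trans)

lemma not_near_spanD:
  "\<lbrakk>x \<in> space m; x \<notin> near_span k b v\<rbrakk> \<Longrightarrow> \<exists>d>0. \<forall>q\<in>Qn k. d \<le> pn (v - lincomb b k q) x"
proof -
  assume "x \<in> space m" "x \<notin> near_span k b v"
  then obtain j :: nat where "\<forall>q\<in>Qn k. inverse (Suc j) \<le> pn (v - lincomb b k q) x"
    unfolding near_span_def by (auto simp: not_less)
  then show ?thesis by (intro exI[of _ "inverse (Suc j)"]) simp
qed

text \<open>Dividing a combination of norm \<open>P\<close> by \<open>q k\<close> compares
  \<open>b k\<close> with a rational combination of its predecessors, so \<open>q k\<close> is at
  most \<open>P / d\<close> in absolute value. Subtracting the last term leaves a combination to
  which the hypothesis for \<open>k\<close> applies.\<close>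

lemma nondegenerate_Suc:
  assumes nd: "nondegenerate A k b" and far: "AE x in m. x \<in> A \<longrightarrow> x \<notin> near_span k b (b k)"
  shows "nondegenerate A (Suc k) b"
proof -
  have scale: "AE x in m. \<forall>t\<in>\<rat>. \<forall>q\<in>Qn k. pn (t *\<^sub>R (b k - lincomb b k q)) x = \<bar>t\<bar> * pn (b k - lincomb b k q) x"
    by (intro AE_Rats AE_Qn pn_scale)
  have tri: "AE x in m. \<forall>q\<in>Qn (Suc k). pn (lincomb b k q) x \<le> pn (lincomb b (Suc k) q) x + \<bar>q k\<bar> * pn (b k) x"
  proof (rule AE_Qn)
    fix q
    have "lincomb b (Suc k) q + (- q k) *\<^sub>R b k = lincomb b k q" by (simp add: lincomb_def)
    with pn_triangle[of "lincomb b (Suc k) q" "(- q k) *\<^sub>R b k"] pn_scale[of "- q k" "b k"]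
    show "AE x in m. pn (lincomb b k q) x \<le> pn (lincomb b (Suc k) q) x + \<bar>q k\<bar> * pn (b k) x"
      by (auto elim!: AE_mp)
  qed
  have pos: "AE x in m. \<forall>q\<in>Qn (Suc k). 0 \<le> pn (lincomb b (Suc k) q) x"
    by (intro AE_Qn pn_nonneg)
  from nd[unfolded nondegenerate_def] far scale tri pos pn_nonneg[of "b k"] AE_space
  show ?thesis unfolding nondegenerate_def
  proof eventually_elim
    case (elim x)
    show ?case
    proof
      assume x: "x \<in> A"
      obtain c where c: "0 < c" "\<And>q. q \<in> Qn k \<Longrightarrow> c * l1 k q \<le> pn (lincomb b k q) x" using elim(1) x by blast
      obtain d where d: "0 < d" "\<And>q. q \<in> Qn k \<Longrightarrow> d \<le> pn (b k - lincomb b k q) x"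
        using not_near_spanD[of x k b "b k"] elim(2,7) x by blast
      define g where "g = pn (b k) x"
      have g: "0 \<le> g" using elim(6) by (simp add: g_def)
      define M where "M = (1 + g / d) / c + 1 / d"
      have M: "0 < M" using c(1) d(1) g by (simp add: M_def add_pos_nonneg add_nonneg_pos)
      have "l1 (Suc k) q \<le> M * pn (lincomb b (Suc k) q) x" if q: "q \<in> Qn (Suc k)" for q
      proof -
        define P where "P = pn (lincomb b (Suc k) q) x"
        define q' where "q' i = (if i < k then q i else 0)" for i
        have q': "q' \<in> Qn k" using q by (simp add: q'_def Qn_def Rn_iff)
        have lq: "lincomb b k q' = lincomb b k q" by (simp add: lincomb_def q'_def)
        have P0: "0 \<le> P" using elim(5) q by (simp add: P_def)
        have t: "\<bar>q k\<bar> \<le> P / d"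
        proof (cases "q k = 0")
          case True
          then show ?thesis using P0 d(1) by simp
        next
          case False
          define r where "r i = (- 1 / q k) * q' i" for i
          have qk: "q k \<in> \<rat>" using q by (simp add: Qn_def)
          then have "r \<in> Qn k" unfolding r_def by (intro Qn_scale q') simp
          have "lincomb b k r = (- 1 / q k) *\<^sub>R lincomb b k q'" unfolding r_def by (rule lincomb_scale)
          then have "q k *\<^sub>R (b k - lincomb b k r) = lincomb b (Suc k) q"
            using False lq by (simp add: scaleR_diff_right scaleR_right_distrib lincomb_def)
          then have "P = \<bar>q k\<bar> * pn (b k - lincomb b k r) x"
            using elim(3) qk \<open>r \<in> Qn k\<close> unfolding P_def by metis
          also have "\<dots> \<ge> \<bar>q k\<bar> * d" using d(2)[OF \<open>r \<in> Qn k\<close>] by (intro mult_left_mono) auto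
          finally show ?thesis using d(1) by (simp add: field_simps)
        qed
        have "c * l1 k q' \<le> P + \<bar>q k\<bar> * g"
          using c(2)[OF q'] elim(4) q unfolding lq P_def g_def by fastforce
        also have "\<dots> \<le> P + P / d * g" using t g by (intro add_left_mono mult_right_mono) auto
        finally have "l1 k q' \<le> (P + P / d * g) / c" using c(1) by (simp add: field_simps)
        moreover have "l1 (Suc k) q = l1 k q' + \<bar>q k\<bar>" by (simp add: l1_def q'_def)
        ultimately have "l1 (Suc k) q \<le> (P + P / d * g) / c + P / d" using t by linarith
        also have "\<dots> = M * P" using c(1) d(1) by (simp add: M_def field_simps)
        finally show ?thesis by (simp add: P_def)
      qed
      then show "\<exists>c>0. \<forall>q\<in>Qn (Suc k). c * l1 (Suc k) q \<le> pn (lincomb b (Suc k) q) x"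
        using M by (intro exI[of _ "1 / M"]) (auto simp: field_simps)
    qed
  qed
qed

lemma independent_tuple_lower:
  assumes "independent_tuple A (Suc k) b"
  shows "independent_tuple A k b"
  unfolding independent_tuple_def
proof (intro allI impI)
  fix f i assume f: "(\<forall>i<k. f i \<in> Linf m) \<and> act (indicator A) (\<Sum>i<k. act (f i) (b i)) = 0" and i: "i < k"
  define g where "g i = (if i < k then f i else (\<lambda>x. 0))" for i
  have "(\<Sum>i<Suc k. act (g i) (b i)) = (\<Sum>i<k. act (f i) (b i))"
    by (simp add: g_def act_const)
  then have "(\<forall>i<Suc k. g i \<in> Linf m) \<and> act (indicator A) (\<Sum>i<Suc k. act (g i) (b i)) = 0"
    using f by (simp add: g_def)
  then have "AE x in m. x \<in> A \<longrightarrow> g i x = 0"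
    using assms i unfolding independent_tuple_def by (meson less_SucI)
  then show "AE x in m. x \<in> A \<longrightarrow> f i x = 0" using i by (simp add: g_def)
qed

text \<open>On \<open>Z\<close> the element \<open>b k\<close> has measurable coordinates
  \<open>u\<close> with respect to its predecessors. On a subset \<open>B\<close> where
  \<open>u\<close> is bounded, 1 and the negative coordinates are admissible coefficients of a
  vanishing combination, so independence makes \<open>B\<close> null; countably many such sets
  exhaust \<open>Z\<close>.\<close>

lemma independent_far_from_span:
  assumes A [measurable]: "A \<in> sets m" and ind: "independent_tuple A (Suc k) b" and nd: "nondegenerate A k b"
  shows "AE x in m. x \<in> A \<longrightarrow> x \<notin> near_span k b (b k)"
proof -
  define Z where "Z = A \<inter> near_span k b (b k)"
  have Z [measurable]: "Z \<in> sets m" unfolding Z_def by measurable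
  have "nondegenerate Z k b" using nd by (rule nondegenerate_mono) (auto simp: Z_def)
  then obtain F where "coordinate_frame p m nrm act pn Z k b F" using nondegenerate_imp_frame[OF Z] by blast
  then interpret coordinate_frame p m nrm act pn Z k b F .
  have "AE x in m. x \<in> Z \<longrightarrow> (\<forall>e>0. \<exists>q\<in>Qn k. pn (b k - lincomb b k q) x < e)"
    by (rule AE_I2) (auto simp: Z_def intro: near_spanD)
  then obtain u where u: "represents (b k) u" "\<And>x. u x \<in> Rn k" and [measurable]: "\<And>i. (\<lambda>x. u x i) \<in> borel_measurable m"
    using represents_exists by blast
  have "AE x in m. x \<in> Z \<longrightarrow> \<not> l1 k (u x) \<le> real N" for N
  proof -
    define B where "B = {x \<in> space m. x \<in> Z \<and> l1 k (u x) \<le> real N}"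
    have B [measurable]: "B \<in> sets m" unfolding B_def l1_def by measurable
    define f where "f i x = (if i < k then - (indicator B x * u x i) else indicator B x)" for i x
    have f: "f i \<in> Linf m" if "i < Suc k" for i
    proof -
      have "\<bar>f i x\<bar> \<le> max 1 (real N)" for x
        using coord_le_l1[of i k "u x"] by (cases "x \<in> B") (auto simp: f_def B_def)
      then show ?thesis unfolding Linf_iff
        by (intro conjI exI[of _ "max 1 (real N)"] AE_I2) (cases "i < k"; simp add: f_def[abs_def])
    qed
    define w where "w = (\<Sum>i<Suc k. act (f i) (b i))"
    have rep_w: "represents w (\<lambda>x i. (if i < k then f i x else 0) + f k x * u x i)"
      unfolding w_def sum.lessThan_Suc by (intro represents_add represents_act_sum represents_act u f) auto
    have zero: "(\<lambda>i. (if i < k then f i x else 0) + f k x * u x i) = (\<lambda>i. 0)" for x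
      using u(2)[of x] by (auto simp: f_def Rn_iff)
    have wZ: "AE x in m. x \<in> Z \<longrightarrow> pn w x = 0"
      using represents_pn[OF rep_w] unfolding zero Norms_zero[OF F] .
    \<comment> \<open>Coordinates control \<open>w\<close> on \<open>Z\<close> only; elsewhere all
      coefficients are 0.\<close>
    have "AE x in m. \<forall>i\<in>{..<Suc k}. pn (act (f i) (b i)) x = \<bar>f i x\<bar> * pn (b i) x"
      by (subst AE_ball_countable) (auto intro!: pn_act f)
    moreover have "AE x in m. pn w x \<le> (\<Sum>i<Suc k. pn (act (f i) (b i)) x)"
      unfolding w_def by (rule pn_sum)
    ultimately have "AE x in m. pn w x = 0"
      using wZ pn_nonneg[of w]
    proof eventually_elim
      case (elim x)
      show ?case
      proof (cases "x \<in> Z")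
        case False
        then have "f i x = 0" for i by (simp add: f_def B_def)
        then have "(\<Sum>i<Suc k. pn (act (f i) (b i)) x) = 0" using elim(1) by (intro sum.neutral) simp
        then show ?thesis using elim by simp
      qed (use elim in simp)
    qed
    then have "act (indicator A) w = 0" using eq_0_iff_pn[of w] by simp
    then have "AE x in m. x \<in> A \<longrightarrow> f k x = 0"
      using ind f unfolding independent_tuple_def w_def by blast
    with AE_space show ?thesis
      by eventually_elim (auto simp: f_def B_def Z_def indicator_def split: if_splits)
  qed
  then have "AE x in m. \<forall>N. x \<in> Z \<longrightarrow> \<not> l1 k (u x) \<le> real N"
    unfolding AE_all_countable by blast
  then show ?thesis
  proof eventually_elim
    case (elim x)
    obtain N where "l1 k (u x) \<le> real N" using real_arch_simple by blast
    then show ?case using elim by (auto simp: Z_def)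
  qed
qed

lemma independent_nondegenerate:
  assumes A: "A \<in> sets m" and ind: "independent_tuple A k b"
  shows "nondegenerate A k b"
  using ind
proof (induction k)
  case 0
  have "AE x in m. \<forall>q\<in>Qn 0. 0 \<le> pn (lincomb b 0 q) x" by (intro AE_Qn pn_nonneg)
  then show ?case unfolding nondegenerate_def
    by eventually_elim (auto simp: l1_def intro!: exI[of _ 1])
next
  case (Suc k)
  have nd: "nondegenerate A k b" by (rule Suc.IH[OF independent_tuple_lower[OF Suc.prems]])
  show ?case by (rule nondegenerate_Suc[OF nd independent_far_from_span[OF A Suc.prems nd]])
qed

section \<open>Maximal independent sets\<close>

lemma locally_independent_mono:
  assumes "locally_independent m act A V" "W \<subseteq> V"
  shows "locally_independent m act A W"
  using assms(1) unfolding locally_independent_def by (meson assms(2) subset_trans)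

lemma locally_independent_tuple:
  assumes b: "bij_betw b {..<k} V"
  shows "locally_independent m act A V \<longleftrightarrow> independent_tuple A k b"
proof
  assume L: "locally_independent m act A V"
  show "independent_tuple A k b"
    unfolding independent_tuple_def
  proof (intro allI impI)
    fix f i assume f: "(\<forall>i<k. f i \<in> Linf m) \<and> act (indicator A) (\<Sum>i<k. act (f i) (b i)) = 0" and i: "i < k"
    define g where "g v = f (the_inv_into {..<k} b v)" for v
    have gb: "g (b i) = f i" if "i < k" for i
      using that b by (simp add: g_def the_inv_into_f_f bij_betw_def)
    have "(\<Sum>v\<in>V. act (g v) v) = (\<Sum>i<k. act (g (b i)) (b i))"
      by (rule sum.reindex_bij_betw[OF b, symmetric])
    also have "\<dots> = (\<Sum>i<k. act (f i) (b i))" by (intro sum.cong) (auto simp: gb)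
    finally have "act (indicator A) (\<Sum>v\<in>V. act (g v) v) = 0" using f by simp
    moreover have "\<forall>v\<in>V. g v \<in> Linf m" using f gb bij_betw_imp_surj_on[OF b] by auto
    moreover have "finite V" using bij_betw_finite[OF b] by simp
    ultimately have "\<forall>v\<in>V. AE x in m. x \<in> A \<longrightarrow> g v x = 0"
      using L unfolding locally_independent_def by blast
    then show "AE x in m. x \<in> A \<longrightarrow> f i x = 0" using gb[OF i] i bij_betw_apply[OF b, of i] by fastforce
  qed
next
  assume T: "independent_tuple A k b"
  show "locally_independent m act A V"
    unfolding locally_independent_def
  proof (intro allI impI ballI)
    fix S f v
    assume f: "finite S \<and> S \<subseteq> V \<and> (\<forall>v\<in>S. f v \<in> Linf m) \<and> act (indicator A) (\<Sum>v\<in>S. act (f v) v) = 0" and v: "v \<in> S"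
    define g where "g i = (if b i \<in> S then f (b i) else (\<lambda>x. 0))" for i
    have "(\<Sum>i<k. act (g i) (b i)) = (\<Sum>v\<in>V. act (if v \<in> S then f v else (\<lambda>x. 0)) v)"
      unfolding g_def by (rule sum.reindex_bij_betw[OF b])
    also have "\<dots> = (\<Sum>v\<in>S. act (f v) v)"
      using f bij_betw_finite[OF b] by (intro sum.mono_neutral_cong_right) (auto simp: act_const)
    finally have "act (indicator A) (\<Sum>i<k. act (g i) (b i)) = 0" using f by simp
    moreover have "\<forall>i<k. g i \<in> Linf m" using f by (simp add: g_def)
    ultimately have *: "\<forall>i<k. AE x in m. x \<in> A \<longrightarrow> g i x = 0"
      using T unfolding independent_tuple_def by blast
    obtain i where "i < k" "b i = v" using v f bij_betw_imp_surj_on[OF b] by blast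
    with * v show "AE x in m. x \<in> A \<longrightarrow> f v x = 0" by (fastforce simp: g_def)
  qed
qed

text \<open>Otherwise the coefficients 1 and -1 form a relation, and on a set of positive measure
  they do not vanish almost everywhere.\<close>

lemma locally_independent_inj:
  assumes A: "A \<in> sets m" "0 < emeasure m A" and V: "locally_independent m act A V"
    and vw: "v \<in> V" "w \<in> V" "act (indicator A) v = act (indicator A) w"
  shows "v = w"
proof (rule ccontr)
  assume ne: "v \<noteq> w"
  define f :: "'v \<Rightarrow> 'a \<Rightarrow> real" where "f u = (if u = v then (\<lambda>x. 1) else (\<lambda>x. - 1))" for u
  have "(\<Sum>u\<in>{v, w}. act (f u) u) = v - w" using ne by (simp add: f_def act_const)
  then have "act (indicator A) (\<Sum>u\<in>{v, w}. act (f u) u) = 0" using vw A by (simp add: act_diff_right)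
  moreover have "finite {v, w}" "{v, w} \<subseteq> V" "\<forall>u\<in>{v, w}. f u \<in> Linf m" using vw by (auto simp: f_def)
  ultimately have "\<forall>u\<in>{v, w}. AE x in m. x \<in> A \<longrightarrow> f u x = 0"
    using V unfolding locally_independent_def by blast
  then have "AE x in m. x \<notin> A" by (simp add: f_def)
  then have "emeasure m A = 0" using A(1) by (simp add: AE_iff_null_sets null_setsD1)
  then show False using A(2) by simp
qed

text \<open>This lemma and the next one say that independence on \<open>A\<close> sees only the
  truncations of the elements to \<open>A\<close>, as long as truncation is injective.\<close>

lemma locally_independent_image_indicator:
  assumes A: "A \<in> sets m" "0 < emeasure m A" and V: "locally_independent m act A V"
  shows "locally_independent m act A (act (indicator A) ` V)"
  unfolding locally_independent_def
proof (intro allI impI ballI)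
  fix S f v
  assume f: "finite S \<and> S \<subseteq> act (indicator A) ` V \<and> (\<forall>v\<in>S. f v \<in> Linf m) \<and> act (indicator A) (\<Sum>v\<in>S. act (f v) v) = 0"
    and v: "v \<in> S"
  have "inj_on (act (indicator A)) V"
    using locally_independent_inj[OF A V] by (rule inj_onI)
  obtain S' where S': "S' \<subseteq> V" "finite S'" "S = act (indicator A) ` S'"
    using finite_subset_image[of S "act (indicator A)" V] f by blast
  have inj: "inj_on (act (indicator A)) S'" using \<open>inj_on (act (indicator A)) V\<close> S'(1) by (rule inj_on_subset)
  define g where "g v = f (act (indicator A) v)" for v
  have g: "\<forall>v\<in>S'. g v \<in> Linf m" using f S' by (auto simp: g_def)
  have "act (indicator A) (\<Sum>v\<in>S. act (f v) v) = (\<Sum>v\<in>S'. act (indicator A) (act (g v) (act (indicator A) v)))"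
    using A(1) by (simp add: S'(3) sum.reindex[OF inj] act_sum_right g_def)
  also have "\<dots> = (\<Sum>v\<in>S'. act (indicator A) (act (g v) v))"
  proof (rule sum.cong[OF refl])
    fix v assume "v \<in> S'"
    then have "act (g v) (act (indicator A) v) = act (indicator A) (act (g v) v)"
      using g A(1) by (intro act_commute) auto
    then show "act (indicator A) (act (g v) (act (indicator A) v)) = act (indicator A) (act (g v) v)"
      using A(1) by (simp add: act_indicator_Int)
  qed
  also have "\<dots> = act (indicator A) (\<Sum>v\<in>S'. act (g v) v)" using A(1) by (simp add: act_sum_right)
  finally have "act (indicator A) (\<Sum>v\<in>S'. act (g v) v) = 0" using f by simp
  then have *: "\<forall>v\<in>S'. AE x in m. x \<in> A \<longrightarrow> g v x = 0"
    using V S' g unfolding locally_independent_def by blast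
  obtain v' where "v' \<in> S'" "v = act (indicator A) v'" using v S' by blast
  with * show "AE x in m. x \<in> A \<longrightarrow> f v x = 0" by (simp add: g_def)
qed

lemma locally_independent_preimage_indicator:
  assumes A: "A \<in> sets m" and inj: "inj_on (act (indicator A)) V"
    and I: "locally_independent m act A (act (indicator A) ` V)"
  shows "locally_independent m act A V"
  unfolding locally_independent_def
proof (intro allI impI ballI)
  fix S f v
  assume f: "finite S \<and> S \<subseteq> V \<and> (\<forall>v\<in>S. f v \<in> Linf m) \<and> act (indicator A) (\<Sum>v\<in>S. act (f v) v) = 0" and v: "v \<in> S"
  have injS: "inj_on (act (indicator A)) S" using f inj by (blast intro: inj_on_subset)
  define g where "g w = f (the_inv_into S (act (indicator A)) w)" for w
  have gA: "g (act (indicator A) v) = f v" if "v \<in> S" for v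
    using that injS by (simp add: g_def the_inv_into_f_f)
  have "act (indicator A) (\<Sum>w\<in>act (indicator A) ` S. act (g w) w)
      = (\<Sum>v\<in>S. act (indicator A) (act (f v) (act (indicator A) v)))"
    using A by (simp add: sum.reindex[OF injS] act_sum_right gA)
  also have "\<dots> = (\<Sum>v\<in>S. act (indicator A) (act (f v) v))"
  proof (rule sum.cong[OF refl])
    fix v assume "v \<in> S"
    then have "act (f v) (act (indicator A) v) = act (indicator A) (act (f v) v)"
      using f A by (intro act_commute) auto
    then show "act (indicator A) (act (f v) (act (indicator A) v)) = act (indicator A) (act (f v) v)"
      using A by (simp add: act_indicator_Int)
  qed
  also have "\<dots> = act (indicator A) (\<Sum>v\<in>S. act (f v) v)" using A by (simp add: act_sum_right)
  finally have "act (indicator A) (\<Sum>w\<in>act (indicator A) ` S. act (g w) w) = 0" using f by simp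
  moreover have "finite (act (indicator A) ` S)" "act (indicator A) ` S \<subseteq> act (indicator A) ` V"
    "\<forall>w\<in>act (indicator A) ` S. g w \<in> Linf m" using f gA by auto
  ultimately have "\<forall>w\<in>act (indicator A) ` S. AE x in m. x \<in> A \<longrightarrow> g w x = 0"
    using I unfolding locally_independent_def by blast
  then show "AE x in m. x \<in> A \<longrightarrow> f v x = 0" using v gA by fastforce
qed

text \<open>Zorn's lemma yields a maximal \<open>W\<close> whose elements need not vanish off
  \<open>A\<close>, while the dimensional decomposition counts only sets whose elements do. The
  truncation of \<open>W\<close> is still maximal: an element enlarging it would also enlarge
  \<open>W\<close>. The conclusion is phrased through \<open>W\<close> because the truncation need
  not contain \<open>V\<close>.\<close>

lemma maximal_locally_independent_exists:
  assumes A: "A \<in> sets m" "0 < emeasure m A" and V: "locally_independent m act A V"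
  obtains W where "V \<subseteq> W" "inj_on (act (indicator A)) W"
    "maximal_locally_independent m act A (act (indicator A) ` W)"
proof -
  let ?L = "{W. V \<subseteq> W \<and> locally_independent m act A W}"
  have "\<exists>W\<in>?L. \<forall>X\<in>?L. W \<subseteq> X \<longrightarrow> X = W"
  proof (rule subset_Zorn_nonempty)
    show "?L \<noteq> {}" using V by blast
    fix C assume C: "C \<noteq> {}" "subset.chain ?L C"
    have "locally_independent m act A (\<Union>C)"
      unfolding locally_independent_def
    proof (intro allI impI)
      fix S f
      assume f: "finite S \<and> S \<subseteq> \<Union>C \<and> (\<forall>v\<in>S. f v \<in> Linf m) \<and> act (indicator A) (\<Sum>v\<in>S. act (f v) v) = 0"
      then obtain W where "W \<in> C" "S \<subseteq> W"
        using finite_subset_Union_chain[of S C ?L] C by blast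
      moreover from this C(2) have "locally_independent m act A W" by (auto simp: subset_chain_def)
      ultimately show "\<forall>v\<in>S. AE x in m. x \<in> A \<longrightarrow> f v x = 0"
        using f unfolding locally_independent_def by blast
    qed
    moreover have "V \<subseteq> \<Union>C"
    proof -
      obtain W where "W \<in> C" using C(1) by blast
      moreover from this have "V \<subseteq> W" using C(2) by (auto simp: subset_chain_def)
      ultimately show ?thesis by blast
    qed
    ultimately show "\<Union>C \<in> ?L" by blast
  qed
  then obtain W where W': "W \<in> ?L" and max': "\<forall>X\<in>?L. W \<subseteq> X \<longrightarrow> X = W" by (rule bexE)
  from W' have W: "V \<subseteq> W" "locally_independent m act A W" by simp_all
  have max: "X = W" if "V \<subseteq> X" "locally_independent m act A X" "W \<subseteq> X" for X
    using max' that by simp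
  let ?a = "act (indicator A)"
  have inj: "inj_on ?a W" using locally_independent_inj[OF A W(2)] by (rule inj_onI)
  have "maximal_locally_independent m act A (?a ` W)"
    unfolding maximal_locally_independent_def
  proof (intro conjI allI impI)
    show "locally_independent m act A (?a ` W)" by (rule locally_independent_image_indicator[OF A W(2)])
    fix U assume U: "?a ` W \<subseteq> U \<and> locally_independent m act A U"
    show "U = ?a ` W"
    proof (rule ccontr)
      assume "U \<noteq> ?a ` W"
      with U obtain u where u: "u \<in> U" "u \<notin> ?a ` W" by blast
      have aa: "?a (?a v) = ?a v" for v using A(1) by (simp add: act_indicator_Int)
      \<comment> \<open>Otherwise \<open>u\<close> and the truncation of \<open>w\<close>, both in
        the independent set \<open>U\<close>, agree on \<open>A\<close> and hence are equal.\<close>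
      have au: "?a u \<noteq> ?a w" if "w \<in> W" for w
      proof
        assume "?a u = ?a w"
        then have "?a u = ?a (?a w)" by (simp add: aa)
        then have "u = ?a w" using locally_independent_inj[OF A, of U u "?a w"] U u that by blast
        then show False using u that by blast
      qed
      have "u \<notin> W" using au by blast
      have "locally_independent m act A (insert u W)"
      proof (rule locally_independent_preimage_indicator[OF A(1)])
        show "inj_on ?a (insert u W)" unfolding inj_on_insert using inj au by (metis DiffD1 imageE)
        have "insert u (?a ` W) \<subseteq> U" using U u by blast
        then have "locally_independent m act A (insert u (?a ` W))"
          using U locally_independent_mono by blast
        from locally_independent_image_indicator[OF A this]
        show "locally_independent m act A (?a ` insert u W)" by (simp add: image_image aa)
      qed
      then have "insert u W = W" using max[of "insert u W"] W(1) by blast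
      then show False using \<open>u \<notin> W\<close> by blast
    qed
  qed
  with W(1) inj show ?thesis by (rule that)
qed

end

section \<open>Products of vector-valued Lebesgue spaces\<close>

text \<open>The case met throughout: the sets \<open>E n\<close> are disjoint, so at every point at
  most one component of a product is nonzero.\<close>

lemma lp_sum_single:
  assumes p: "1 \<le> p" and a: "\<And>k. k \<noteq> n \<Longrightarrow> a k = 0" "0 \<le> a n"
  shows "lp_finite p a" "lp_sum p a = a n"
proof -
  have "lp_finite p a \<and> lp_sum p a = a n"
  proof (cases "p = \<infinity>")
    case True
    have le: "a k \<le> a n" for k using a by (cases "k = n") auto
    then have "(SUP k. a k) = a n" by (intro cSup_eq_maximum) auto
    moreover have "bdd_above (range a)" using le by (rule bdd_aboveI2)
    ultimately show ?thesis using True by (simp add: lp_finite_def lp_sum_def)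
  next
    case False
    define q where "q = enn2real p"
    have q: "1 \<le> q" using enn2real_ge_1[OF p False] by (simp add: q_def)
    have sums: "(\<lambda>k. a k powr q) sums (\<Sum>k\<in>{n}. a k powr q)"
      by (rule sums_finite) (use a q in auto)
    then have "(\<Sum>k. a k powr q) = a n powr q" by (simp add: sums_iff)
    moreover have "(a n powr q) powr (1 / q) = a n" using a(2) q by (simp add: powr_powr)
    ultimately show ?thesis using False sums by (simp add: lp_finite_def lp_sum_def q_def sums_iff)
  qed
  then show "lp_finite p a" "lp_sum p a = a n" by auto
qed

lemma Lp_space_restrict:
  assumes E: "E \<in> sets m" and g: "g \<in> Lp_space p m"
  shows "g \<in> Lp_space p (restrict_space m E)"
proof -
  have E': "E \<inter> space m \<in> sets m" using E by simp
  have gm: "g \<in> borel_measurable (restrict_space m E)"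
    using g by (intro measurable_restrict_space1 Lp_space_measurable)
  show ?thesis
  proof (cases "p = \<infinity>")
    case True
    from g obtain c where "AE x in m. \<bar>g x\<bar> \<le> c" unfolding True by (auto simp: Linf_iff)
    then have "AE x in restrict_space m E. \<bar>g x\<bar> \<le> c"
      unfolding AE_restrict_space_iff[OF E'] by eventually_elim simp
    then show ?thesis using gm unfolding True Linf_iff by blast
  next
    case False
    then have "integrable m (\<lambda>x. \<bar>g x\<bar> powr enn2real p)" using g by (simp add: Lp_space_def)
    then have "integrable m (\<lambda>x. indicator E x *\<^sub>R (\<bar>g x\<bar> powr enn2real p))"
      by (rule integrable_mult_indicator[OF E])
    then show ?thesis using gm False by (simp add: Lp_space_def integrable_restrict_space[OF E'])
  qed
qed

text \<open>Separated from the module because it is used twice, for the given norms and for the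
  Euclidean ones. The norms are defined at every point, also off \<open>E n\<close>.\<close>

locale norm_field =
  fixes p :: ennreal and m :: "'a measure" and E :: "nat \<Rightarrow> 'a set" and F :: "nat \<Rightarrow> 'a \<Rightarrow> (nat \<Rightarrow> real) \<Rightarrow> real"
  assumes exponent: "1 \<le> p"
    and E_sets [measurable]: "E n \<in> sets m"
    and E_disjoint: "disjoint_family E"
    and E_cover: "AE x in m. x \<in> (\<Union>n. E n)"
    and F_Norms: "F n x \<in> Norms n"
    and F_Qn_measurable: "q \<in> Qn n \<Longrightarrow> (\<lambda>x. F n x q) \<in> borel_measurable m"
begin

text \<open>Representatives without integrability: linear operations and measurability are settled
  here independently of the norms, and \<open>product_repsI\<close> supplies the rest.\<close>

definition section_reps :: "(nat \<Rightarrow> 'a \<Rightarrow> nat \<Rightarrow> real) set" where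
  "section_reps = {u. \<forall>n. (\<forall>x\<in>E n. u n x \<in> Rn n) \<and>
     (\<forall>i<n. (\<lambda>x. u n x i) \<in> borel_measurable (restrict_space m (E n)))}"

lemma section_Rn: "\<lbrakk>u \<in> section_reps; x \<in> E n\<rbrakk> \<Longrightarrow> u n x \<in> Rn n"
  by (simp add: section_reps_def)

lemma section_measurable: "\<lbrakk>u \<in> section_reps; i < n\<rbrakk> \<Longrightarrow> (\<lambda>x. u n x i) \<in> borel_measurable (restrict_space m (E n))"
  by (simp add: section_reps_def)

lemma section_add: "\<lbrakk>u \<in> section_reps; w \<in> section_reps\<rbrakk> \<Longrightarrow> (\<lambda>n x i. u n x i + w n x i) \<in> section_reps"
  unfolding section_reps_def by (auto intro: Rn_add borel_measurable_add)

lemma section_mult: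
  assumes f: "f \<in> borel_measurable m" and u: "u \<in> section_reps"
  shows "(\<lambda>n x i. f x * u n x i) \<in> section_reps"
  unfolding section_reps_def
proof (intro CollectI allI conjI ballI impI)
  show "(\<lambda>i. f x * u n x i) \<in> Rn n" if "x \<in> E n" for n x
    by (rule Rn_scale[OF section_Rn[OF u that]])
  show "(\<lambda>x. f x * u n x i) \<in> borel_measurable (restrict_space m (E n))" if "i < n" for n i
    using section_measurable[OF u that] measurable_restrict_space1[OF f] by (rule borel_measurable_times[rotated])
qed

lemma product_pn_eq:
  assumes "u \<in> section_reps" "x \<in> E n"
  shows "Lp_product_pn p E F u x = F n x (u n x)"
proof -
  have "x \<notin> E k" if "k \<noteq> n" for k using E_disjoint assms(2) that by (auto simp: disjoint_family_on_def)
  then have "vector_Lp_pn (E k) (F k) (u k) x = 0" if "k \<noteq> n" for k using that by (simp add: vector_Lp_pn_def)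
  moreover have n: "vector_Lp_pn (E n) (F n) (u n) x = F n x (u n x)" using assms by (simp add: vector_Lp_pn_def)
  moreover have "0 \<le> F n x (u n x)" by (rule Norms_nonneg[OF F_Norms section_Rn[OF assms]])
  ultimately show ?thesis
    unfolding Lp_product_pn_def using lp_sum_single(2)[OF exponent, of n "\<lambda>k. vector_Lp_pn (E k) (F k) (u k) x"] by simp
qed

lemma vector_single:
  assumes u: "u \<in> section_reps"
  obtains n where "\<And>k. k \<noteq> n \<Longrightarrow> vector_Lp_pn (E k) (F k) (u k) x = 0" "0 \<le> vector_Lp_pn (E n) (F n) (u n) x"
proof (cases "\<exists>n. x \<in> E n")
  case True
  then obtain n where n: "x \<in> E n" by blast
  have "x \<notin> E k" if "k \<noteq> n" for k using E_disjoint n that by (auto simp: disjoint_family_on_def)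
  then show ?thesis
    using that[of n] n Norms_nonneg[OF F_Norms section_Rn[OF u n]] by (simp add: vector_Lp_pn_def)
next
  case False
  then show ?thesis using that[of 0] by (simp add: vector_Lp_pn_def)
qed

lemma F_Norms_borel: "F n \<in> restrict_space m (E n) \<rightarrow>\<^sub>M Norms_borel n"
  by (rule measurable_Norms_borel[OF F_Norms]) (rule measurable_restrict_space1[OF F_Qn_measurable])

lemma norm_field_eval_measurable:
  assumes u: "u \<in> section_reps"
  shows "(\<lambda>x. F n x (u n x)) \<in> borel_measurable (restrict_space m (E n))"
proof (rule measurable_Norms_eval[OF F_Norms])
  show "(\<lambda>x. F n x q) \<in> borel_measurable (restrict_space m (E n))" if "q \<in> Qn n" for q
    by (rule measurable_restrict_space1[OF F_Qn_measurable[OF that]])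
qed (use u section_Rn section_measurable in \<open>auto simp: space_restrict_space\<close>)

lemma product_pn_measurable:
  assumes u: "u \<in> section_reps"
  shows "Lp_product_pn p E F u \<in> borel_measurable m"
proof -
  have h: "vector_Lp_pn (E n) (F n) (u n) \<in> borel_measurable m" for n
  proof -
    have "(\<lambda>x. indicator (E n) x *\<^sub>R F n x (u n x)) \<in> borel_measurable m"
      using norm_field_eval_measurable[OF u, of n] by (subst (asm) borel_measurable_restrict_space_iff) auto
    also have "(\<lambda>x. indicator (E n) x *\<^sub>R F n x (u n x)) = vector_Lp_pn (E n) (F n) (u n)"
      by (auto simp: vector_Lp_pn_def)
    finally show ?thesis .
  qed
  \<comment> \<open>With at most one nonzero term, the \<open>lp_sum\<close> is also an ordinary
    series, whose measurability is immediate.\<close>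
  have "Lp_product_pn p E F u x = (\<Sum>n. vector_Lp_pn (E n) (F n) (u n) x)" for x
  proof -
    obtain n where n: "\<And>k. k \<noteq> n \<Longrightarrow> vector_Lp_pn (E k) (F k) (u k) x = 0" "0 \<le> vector_Lp_pn (E n) (F n) (u n) x"
      using vector_single[OF u] by blast
    have "(\<lambda>k. vector_Lp_pn (E k) (F k) (u k) x) sums (\<Sum>k\<in>{n}. vector_Lp_pn (E k) (F k) (u k) x)"
      by (rule sums_finite) (use n in auto)
    then show ?thesis
      using lp_sum_single(2)[OF exponent, of n "\<lambda>k. vector_Lp_pn (E k) (F k) (u k) x"] n
      by (simp add: Lp_product_pn_def sums_iff)
  qed
  then have "Lp_product_pn p E F u = (\<lambda>x. \<Sum>n. vector_Lp_pn (E n) (F n) (u n) x)" by blast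
  then show ?thesis using h by simp
qed

text \<open>A single dominating function settles integrability of each component and of the product
  norm.\<close>

lemma product_repsI:
  assumes u: "u \<in> section_reps" and g: "g \<in> Lp_space p m"
    and le: "\<And>n. AE x in m. x \<in> E n \<longrightarrow> F n x (u n x) \<le> \<bar>g x\<bar>"
  shows "u \<in> Lp_product_reps p m E F"
  unfolding Lp_product_reps_def
proof (intro CollectI conjI allI)
  fix n
  have "(\<lambda>x. F n x (u n x)) \<in> Lp_space p (restrict_space m (E n))"
  proof (rule Lp_dominated[OF Lp_space_restrict[OF E_sets g] norm_field_eval_measurable[OF u]])
    have "AE x in m. x \<in> E n \<longrightarrow> \<bar>F n x (u n x)\<bar> \<le> \<bar>g x\<bar>"
      using le[of n] by eventually_elim (use Norms_nonneg[OF F_Norms section_Rn[OF u]] in auto)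
    then show "AE x in restrict_space m (E n). \<bar>F n x (u n x)\<bar> \<le> \<bar>g x\<bar>"
      by (subst AE_restrict_space_iff) auto
  qed
  then show "u n \<in> vector_Lp p m (E n) n (F n)"
    using u by (simp add: vector_Lp_def section_reps_def)
next
  show "AE x in m. lp_finite p (\<lambda>n. vector_Lp_pn (E n) (F n) (u n) x)"
  proof (rule AE_I2)
    fix x
    obtain n where n: "\<And>k. k \<noteq> n \<Longrightarrow> vector_Lp_pn (E k) (F k) (u k) x = 0" "0 \<le> vector_Lp_pn (E n) (F n) (u n) x"
      using vector_single[OF u] by blast
    show "lp_finite p (\<lambda>n. vector_Lp_pn (E n) (F n) (u n) x)" 
      by (rule lp_sum_single(1)[OF exponent, of n]) (use n in auto)
  qed
  show "Lp_product_pn p E F u \<in> Lp_space p m"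
  proof (rule Lp_dominated[OF g product_pn_measurable[OF u]])
    have "AE x in m. \<forall>n. x \<in> E n \<longrightarrow> F n x (u n x) \<le> \<bar>g x\<bar>"
      unfolding AE_all_countable using le by blast
    with E_cover show "AE x in m. \<bar>Lp_product_pn p E F u x\<bar> \<le> \<bar>g x\<bar>"
    proof eventually_elim
      case (elim x)
      then obtain n where n: "x \<in> E n" by blast
      then show ?case
        using elim(2) product_pn_eq[OF u n] Norms_nonneg[OF F_Norms section_Rn[OF u n]] by auto
    qed
  qed
qed

lemma product_reps_section: "u \<in> Lp_product_reps p m E F \<Longrightarrow> u \<in> section_reps"
  by (auto simp: Lp_product_reps_def vector_Lp_def section_reps_def)

text \<open>Used in both directions: uniformly equivalent norms have the same representatives, so
  that one map can be the isometry for both.\<close>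

lemma product_reps_equivalent:
  assumes G: "norm_field p m E G"
    and le: "\<And>n. AE x in m. x \<in> E n \<longrightarrow> (\<forall>a\<in>Rn n. G n x a \<le> C * F n x a)"
  shows "Lp_product_reps p m E F \<subseteq> Lp_product_reps p m E G"
proof
  interpret G: norm_field p m E G by (rule G)
  fix u assume u: "u \<in> Lp_product_reps p m E F"
  note us = product_reps_section[OF u]
  have "Lp_product_pn p E F u \<in> Lp_space p m" using u by (simp add: Lp_product_reps_def)
  then have "(\<lambda>x. C * Lp_product_pn p E F u x) \<in> Lp_space p m" by (rule Lp_scale)
  then show "u \<in> Lp_product_reps p m E G"
  proof (rule G.product_repsI[rotated])
    show "u \<in> G.section_reps" using us by (simp add: section_reps_def G.section_reps_def)
    show "AE x in m. x \<in> E n \<longrightarrow> G n x (u n x) \<le> \<bar>C * Lp_product_pn p E F u x\<bar>" for n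
      using le[of n]
    proof eventually_elim
      case (elim x)
      show ?case
      proof
        assume x: "x \<in> E n"
        then have "G n x (u n x) \<le> C * F n x (u n x)" using elim section_Rn[OF us x] by blast
        then show "G n x (u n x) \<le> \<bar>C * Lp_product_pn p E F u x\<bar>" using product_pn_eq[OF us x] by simp
      qed
    qed
  qed
qed

end

section \<open>The isometry\<close>

locale decomposed_module = Lp_normed_module p m nrm act pn + premodule_ge_1 p m nrm act pn
  for p :: ennreal
    and m :: "'a measure"
    and nrm :: "'v::real_vector \<Rightarrow> real"
    and act :: "('a \<Rightarrow> real) \<Rightarrow> 'v \<Rightarrow> 'v"
    and pn :: "'v \<Rightarrow> 'a \<Rightarrow> real" +
  fixes E :: "nat \<Rightarrow> 'a set" and Einf :: "'a set"
  assumes decomposition: "dimensional_decomposition m act pn E Einf"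
begin

lemma sets_E [measurable]: "E n \<in> sets m"
  and disjoint_E: "disjoint_family E"
  using decomposition by (auto simp: dimensional_decomposition_def)

lemma AE_E: "AE x in m. x \<in> (\<Union>n. E n)"
proof -
  have "Einf \<in> null_sets m" and sp: "(\<Union>n. E n) \<union> Einf = space m"
    using decomposition by (auto simp: dimensional_decomposition_def)
  from AE_not_in[OF this(1)] AE_space show ?thesis by eventually_elim (use sp in blast)
qed

text \<open>The decomposition prescribes the size of maximal sets only. \<open>V\<close> extends to
  a set \<open>W\<close> whose truncation is maximal, and truncation is injective on
  \<open>W\<close>, so sizes can be compared.\<close>

lemma dimension_bound:
  assumes A: "A \<in> sets m" "A \<subseteq> E n" "0 < emeasure m A" and V: "locally_independent m act A V"
  shows "finite V \<and> card V \<le> n"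
    and "\<exists>W. finite W \<and> card W = n \<and> locally_independent m act A W"
proof -
  let ?a = "act (indicator A)"
  obtain W where W: "V \<subseteq> W" "inj_on ?a W" "maximal_locally_independent m act A (?a ` W)"
    using maximal_locally_independent_exists[OF A(1,3) V] .
  have "AE x in m. x \<notin> A \<longrightarrow> pn v x = 0" if "v \<in> ?a ` W" for v
  proof -
    obtain w where w: "v = ?a w" using \<open>v \<in> ?a ` W\<close> by (rule imageE)
    show ?thesis unfolding w using pn_indicator[OF A(1), of w] by eventually_elim simp
  qed
  then have supp: "\<forall>v\<in>?a ` W. AE x in m. x \<notin> A \<longrightarrow> pn v x = 0" by (rule ballI)
  have "\<forall>n. \<forall>A \<in> sets m. A \<subseteq> E n \<and> emeasure m A > 0 \<longrightarrow>
      (\<forall>V. maximal_locally_independent m act A V \<and> (\<forall>v\<in>V. AE x in m. x \<notin> A \<longrightarrow> pn v x = 0) \<longrightarrow>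
        finite V \<and> card V = n)"
    using decomposition unfolding dimensional_decomposition_def by (elim conjE)
  from this[THEN spec, THEN bspec, OF A(1), THEN mp, OF conjI[OF A(2,3)], THEN spec, THEN mp, OF conjI[OF W(3) supp]]
  have fin: "finite (?a ` W)" "card (?a ` W) = n" by (rule conjunct1, rule conjunct2)
  then have "finite W" "card W = n" using W(2) by (auto simp: card_image dest: finite_imageD)
  then show "finite V \<and> card V \<le> n" using W(1) by (auto intro: card_mono finite_subset)
  show "\<exists>W. finite W \<and> card W = n \<and> locally_independent m act A W"
    using fin W(3) unfolding maximal_locally_independent_def by blast
qed

lemma independent_tuple_inj:
  assumes A: "A \<in> sets m" "0 < emeasure m A" and b: "independent_tuple A k b"
  shows "inj_on b {..<k}"
proof (rule inj_onI, rule ccontr)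
  fix i j assume ij: "i \<in> {..<k}" "j \<in> {..<k}" "b i = b j" "i \<noteq> j"
  define f :: "nat \<Rightarrow> 'a \<Rightarrow> real" where "f l = (if l = i then (\<lambda>x. 1) else if l = j then (\<lambda>x. - 1) else (\<lambda>x. 0))" for l
  have "(\<Sum>l<k. act (f l) (b l)) = (\<Sum>l\<in>{i, j}. act (f l) (b l))"
    using ij by (intro sum.mono_neutral_right) (auto simp: f_def act_const)
  also have "\<dots> = 0" using ij by (simp add: f_def act_const)
  finally have "act (indicator A) (\<Sum>l<k. act (f l) (b l)) = 0" using A(1) by simp
  moreover have "\<forall>l<k. f l \<in> Linf m" by (simp add: f_def)
  ultimately have "AE x in m. x \<in> A \<longrightarrow> f i x = 0" using b ij unfolding independent_tuple_def by blast
  then have "AE x in m. x \<notin> A" by (simp add: f_def)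
  then show False using A by (simp add: AE_iff_null_sets[symmetric] null_setsD1)
qed

text \<open>An element staying away from the span on a set of positive measure could be appended to
  the basis there, giving \<open>n + 1\<close> independent elements on a subset of
  \<open>E n\<close>. If \<open>E n\<close> is null, the decomposition says nothing, but any
  \<open>b\<close> will do.\<close>

lemma basis_exists: "\<exists>b. nondegenerate (E n) n b \<and> (\<forall>v. AE x in m. x \<in> E n \<longrightarrow> x \<in> near_span n b v)"
proof (cases "emeasure m (E n) = 0")
  case True
  then have "E n \<in> null_sets m" by (simp add: null_setsI)
  from AE_not_in[OF this] show ?thesis
    by (intro exI[of _ "\<lambda>i. 0"] conjI allI) (auto simp: nondegenerate_def elim!: AE_mp)
next
  case False
  then have pos: "0 < emeasure m (E n)" by (simp add: zero_less_iff_neq_zero)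
  have "locally_independent m act (E n) {}" by (simp add: locally_independent_def)
  then obtain W where W: "finite W" "card W = n" "locally_independent m act (E n) W"
    using dimension_bound(2)[OF sets_E order_refl pos] by blast
  obtain b where b: "bij_betw b {..<n} W"
    using ex_bij_betw_nat_finite[OF W(1)] W(2) by (auto simp: atLeast0LessThan)
  have nd: "nondegenerate (E n) n b"
    using W(3) locally_independent_tuple[OF b] independent_nondegenerate[OF sets_E] by blast
  have "AE x in m. x \<in> E n \<longrightarrow> x \<in> near_span n b v" for v
  proof -
    define A where "A = E n - near_span n b v"
    have A [measurable]: "A \<in> sets m" unfolding A_def by measurable
    have "emeasure m A = 0"
    proof (rule ccontr)
      assume "emeasure m A \<noteq> 0"
      then have posA: "0 < emeasure m A" by (simp add: zero_less_iff_neq_zero)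
      define b' where "b' = b(n := v)"
      have nd': "nondegenerate A n b'"
        by (rule nondegenerate_cong[OF nondegenerate_mono[OF nd]]) (auto simp: A_def b'_def)
      have "near_span n b' (b' n) = near_span n b v"
        by (simp add: near_span_def b'_def lincomb_def)
      then have "AE x in m. x \<in> A \<longrightarrow> x \<notin> near_span n b' (b' n)" by (simp add: A_def)
      then have ind: "independent_tuple A (Suc n) b'"
        by (intro nondegenerate_independent[OF A] nondegenerate_Suc[OF nd'])
      have bij: "bij_betw b' {..<Suc n} (b' ` {..<Suc n})"
        using independent_tuple_inj[OF A posA ind] by (simp add: bij_betw_def)
      have "locally_independent m act A (b' ` {..<Suc n})"
        using locally_independent_tuple[OF bij] ind by blast
      from dimension_bound(1)[OF A _ posA this, of n] have "card (b' ` {..<Suc n}) \<le> n"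
        by (simp add: A_def)
      then show False using bij_betw_same_card[OF bij] by simp
    qed
    then have "A \<in> null_sets m" by (simp add: null_setsI)
    from AE_not_in[OF this] show ?thesis by eventually_elim (simp add: A_def)
  qed
  with nd show ?thesis by blast
qed

lemma frames_exist:
  obtains b F where "\<And>n. coordinate_frame p m nrm act pn (E n) n (b n) (F n)"
    "\<And>n v. AE x in m. x \<in> E n \<longrightarrow> x \<in> near_span n (b n) v"
proof -
  obtain b where b: "\<And>n. nondegenerate (E n) n (b n)" "\<And>n v. AE x in m. x \<in> E n \<longrightarrow> x \<in> near_span n (b n) v"
    using basis_exists by metis
  have "\<exists>F. coordinate_frame p m nrm act pn (E n) n (b n) F" for n
    using nondegenerate_imp_frame[OF sets_E b(1)] by blast
  then obtain F where "\<And>n. coordinate_frame p m nrm act pn (E n) n (b n) (F n)" by metis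
  then show ?thesis using b(2) by (rule that)
qed

end

locale framed_module = decomposed_module p m nrm act pn E Einf
  for p :: ennreal
    and m :: "'a measure"
    and nrm :: "'v::real_vector \<Rightarrow> real"
    and act :: "('a \<Rightarrow> real) \<Rightarrow> 'v \<Rightarrow> 'v"
    and pn :: "'v \<Rightarrow> 'a \<Rightarrow> real"
    and E :: "nat \<Rightarrow> 'a set" and Einf :: "'a set" +
  fixes b :: "nat \<Rightarrow> nat \<Rightarrow> 'v" and F :: "nat \<Rightarrow> 'a \<Rightarrow> (nat \<Rightarrow> real) \<Rightarrow> real"
  assumes frame: "coordinate_frame p m nrm act pn (E n) n (b n) (F n)"
    and spanning: "AE x in m. x \<in> E n \<longrightarrow> x \<in> near_span n (b n) v"
begin

sublocale fr: coordinate_frame p m nrm act pn "E n" n "b n" "F n" for n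
  by (rule frame)

sublocale norm_field p m E F
  by standard (rule p sets_E disjoint_E AE_E fr.F fr.F_measurable; assumption)+

section \<open>The coordinate map\<close>

text \<open>This is the isometry. The set of all coordinate representatives of \<open>v\<close> is
  already an equivalence class of the product, so none of them has to be chosen.\<close>

definition coordinates :: "'v \<Rightarrow> (nat \<Rightarrow> 'a \<Rightarrow> nat \<Rightarrow> real) set" where
  "coordinates v = {u \<in> section_reps. \<forall>n. fr.represents n v (u n)}"

lemma coordinates_nonempty: "coordinates v \<noteq> {}"
proof -
  have "\<exists>u. fr.represents n v u \<and> (\<forall>x. u x \<in> Rn n) \<and> (\<forall>i. (\<lambda>x. u x i) \<in> borel_measurable m)" for n
  proof -
    have near: "AE x in m. x \<in> E n \<longrightarrow> (\<forall>e>0. \<exists>q\<in>Qn n. pn (v - lincomb (b n) n q) x < e)"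
      using spanning[of n v] by eventually_elim (intro impI allI near_spanD; simp)
    obtain u where "fr.represents n v u" "\<And>x. u x \<in> Rn n" "\<And>i. (\<lambda>x. u x i) \<in> borel_measurable m"
      by (rule fr.represents_exists[OF near]) blast
    then show ?thesis by (intro exI[of _ u]) simp
  qed
  then obtain u where "\<And>n. fr.represents n v (u n)" "\<And>n x. u n x \<in> Rn n" "\<And>n i. (\<lambda>x. u n x i) \<in> borel_measurable m"
    by metis
  then have "u \<in> coordinates v"
    by (simp add: coordinates_def section_reps_def measurable_restrict_space1)
  then show ?thesis by blast
qed

lemma coordinates_pn:
  assumes u: "u \<in> coordinates v"
  shows "AE x in m. pn v x = Lp_product_pn p E F u x"
proof -
  have "AE x in m. \<forall>n. x \<in> E n \<longrightarrow> pn v x = F n x (u n x)"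
    unfolding AE_all_countable using u fr.represents_pn by (simp add: coordinates_def)
  with E_cover show ?thesis
  proof eventually_elim
    case (elim x)
    then obtain n where "x \<in> E n" by blast
    then show ?case using elim product_pn_eq[of u x n] u by (simp add: coordinates_def)
  qed
qed

lemma coordinates_reps:
  assumes u: "u \<in> coordinates v"
  shows "u \<in> Lp_product_reps p m E F"
proof (rule product_repsI[OF _ pn_Lp])
  show "u \<in> section_reps" using u by (simp add: coordinates_def)
  show "AE x in m. x \<in> E n \<longrightarrow> F n x (u n x) \<le> \<bar>pn v x\<bar>" for n
  proof -
    have "fr.represents n v (u n)" using u by (simp add: coordinates_def)
    from fr.represents_pn[OF this] show ?thesis by eventually_elim auto
  qed
qed

lemma coordinates_add:
  assumes "u \<in> coordinates v" "w \<in> coordinates v'"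
  shows "(\<lambda>n x i. u n x i + w n x i) \<in> coordinates (v + v')"
  using assms by (simp add: coordinates_def section_add fr.represents_add)

lemma coordinates_act:
  assumes "f \<in> Linf m" "u \<in> coordinates v"
  shows "(\<lambda>n x i. f x * u n x i) \<in> coordinates (act f v)"
  using assms by (simp add: coordinates_def section_mult fr.represents_act Lp_space_measurable)

lemma coordinates_scale:
  assumes "u \<in> coordinates v"
  shows "(\<lambda>n x i. c * u n x i) \<in> coordinates (c *\<^sub>R v)"
  using coordinates_act[OF Linf_const assms, of c] by (simp add: act_const)

text \<open>By linearity, 0 is a coordinate representative of \<open>v - w\<close>, whose pointwise
  norm therefore vanishes.\<close>

lemma coordinates_inj:
  assumes u: "u \<in> coordinates v" and w: "u \<in> coordinates w"
  shows "v = w"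
proof -
  have "(\<lambda>n x i. u n x i + (- 1) * u n x i) \<in> coordinates (v + (- 1) *\<^sub>R w)"
    by (rule coordinates_add[OF u coordinates_scale[OF w]])
  then have z: "(\<lambda>n x i. 0) \<in> coordinates (v - w)" by simp
  have "AE x in m. pn (v - w) x = 0"
    using coordinates_pn[OF z] E_cover
  proof eventually_elim
    case (elim x)
    then obtain n where "x \<in> E n" by blast
    then show ?case using elim(1) product_pn_eq[of "\<lambda>n x i. 0" x n] z Norms_zero[OF F_Norms]
      by (simp add: coordinates_def)
  qed
  then show ?thesis using eq_0_iff_pn[of "v - w"] by simp
qed

lemma coordinates_AE_eq:
  assumes "u \<in> coordinates v" "w \<in> coordinates v"
  shows "AE x in m. x \<in> E n \<longrightarrow> u n x = w n x"
  using assms fr.represents_unique[of n v "u n" "w n"] by (simp add: coordinates_def)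

text \<open>Uniqueness of coordinates puts them all into one class, and
  \<open>represents_cong\<close> shows that the class contains nothing else.\<close>

lemma coordinates_class:
  assumes u: "u \<in> coordinates v"
  shows "coordinates v = {(u, w). u \<in> Lp_product_reps p m E F \<and> w \<in> Lp_product_reps p m E F \<and>
                (\<forall>n. AE x in m. x \<in> E n \<longrightarrow> u n x = w n x)} `` {u}"
proof (intro set_eqI iffI)
  fix w assume "w \<in> coordinates v"
  then show "w \<in> {(u, w). u \<in> Lp_product_reps p m E F \<and> w \<in> Lp_product_reps p m E F \<and>
                (\<forall>n. AE x in m. x \<in> E n \<longrightarrow> u n x = w n x)} `` {u}"
    using coordinates_reps u coordinates_AE_eq[OF u] by simp
next
  fix w assume "w \<in> {(u, w). u \<in> Lp_product_reps p m E F \<and> w \<in> Lp_product_reps p m E F \<and>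
                (\<forall>n. AE x in m. x \<in> E n \<longrightarrow> u n x = w n x)} `` {u}"
  then have w: "w \<in> Lp_product_reps p m E F" "\<And>n. AE x in m. x \<in> E n \<longrightarrow> u n x = w n x" by auto
  then show "w \<in> coordinates v"
    using u product_reps_section[OF w(1)] fr.represents_cong[OF _ w(2)] by (simp add: coordinates_def)
qed

text \<open>On \<open>B k\<close> the elements \<open>v\<close> and \<open>w k\<close> have
  pointwise distance 0, so the coordinates of \<open>w k\<close> serve for \<open>v\<close>
  there.\<close>

lemma represents_glue:
  assumes B: "E n \<subseteq> (\<Union>k::nat. B k)"
    and w: "\<And>k. fr.represents n (w k) (f k)" "\<And>k x. x \<in> B k \<Longrightarrow> f k x = u x"
    and vw: "\<And>k. AE x in m. x \<in> B k \<longrightarrow> pn (v - w k) x = 0"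
  shows "fr.represents n v u"
proof -
  have 1: "AE x in m. \<forall>k. \<forall>q\<in>Qn n. pn (v - lincomb (b n) n q) x \<le> pn (v - w k) x + pn (w k - lincomb (b n) n q) x"
    unfolding AE_all_countable
  proof (intro allI AE_Qn)
    fix k q
    show "AE x in m. pn (v - lincomb (b n) n q) x \<le> pn (v - w k) x + pn (w k - lincomb (b n) n q) x"
      using pn_triangle[of "v - w k" "w k - lincomb (b n) n q"] by simp
  qed
  have 2: "AE x in m. \<forall>k. x \<in> B k \<longrightarrow> pn (v - w k) x = 0" unfolding AE_all_countable using vw by blast
  have 3: "AE x in m. \<forall>k. x \<in> E n \<longrightarrow> f k x \<in> Rn n \<and> (\<forall>q\<in>Qn n. pn (w k - lincomb (b n) n q) x \<le> F n x (\<lambda>i. f k x i - q i))"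
    unfolding AE_all_countable using w(1) unfolding fr.represents_def by blast
  from 1 2 3 show ?thesis unfolding fr.represents_def
  proof eventually_elim
    case (elim x)
    show ?case
    proof
      assume x: "x \<in> E n"
      then obtain k where k: "x \<in> B k" using B by blast
      have fk: "u x \<in> Rn n \<and> (\<forall>q\<in>Qn n. pn (w k - lincomb (b n) n q) x \<le> F n x (\<lambda>i. u x i - q i))"
        using elim(3)[rule_format, OF x, of k] unfolding w(2)[OF k] .
      show "u x \<in> Rn n \<and> (\<forall>q\<in>Qn n. pn (v - lincomb (b n) n q) x \<le> F n x (\<lambda>i. u x i - q i))"
      proof (intro conjI ballI)
        fix q assume q: "q \<in> Qn n"
        have "pn (v - lincomb (b n) n q) x \<le> pn (v - w k) x + pn (w k - lincomb (b n) n q) x"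
          using elim(1) q by blast
        moreover have "pn (v - w k) x = 0" using elim(2) k by blast
        ultimately show "pn (v - lincomb (b n) n q) x \<le> F n x (\<lambda>i. u x i - q i)" using fk q by fastforce
      qed (use fk in blast)
    qed
  qed
qed

text \<open>The module element with given coordinates is glued from elements with bounded coordinates.\<close>

lemma coordinates_surj:
  assumes u: "u \<in> Lp_product_reps p m E F"
  obtains v where "u \<in> coordinates v"
proof -
  note us = product_reps_section[OF u]
  have Lp: "Lp_product_pn p E F u \<in> Lp_space p m" using u by (simp add: Lp_product_reps_def)
  \<comment> \<open>Shells on which the coordinates are bounded and therefore act on the
    module.\<close>
  define B where "B n k = {x \<in> E n. real k \<le> l1 n (u n x) \<and> l1 n (u n x) < real (Suc k)}" for n k
  have B [measurable]: "B n k \<in> sets m" for n k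
  proof -
    have [measurable]: "(\<lambda>x. l1 n (u n x)) \<in> borel_measurable (restrict_space m (E n))"
      unfolding l1_def using section_measurable[OF us, of _ n] by (intro borel_measurable_sum borel_measurable_abs) auto
    have "{x \<in> space (restrict_space m (E n)). real k \<le> l1 n (u n x) \<and> l1 n (u n x) < real (Suc k)} \<in> sets (restrict_space m (E n))"
      by measurable
    also have "{x \<in> space (restrict_space m (E n)). real k \<le> l1 n (u n x) \<and> l1 n (u n x) < real (Suc k)} = B n k"
      using sets.sets_into_space[OF E_sets[of n]] by (auto simp: B_def space_restrict_space)
    finally show ?thesis by (simp add: sets_restrict_space_iff)
  qed
  have B_cover: "E n \<subseteq> (\<Union>k. B n k)" for n
  proof
    fix x assume x: "x \<in> E n"
    have "real (nat \<lfloor>l1 n (u n x)\<rfloor>) \<le> l1 n (u n x)" "l1 n (u n x) < real (Suc (nat \<lfloor>l1 n (u n x)\<rfloor>))"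
      using l1_nonneg[of n "u n x"] by linarith+
    then show "x \<in> (\<Union>k. B n k)" using x by (auto simp: B_def)
  qed
  define f where "f n k i x = indicator (B n k) x * u n x i" for n k i x
  have f: "f n k i \<in> Linf m" if i: "i < n" for n k i
    unfolding Linf_iff
  proof (intro conjI exI[of _ "real (Suc k)"] AE_I2)
    have "(\<lambda>x. indicator (E n) x *\<^sub>R u n x i) \<in> borel_measurable m"
      using section_measurable[OF us i] by (subst (asm) borel_measurable_restrict_space_iff) auto
    moreover have "f n k i = (\<lambda>x. indicator (B n k) x * (indicator (E n) x *\<^sub>R u n x i))"
      by (auto simp: f_def B_def fun_eq_iff indicator_def)
    ultimately show "f n k i \<in> borel_measurable m" by simp
    show "\<bar>f n k i x\<bar> \<le> real (Suc k)" for x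
      using coord_le_l1[OF i, of "u n x"] by (auto simp: f_def B_def indicator_def)
  qed
  define w where "w n k = (\<Sum>i<n. act (f n k i) (b n i))" for n k
  have w: "fr.represents n (w n k) (\<lambda>x i. if i < n then f n k i x else 0)" for n k
    unfolding w_def by (rule fr.represents_act_sum[OF f])
  have fu: "(\<lambda>i. if i < n then f n k i x else 0) = u n x" if "x \<in> B n k" for n k x
    using section_Rn[OF us, of x n] that by (auto simp: f_def B_def Rn_iff fun_eq_iff)
  \<comment> \<open>Glueing takes a single sequence, so the pairs of indices are enumerated.\<close>
  define A where "A j = case_prod B (prod_decode j)" for j
  define w' where "w' j = case_prod w (prod_decode j)" for j
  have A [measurable]: "A j \<in> sets m" for j by (simp add: A_def split: prod.split)
  have B_disj: "B n k \<inter> B n' k' = {}" if "(n, k) \<noteq> (n', k')" for n k n' k'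
  proof (cases "n = n'")
    case True
    then have "Suc k \<le> k' \<or> Suc k' \<le> k" using that by auto
    then show ?thesis unfolding B_def True
      by (elim disjE) (auto simp: not_le dest!: of_nat_mono[where 'a = real])
  next
    case False
    then show ?thesis using E_disjoint by (auto simp: B_def disjoint_family_on_def)
  qed
  have A_disj: "A i \<inter> A j = {}" if "i \<noteq> j" for i j
  proof -
    obtain n k n' k' where ij: "prod_decode i = (n, k)" "prod_decode j = (n', k')" by (metis surj_pair)
    have "prod_decode i \<noteq> prod_decode j" using that inj_prod_decode[of UNIV] by (auto dest: injD)
    then have "(n, k) \<noteq> (n', k')" unfolding ij .
    from B_disj[OF this] show ?thesis by (simp add: A_def ij)
  qed
  define P where "P = Lp_product_pn p E F u"
  have wA: "AE x in m. x \<in> A j \<longrightarrow> pn (w' j) x = P x" for j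
  proof -
    obtain n k where nk: "prod_decode j = (n, k)" by fastforce
    show ?thesis using fr.represents_pn[OF w[of n k]]
    proof eventually_elim
      case (elim x)
      show ?case
      proof
        assume "x \<in> A j"
        then have x: "x \<in> B n k" "x \<in> E n" by (auto simp: A_def nk B_def)
        then show "pn (w' j) x = P x"
          using elim fu[OF x(1)] product_pn_eq[OF us x(2)] by (simp add: w'_def nk P_def)
      qed
    qed
  qed
  \<comment> \<open>By disjointness, the pointwise norm of every partial sum is at most
    \<open>P\<close>; this yields the finite \<open>limsup\<close> that glueing asks for.\<close>
  have bound: "nrm (\<Sum>j<N. act (indicator (A j)) (w' j)) \<le> Lp_norm p m P" for N
  proof -
    let ?S = "\<Sum>j<N. act (indicator (A j)) (w' j)"
    have "AE x in m. \<forall>j. pn (act (indicator (A j)) (w' j)) x = indicator (A j) x * pn (w' j) x"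
      unfolding AE_all_countable using pn_indicator[OF A] by blast
    moreover have "AE x in m. \<forall>j. x \<in> A j \<longrightarrow> pn (w' j) x = P x" unfolding AE_all_countable using wA by blast
    moreover have "AE x in m. pn ?S x \<le> (\<Sum>j<N. pn (act (indicator (A j)) (w' j)) x)" by (rule pn_sum)
    ultimately have "AE x in m. \<bar>pn ?S x\<bar> \<le> \<bar>P x\<bar>"
      using pn_nonneg[of ?S]
    proof eventually_elim
      case (elim x)
      have "(\<Sum>j<N. pn (act (indicator (A j)) (w' j)) x) = (\<Sum>j<N. indicator (A j) x * P x)"
        using elim(1,2) by (intro sum.cong) (auto simp: indicator_def)
      also have "\<dots> = indicator (\<Union>j<N. A j) x * P x"
        using A_disj by (subst indicator_UN_disjoint) (auto simp: disjoint_family_on_def sum_distrib_right)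
      also have "\<dots> \<le> \<bar>P x\<bar>" by (auto simp: indicator_def)
      finally show ?case using elim(3,4) by simp
    qed
    then show ?thesis unfolding nrm_eq P_def by (intro Lp_norm_mono[OF p Lp pn_measurable])
  qed
  have "limsup (\<lambda>N. ereal (nrm (\<Sum>j<N. act (indicator (A j)) (w' j)))) \<le> ereal (Lp_norm p m P)"
    by (rule Limsup_bounded) (simp add: bound)
  then have "limsup (\<lambda>N. ereal (nrm (\<Sum>j<N. act (indicator (A j)) (w' j)))) < \<infinity>"
    by (rule order.strict_trans1) simp
  moreover have "act (indicator (A i \<inter> A j)) (w' i) = act (indicator (A i \<inter> A j)) (w' j)" for i j
  proof (cases "i = j")
    case False
    have "indicator {} = (\<lambda>x :: 'a. 0 :: real)" by (simp add: fun_eq_iff)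
    then show ?thesis using A_disj[OF False] by (simp add: act_const)
  qed simp
  ultimately obtain v where v: "\<And>j. act (indicator (A j)) v = act (indicator (A j)) (w' j)"
    using glueing[of A w', OF A] by blast
  have "fr.represents n v (u n)" for n
  proof (rule represents_glue[OF B_cover w fu])
    fix k
    have j: "A (prod_encode (n, k)) = B n k" "w' (prod_encode (n, k)) = w n k" by (simp_all add: A_def w'_def)
    have "act (indicator (B n k)) (v - w n k) = 0"
      using v[of "prod_encode (n, k)"] unfolding j by (simp add: act_diff_right)
    then show "AE x in m. x \<in> B n k \<longrightarrow> pn (v - w n k) x = 0" by (simp add: act_indicator_eq_0_iff)
  qed
  then have "u \<in> coordinates v" using us by (simp add: coordinates_def)
  then show ?thesis by (rule that)
qed

lemma coordinates_bij: "bij_betw coordinates UNIV (Lp_product p m E F)"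
  unfolding bij_betw_def
proof (intro conjI inj_onI set_eqI iffI)
  show "v = w" if "coordinates v = coordinates w" for v w
    using coordinates_nonempty[of v] coordinates_inj that by blast
  fix X
  {
    assume "X \<in> range coordinates"
    then obtain v where X: "X = coordinates v" by blast
    obtain u where u: "u \<in> coordinates v" using coordinates_nonempty by blast
    show "X \<in> Lp_product p m E F"
      unfolding X coordinates_class[OF u] Lp_product_def by (rule quotientI[OF coordinates_reps[OF u]])
  }
  assume "X \<in> Lp_product p m E F"
  then obtain u where u: "u \<in> Lp_product_reps p m E F"
    and X: "X = {(u, w). u \<in> Lp_product_reps p m E F \<and> w \<in> Lp_product_reps p m E F \<and>
                (\<forall>n. AE x in m. x \<in> E n \<longrightarrow> u n x = w n x)} `` {u}"
    unfolding Lp_product_def by (rule quotientE)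
  obtain v where v: "u \<in> coordinates v" using coordinates_surj[OF u] .
  show "X \<in> range coordinates" unfolding X coordinates_class[OF v, symmetric] by blast
qed

lemma coordinates_isometry: "Lp_product_isometry p m act pn E F coordinates"
  unfolding Lp_product_isometry_def
  using coordinates_bij coordinates_add coordinates_act coordinates_pn by blast

end

section \<open>The module with a pointwise scalar product\<close>

text \<open>Equivalent norms have the same Cauchy sequences and the same limits, and definiteness is
  inherited as well.\<close>

lemma Banach_norm_equivalent:
  fixes nrm nrm' :: "'v::real_vector \<Rightarrow> real"
  assumes B: "Banach_norm nrm"
    and nonneg: "\<And>v. 0 \<le> nrm' v"
    and scale: "\<And>c v. nrm' (c *\<^sub>R v) = \<bar>c\<bar> * nrm' v"
    and tri: "\<And>v w. nrm' (v + w) \<le> nrm' v + nrm' w"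
    and le: "0 < C" "\<And>v. nrm v \<le> C * nrm' v" "\<And>v. nrm' v \<le> C * nrm v"
  shows "Banach_norm nrm'"
proof -
  have n: "\<And>v. 0 \<le> nrm v" "\<And>v. nrm v = 0 \<longleftrightarrow> v = 0" "\<And>c v. nrm (c *\<^sub>R v) = \<bar>c\<bar> * nrm v"
    "\<And>v w. nrm (v + w) \<le> nrm v + nrm w" and complete: "Metric_space.mcomplete UNIV (\<lambda>v w. nrm (v - w))"
    using B by (simp_all add: Banach_norm_def)
  have zero': "nrm' v = 0 \<longleftrightarrow> v = 0" for v
  proof
    assume "nrm' v = 0"
    then have "nrm v = 0" using le(2)[of v] n(1)[of v] by simp
    then show "v = 0" using n(2) by simp
  next
    assume "v = 0"
    then show "nrm' v = 0" using scale[of 0 0] by simp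
  qed
  have metric: "Metric_space UNIV (\<lambda>v w. f (v - w))"
    if f: "\<And>v. 0 \<le> f v" "\<And>v. f v = 0 \<longleftrightarrow> v = 0" "\<And>c v. f (c *\<^sub>R v) = \<bar>c\<bar> * f v" "\<And>v w. f (v + w) \<le> f v + f w"
    for f :: "'v \<Rightarrow> real"
  proof
    show "f (x - y) = f (y - x)" for x y using f(3)[of "- 1" "y - x"] by simp
    show "f (x - z) \<le> f (x - y) + f (y - z)" for x y z using f(4)[of "x - y" "y - z"] by simp
  qed (use f in auto)
  interpret M: Metric_space UNIV "\<lambda>v w. nrm (v - w)" by (rule metric[OF n])
  interpret M': Metric_space UNIV "\<lambda>v w. nrm' (v - w)" by (rule metric[OF nonneg zero' scale tri])
  have "M'.mcomplete"
    unfolding M'.mcomplete_def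
  proof (intro allI impI)
    fix s assume s: "M'.MCauchy s"
    have "M.MCauchy s"
      unfolding M.MCauchy_def
    proof (intro conjI allI impI)
      fix e :: real assume "0 < e"
      then have "0 < e / C" using le(1) by simp
      then obtain N where N: "\<And>j k. \<lbrakk>N \<le> j; N \<le> k\<rbrakk> \<Longrightarrow> nrm' (s j - s k) < e / C"
        using s unfolding M'.MCauchy_def by meson
      show "\<exists>N. \<forall>j k. N \<le> j \<longrightarrow> N \<le> k \<longrightarrow> nrm (s j - s k) < e"
      proof (intro exI[of _ N] allI impI)
        fix j k assume "N \<le> j" "N \<le> k"
        then have "C * nrm' (s j - s k) < e" using N[of j k] le(1) by (simp add: field_simps)
        then show "nrm (s j - s k) < e" using le(2)[of "s j - s k"] by linarith
      qed
    qed simp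
    then obtain x where x: "limitin M.mtopology s x sequentially" using complete unfolding M.mcomplete_def by blast
    have "limitin M'.mtopology s x sequentially"
      unfolding M'.limitin_metric
    proof (intro conjI allI impI)
      fix e :: real assume "0 < e"
      then have "0 < e / C" using le(1) by simp
      then have "\<forall>\<^sub>F j in sequentially. s j \<in> UNIV \<and> nrm (s j - x) < e / C"
        using x unfolding M.limitin_metric by blast
      then show "\<forall>\<^sub>F j in sequentially. s j \<in> UNIV \<and> nrm' (s j - x) < e"
      proof eventually_elim
        case (elim j)
        then have "C * nrm (s j - x) < e" using le(1) by (simp add: field_simps)
        then show ?case using le(3)[of "s j - x"] by simp
      qed
    qed simp
    then show "\<exists>x. limitin M'.mtopology s x sequentially" by blast
  qed
  then show ?thesis
    unfolding Banach_norm_def using nonneg zero' scale tri by blast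
qed

locale bounded_module = framed_module p m nrm act pn E Einf b F
  for p :: ennreal
    and m :: "'a measure"
    and nrm :: "'v::real_vector \<Rightarrow> real"
    and act :: "('a \<Rightarrow> real) \<Rightarrow> 'v \<Rightarrow> 'v"
    and pn :: "'v \<Rightarrow> 'a \<Rightarrow> real"
    and E :: "nat \<Rightarrow> 'a set" and Einf :: "'a set"
    and b :: "nat \<Rightarrow> nat \<Rightarrow> 'v" and F :: "nat \<Rightarrow> 'a \<Rightarrow> (nat \<Rightarrow> real) \<Rightarrow> real" +
  fixes N :: nat
  assumes bounded: "N < n \<Longrightarrow> emeasure m (E n) = 0"
begin

definition F' :: "nat \<Rightarrow> 'a \<Rightarrow> (nat \<Rightarrow> real) \<Rightarrow> real" where
  "F' n x = euclid n (F n x)"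

text \<open>The constant of \<open>euclid_equivalent\<close> in the largest dimension
  \<open>N\<close>. This is where a bound on the dimension makes the equivalence uniform.\<close>

definition C :: real where
  "C = 2 * 3 ^ N - 1"

sublocale eu: norm_field p m E F'
proof
  show "F' n x \<in> Norms n" for n x unfolding F'_def by (rule euclid_Norms[OF F_Norms])
  show "(\<lambda>x. F' n x q) \<in> borel_measurable m" if "q \<in> Qn n" for n q
    unfolding F'_def using F_Norms F_Qn_measurable that by (rule measurable_euclid)
qed (rule p sets_E disjoint_E AE_E)+

lemma C_pos: "0 < C"
proof -
  have "1 \<le> (3::real) ^ N" by simp
  then show ?thesis unfolding C_def by linarith
qed

lemma F'_equivalent:
  "AE x in m. x \<in> E n \<longrightarrow> (\<forall>a\<in>Rn n. F n x a \<le> C * F' n x a \<and> F' n x a \<le> C * F n x a)"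
proof (cases "N < n")
  case True
  then have "E n \<in> null_sets m" using bounded by (simp add: null_setsI)
  from AE_not_in[OF this] show ?thesis by eventually_elim simp
next
  case False
  have c: "2 * 3 ^ n - 1 \<le> C" unfolding C_def using False by (simp add: power_increasing)
  have "F n x a \<le> C * F' n x a \<and> F' n x a \<le> C * F n x a" if a: "a \<in> Rn n" for x a
  proof
    show "F n x a \<le> C * F' n x a"
      unfolding F'_def using euclid_equivalent(1)[OF F_Norms a] mult_right_mono[OF c Norms_nonneg[OF euclid_Norms[OF F_Norms] a]]
      by (rule order_trans)
    show "F' n x a \<le> C * F n x a"
      unfolding F'_def using euclid_equivalent(2)[OF F_Norms a] mult_right_mono[OF c Norms_nonneg[OF F_Norms a]]
      by (rule order_trans)
  qed
  then show ?thesis by simp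
qed

lemma product_reps_eq: "Lp_product_reps p m E F' = Lp_product_reps p m E F"
proof
  show "Lp_product_reps p m E F' \<subseteq> Lp_product_reps p m E F"
  proof (rule eu.product_reps_equivalent[of F C])
    show "norm_field p m E F" by unfold_locales
    show "AE x in m. x \<in> E n \<longrightarrow> (\<forall>a\<in>Rn n. F n x a \<le> C * F' n x a)" for n
      using F'_equivalent[of n] by eventually_elim simp
  qed
  show "Lp_product_reps p m E F \<subseteq> Lp_product_reps p m E F'"
  proof (rule product_reps_equivalent[of F' C])
    show "norm_field p m E F'" by unfold_locales
    show "AE x in m. x \<in> E n \<longrightarrow> (\<forall>a\<in>Rn n. F' n x a \<le> C * F n x a)" for n
      using F'_equivalent[of n] by eventually_elim simp
  qed
qed

text \<open>Another choice of the representative changes this function on a null set only, as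
  \<open>pn'_E\<close> shows.\<close>

definition pn' :: "'v \<Rightarrow> 'a \<Rightarrow> real" where
  "pn' v = Lp_product_pn p E F' (SOME u. u \<in> coordinates v)"

definition nrm' :: "'v \<Rightarrow> real" where
  "nrm' v = Lp_norm p m (pn' v)"

lemma coordinates_obtain:
  obtains u where "u \<in> coordinates v" "u \<in> section_reps"
  using coordinates_nonempty[of v] by (auto simp: coordinates_def)

lemma pn'_E:
  assumes u: "u \<in> coordinates v"
  shows "AE x in m. \<forall>n. x \<in> E n \<longrightarrow> u n x \<in> Rn n \<and> pn' v x = F' n x (u n x)"
proof -
  define w where "w = (SOME u. u \<in> coordinates v)"
  have w: "w \<in> coordinates v" unfolding w_def by (rule someI[of "\<lambda>u. u \<in> coordinates v", OF u])
  have "AE x in m. \<forall>n. x \<in> E n \<longrightarrow> u n x = w n x"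
    unfolding AE_all_countable using coordinates_AE_eq[OF u w] by blast
  then show ?thesis
  proof eventually_elim
    case (elim x)
    show ?case
    proof (intro allI impI conjI)
      fix n assume x: "x \<in> E n"
      show "u n x \<in> Rn n" using u section_Rn x by (simp add: coordinates_def)
      have "w \<in> section_reps" using w by (simp add: coordinates_def)
      from eu.product_pn_eq[OF this x] show "pn' v x = F' n x (u n x)"
        using elim x by (simp add: pn'_def w_def)
    qed
  qed
qed

lemma coordinates_pn':
  assumes u: "u \<in> coordinates v"
  shows "AE x in m. pn' v x = Lp_product_pn p E F' u x"
  using pn'_E[OF u] E_cover
proof eventually_elim
  case (elim x)
  then obtain n where n: "x \<in> E n" by blast
  have "u \<in> section_reps" using u by (simp add: coordinates_def)
  from eu.product_pn_eq[OF this n] show ?case using elim n by simp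
qed

lemma pn'_measurable [measurable]: "pn' v \<in> borel_measurable m"
proof -
  have "(SOME u. u \<in> coordinates v) \<in> coordinates v" using coordinates_nonempty by (simp add: some_in_eq)
  then show ?thesis unfolding pn'_def by (intro eu.product_pn_measurable) (simp add: coordinates_def)
qed

lemma pn'_equivalent: "AE x in m. 0 \<le> pn' v x \<and> pn v x \<le> C * pn' v x \<and> pn' v x \<le> C * pn v x"
proof -
  obtain u where u: "u \<in> coordinates v" "u \<in> section_reps" by (rule coordinates_obtain)
  have "AE x in m. \<forall>n. x \<in> E n \<longrightarrow> (\<forall>a\<in>Rn n. F n x a \<le> C * F' n x a \<and> F' n x a \<le> C * F n x a)"
    unfolding AE_all_countable using F'_equivalent by blast
  with pn'_E[OF u(1)] coordinates_pn[OF u(1)] E_cover show ?thesis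
  proof eventually_elim
    case (elim x)
    then obtain n where n: "x \<in> E n" by blast
    have ux: "u n x \<in> Rn n" using section_Rn[OF u(2) n] .
    show ?case using elim n ux product_pn_eq[OF u(2) n] Norms_nonneg[OF eu.F_Norms ux] by auto
  qed
qed

lemma pn'_Lp: "pn' v \<in> Lp_space p m"
proof (rule Lp_dominated[OF Lp_scale[OF pn_Lp, of C v]])
  show "AE x in m. \<bar>pn' v x\<bar> \<le> \<bar>C * pn v x\<bar>" using pn'_equivalent[of v] by eventually_elim simp
qed simp

lemma pn'_triangle: "AE x in m. pn' (v + w) x \<le> pn' v x + pn' w x"
proof -
  obtain u where u: "u \<in> coordinates v" "u \<in> section_reps" by (rule coordinates_obtain)
  obtain u' where u': "u' \<in> coordinates w" "u' \<in> section_reps" by (rule coordinates_obtain)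
  from pn'_E[OF u(1)] pn'_E[OF u'(1)] pn'_E[OF coordinates_add[OF u(1) u'(1)]] E_cover show ?thesis
  proof eventually_elim
    case (elim x)
    then obtain n where n: "x \<in> E n" by blast
    show ?case
      using elim n Norms_triangle[OF eu.F_Norms section_Rn[OF u(2) n] section_Rn[OF u'(2) n], of x] by simp
  qed
qed

lemma pn'_act:
  assumes f: "f \<in> Linf m"
  shows "AE x in m. pn' (act f v) x = \<bar>f x\<bar> * pn' v x"
proof -
  obtain u where u: "u \<in> coordinates v" "u \<in> section_reps" by (rule coordinates_obtain)
  from pn'_E[OF u(1)] pn'_E[OF coordinates_act[OF f u(1)]] E_cover show ?thesis
  proof eventually_elim
    case (elim x)
    then obtain n where n: "x \<in> E n" by blast
    show ?case
      using elim n Norms_scale[OF eu.F_Norms section_Rn[OF u(2) n], of x "f x"] by simp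
  qed
qed

text \<open>Bilinear expansion. Its consequence for \<open>pn'\<close> is the only trace of the
  scalar product that uniform convexity uses.\<close>

lemma scalar_product_parallelogram:
  assumes "norm_from_scalar_product n G" "a \<in> Rn n" "c \<in> Rn n"
  shows "(G (\<lambda>i. a i + c i))\<^sup>2 + (G (\<lambda>i. a i - c i))\<^sup>2 = 2 * (G a)\<^sup>2 + 2 * (G c)\<^sup>2"
proof -
  obtain B where B: "\<forall>a \<in> Rn n. \<forall>b \<in> Rn n. B a b = B b a"
    "\<forall>a \<in> Rn n. \<forall>b \<in> Rn n. \<forall>c \<in> Rn n. B (\<lambda>i. a i + b i) c = B a c + B b c"
    "\<forall>t. \<forall>a \<in> Rn n. \<forall>b \<in> Rn n. B (\<lambda>i. t * a i) b = t * B a b"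
    "\<forall>a \<in> Rn n. a \<noteq> (\<lambda>i. 0) \<longrightarrow> 0 < B a a" "\<forall>a \<in> Rn n. G a = sqrt (B a a)"
    using assms(1) unfolding norm_from_scalar_product_def by (elim exE conjE)
  note sym = B(1)[rule_format] and add = B(2)[rule_format] and scale = B(3)[rule_format]
    and pos = B(4)[rule_format] and G = B(5)[rule_format]
  have nonneg: "0 \<le> B a a" if "a \<in> Rn n" for a
    using pos[OF that] scale[OF Rn_zero Rn_zero, of 0] by (cases "a = (\<lambda>i. 0)") (auto intro: less_imp_le)
  have G2: "(G a)\<^sup>2 = B a a" if "a \<in> Rn n" for a using G[OF that] nonneg[OF that] by simp
  define d where "d = (\<lambda>i. (- 1) * c i)"
  have d: "d \<in> Rn n" unfolding d_def by (rule Rn_scale[OF assms(3)])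
  have Bd: "B d y = - B c y" "B y d = - B y c" if "y \<in> Rn n" for y
    using scale[OF assms(3) that, of "- 1"] sym[OF that d] sym[OF that assms(3)] by (simp_all add: d_def)
  have expand: "B (\<lambda>i. y i + z i) (\<lambda>i. y i + z i) = B y y + 2 * B y z + B z z" if "y \<in> Rn n" "z \<in> Rn n" for y z
  proof -
    have "B (\<lambda>i. y i + z i) (\<lambda>i. y i + z i) = B y (\<lambda>i. y i + z i) + B z (\<lambda>i. y i + z i)"
      by (rule add[OF that Rn_add[OF that]])
    also have "B y (\<lambda>i. y i + z i) = B y y + B z y" using sym[OF that(1) Rn_add[OF that]] add[OF that that(1)] by simp
    also have "B z (\<lambda>i. y i + z i) = B y z + B z z" using sym[OF that(2) Rn_add[OF that]] add[OF that that(2)] by simp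
    finally show ?thesis using sym[OF that] by simp
  qed
  have ad: "(\<lambda>i. a i - c i) = (\<lambda>i. a i + d i)" by (simp add: d_def)
  show ?thesis
    unfolding ad using expand[OF assms(2,3)] expand[OF assms(2) d] Bd(1)[OF d] Bd(2)[OF assms(3)] Bd(2)[OF assms(2)]
    by (simp add: G2 assms d Rn_add)
qed

lemma F'_scalar_product: "norm_from_scalar_product n (F' n x)"
  unfolding F'_def by (rule euclid_scalar_product[OF F_Norms])

lemma pn'_parallelogram:
  "AE x in m. (pn' (v + w) x)\<^sup>2 + (pn' (v - w) x)\<^sup>2 = 2 * (pn' v x)\<^sup>2 + 2 * (pn' w x)\<^sup>2"
proof -
  obtain u where u: "u \<in> coordinates v" "u \<in> section_reps" by (rule coordinates_obtain)
  obtain u' where u': "u' \<in> coordinates w" "u' \<in> section_reps" by (rule coordinates_obtain)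
  have d: "(\<lambda>n x i. u n x i - u' n x i) \<in> coordinates (v - w)"
    using coordinates_add[OF u(1) coordinates_scale[OF u'(1), of "- 1"]] by simp
  from pn'_E[OF u(1)] pn'_E[OF u'(1)] pn'_E[OF coordinates_add[OF u(1) u'(1)]] pn'_E[OF d] E_cover show ?thesis
  proof eventually_elim
    case (elim x)
    then obtain n where n: "x \<in> E n" by blast
    show ?case
      using elim n scalar_product_parallelogram[OF F'_scalar_product section_Rn[OF u(2) n] section_Rn[OF u'(2) n], of x]
      by simp
  qed
qed

lemma nrm'_equivalent: "nrm v \<le> C * nrm' v" "nrm' v \<le> C * nrm v"
proof -
  have 1: "AE x in m. \<bar>pn v x\<bar> \<le> \<bar>C * pn' v x\<bar>" "AE x in m. \<bar>pn' v x\<bar> \<le> \<bar>C * pn v x\<bar>"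
    using pn'_equivalent[of v] pn_nonneg[of v] by (eventually_elim, simp)+
  show "nrm v \<le> C * nrm' v"
    using Lp_norm_mono[OF p Lp_scale[OF pn'_Lp] pn_measurable 1(1)] Lp_norm_scale[OF p pn'_Lp, of C v] C_pos
    by (simp add: nrm_eq nrm'_def)
  show "nrm' v \<le> C * nrm v"
    using Lp_norm_mono[OF p Lp_scale[OF pn_Lp] pn'_measurable 1(2)] Lp_norm_scale[OF p pn_Lp, of C v] C_pos
    by (simp add: nrm_eq nrm'_def)
qed

lemma nrm'_triangle: "nrm' (v + w) \<le> nrm' v + nrm' w"
proof -
  have "AE x in m. \<bar>pn' (v + w) x\<bar> \<le> \<bar>pn' v x + pn' w x\<bar>"
    using pn'_triangle[of v w] pn'_equivalent[of "v + w"] by eventually_elim simp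
  from Lp_norm_mono[OF p Lp_add(1)[OF p pn'_Lp pn'_Lp] pn'_measurable this]
  show ?thesis using Lp_add(2)[OF p pn'_Lp[of v] pn'_Lp[of w]] by (simp add: nrm'_def)
qed

lemma nrm'_scale: "nrm' (c *\<^sub>R v) = \<bar>c\<bar> * nrm' v"
proof -
  have "AE x in m. \<bar>pn' (c *\<^sub>R v) x\<bar> = \<bar>c * pn' v x\<bar>"
    using pn'_act[OF Linf_const[of c], of v] unfolding act_const by eventually_elim (simp add: abs_mult)
  from Lp_norm_cong[OF p Lp_scale[OF pn'_Lp] pn'_measurable this]
  show ?thesis using Lp_norm_scale[OF p pn'_Lp, of c v] by (simp add: nrm'_def)
qed

lemma Banach_norm_nrm': "Banach_norm nrm'"
  by (rule Banach_norm_equivalent[OF banach _ nrm'_scale nrm'_triangle C_pos nrm'_equivalent])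
    (simp add: nrm'_def Lp_norm_nonneg)

text \<open>An element obtained by glueing with respect to \<open>nrm\<close> is cut off to the union of the sets; the
  norm bound then follows from monotone convergence.\<close>

lemma glueing':
  fixes w :: "nat \<Rightarrow> 'v"
  assumes A [measurable]: "\<And>n. A n \<in> sets m"
    and compat: "\<And>i j. act (indicator (A i \<inter> A j)) (w i) = act (indicator (A i \<inter> A j)) (w j)"
    and fin: "limsup (\<lambda>n. ereal (nrm' (\<Sum>i<n. act (indicator (A i)) (w i)))) < \<infinity>"
  shows "\<exists>v. (\<forall>i. act (indicator (A i)) v = act (indicator (A i)) (w i)) \<and>
    ereal (nrm' v) \<le> liminf (\<lambda>n. ereal (nrm' (\<Sum>i<n. act (indicator (A i)) (w i))))"
proof -
  define S where "S n = (\<Sum>i<n. act (indicator (A i)) (w i))" for n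
  \<comment> \<open>Eventually \<open>c\<close> bounds the new norms of the partial sums;
    equivalence carries this over to \<open>nrm\<close>, for which glueing is available.\<close>
  obtain c where c: "limsup (\<lambda>n. ereal (nrm' (S n))) < ereal c"
    using fin unfolding S_def by (metis ereal_dense2)
  have "\<forall>\<^sub>F n in sequentially. ereal (nrm (S n)) \<le> ereal (C * c)"
    using Limsup_lessD[OF c]
  proof eventually_elim
    case (elim n)
    then have "C * nrm' (S n) \<le> C * c" using C_pos by simp
    then show ?case using nrm'_equivalent(1)[of "S n"] by simp
  qed
  then have "limsup (\<lambda>n. ereal (nrm (S n))) \<le> ereal (C * c)" by (rule Limsup_bounded)
  then have "limsup (\<lambda>n. ereal (nrm (S n))) < \<infinity>" by (rule order.strict_trans1) simp
  then obtain v0 where v0: "\<And>i. act (indicator (A i)) v0 = act (indicator (A i)) (w i)"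
    using glueing[of A w, OF A compat] unfolding S_def by blast
  define U where "U = (\<Union>i. A i)"
  have U [measurable]: "U \<in> sets m" unfolding U_def by measurable
  define v where "v = act (indicator U) v0"
  have v: "act (indicator (A i)) v = act (indicator (A i)) (w i)" for i
  proof -
    have "A i \<inter> U = A i" by (auto simp: U_def)
    then show ?thesis using act_indicator_Int[OF A U, of i v0] v0[of i] by (simp add: v_def)
  qed
  have supp: "AE x in m. x \<notin> U \<longrightarrow> pn' v x = 0"
    unfolding v_def using pn'_act[OF Linf_indicator[OF U], of v0] by eventually_elim (simp add: indicator_def)
  have Lind: "(\<lambda>x. \<Sum>i<n. indicator (A i) x :: real) \<in> Linf m" for n
    by (intro Linf_sum) simp
  \<comment> \<open>The sets \<open>A i\<close> may overlap, so a partial sum multiplies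
    \<open>v\<close> by a counting function. For \<open>n \<ge> k\<close> this is at least 1 on the
    union of the first \<open>k\<close> sets, which is all that the comparison of norms
    requires.\<close>
  have S: "S n = act (\<lambda>x. \<Sum>i<n. indicator (A i) x) v" for n
    unfolding S_def v[symmetric] by (rule act_sum_left[symmetric]) simp
  have "ereal (nrm' v) \<le> liminf (\<lambda>n. ereal (nrm' (S n)))"
  proof (rule ccontr)
    assume "\<not> ?thesis"
    then have "liminf (\<lambda>n. ereal (nrm' (S n))) < ereal (nrm' v)" by simp
    then obtain c where c: "liminf (\<lambda>n. ereal (nrm' (S n))) < ereal c" "ereal c < ereal (nrm' v)"
      using ereal_dense2 by blast
    have freq: "\<exists>n\<ge>k. nrm' (S n) < c" for k
    proof (rule ccontr)
      assume "\<not> ?thesis"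
      then have "\<forall>\<^sub>F n in sequentially. ereal c \<le> ereal (nrm' (S n))"
        by (auto simp: eventually_sequentially not_less)
      then have "ereal c \<le> liminf (\<lambda>n. ereal (nrm' (S n)))" by (rule Liminf_bounded)
      then show False using c(1) by simp
    qed
    define B where "B k = (\<Union>i<k. A i)" for k
    have B [measurable]: "B k \<in> sets m" for k unfolding B_def by measurable
    have le: "Lp_norm p m (\<lambda>x. indicator (B k) x * pn' v x) \<le> c" for k
    proof -
      obtain n where n: "k \<le> n" "nrm' (S n) < c" using freq by blast
      have "AE x in m. \<bar>indicator (B k) x * pn' v x\<bar> \<le> \<bar>pn' (S n) x\<bar>"
        using pn'_act[OF Lind[of n], of v] pn'_equivalent[of v]
      proof eventually_elim
        case (elim x)
        have "indicator (B k) x \<le> (\<Sum>i<n. indicator (A i) x :: real)"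
        proof (cases "x \<in> B k")
          case True
          then obtain i where i: "i < k" "x \<in> A i" by (auto simp: B_def)
          then have "1 \<le> (\<Sum>i<n. indicator (A i) x :: real)"
            using n(1) member_le_sum[of i "{..<n}" "\<lambda>i. indicator (A i) x :: real"] by simp
          then show ?thesis by (simp add: indicator_def)
        qed (simp add: sum_nonneg)
        then have "indicator (B k) x * pn' v x \<le> (\<Sum>i<n. indicator (A i) x) * pn' v x"
          using elim(2) by (intro mult_right_mono) auto
        then show ?case using elim unfolding S by (simp add: sum_nonneg abs_of_nonneg indicator_def)
      qed
      then have "Lp_norm p m (\<lambda>x. indicator (B k) x * pn' v x) \<le> nrm' (S n)"
        unfolding nrm'_def by (intro Lp_norm_mono[OF p pn'_Lp]) simp_all
      then show ?thesis using n(2) by linarith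
    qed
    have "nrm' v \<le> c"
      unfolding nrm'_def
    proof (rule Lp_norm_increasing_sets(2)[OF p pn'_measurable B _ _ _ le])
      show "incseq B" unfolding incseq_def B_def by (intro allI impI UN_mono) auto
      have "(\<Union>k. B k) = U" by (auto simp: B_def U_def)
      then show "AE x in m. x \<notin> (\<Union>k. B k) \<longrightarrow> pn' v x = 0" using supp by simp
      show "(\<lambda>x. indicator (B k) x * pn' v x) \<in> Lp_space p m" for k
        by (rule Lp_dominated[OF pn'_Lp[of v]]) (auto intro!: AE_I2 simp: indicator_def)
    qed
    then show False using c(2) by simp
  qed
  with v show ?thesis unfolding S_def by blast
qed

lemma module': "Lp_normed_module p m nrm' act pn'"
proof
  show "Banach_norm nrm'" by (rule Banach_norm_nrm')
  show "pn' v \<in> Lp_space p m" for v by (rule pn'_Lp)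
  show "AE x in m. 0 \<le> pn' v x" for v using pn'_equivalent[of v] by eventually_elim simp
  show "nrm' v = Lp_norm p m (pn' v)" for v by (rule nrm'_def)
  show "AE x in m. pn' (act f v) x = \<bar>f x\<bar> * pn' v x" if "f \<in> Linf m" for f v by (rule pn'_act[OF that])
  show "act (indicator (\<Union>n. A n)) v = 0" if "\<And>n::nat. A n \<in> sets m" "\<And>n. act (indicator (A n)) v = 0" for v A
    using that by (rule locality)
  show "\<exists>v. (\<forall>i. act (indicator (A i)) v = act (indicator (A i)) (w i)) \<and>
      ereal (nrm' v) \<le> liminf (\<lambda>n. ereal (nrm' (\<Sum>i<n. act (indicator (A i)) (w i))))"
    if "\<And>n. A n \<in> sets m" "\<And>i j. act (indicator (A i \<inter> A j)) (w i) = act (indicator (A i \<inter> A j)) (w j)"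
      "limsup (\<lambda>n. ereal (nrm' (\<Sum>i<n. act (indicator (A i)) (w i)))) < \<infinity>" for w A
    using that by (rule glueing')
qed (rule act_cong act_add_left act_scale_left act_add_right act_scale_right act_mult act_one; assumption)+

text \<open>The same map works, because both families of norms have the same representatives and
  hence the same classes.\<close>

lemma isometry': "Lp_product_isometry p m act pn' E F' coordinates"
proof -
  have "Lp_product p m E F' = Lp_product p m E F" unfolding Lp_product_def product_reps_eq ..
  then show ?thesis
    using coordinates_isometry coordinates_pn' unfolding Lp_product_isometry_def by simp
qed

end

section \<open>Uniform convexity\<close>

text \<open>Write the two numbers as 1 + y and 1 - y: the sum of their powers increases strictly in
  y \<ge> 0 and equals 2 at y = 0.\<close>

lemma powr_mean_strict:
  fixes a b q :: real
  assumes q: "1 < q" and ab: "0 \<le> a" "0 \<le> b" "a + b = 2" "a powr q + b powr q = 2"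
  shows "a = 1"
proof (rule ccontr)
  assume "a \<noteq> 1"
  define x where "x = \<bar>a - 1\<bar>"
  have x: "0 < x" "x \<le> 1" using \<open>a \<noteq> 1\<close> ab by (auto simp: x_def)
  define f where "f y = (1 + y) powr q + (1 - y) powr q" for y :: real
  have "f 0 < f x"
  proof (rule DERIV_pos_imp_increasing_open[OF x(1)])
    fix y assume y: "0 < y" "y < x"
    have "(f has_real_derivative q * (1 + y) powr (q - 1) - q * (1 - y) powr (q - 1)) (at y)"
      unfolding f_def using y x by (auto intro!: derivative_eq_intros)
    moreover have "(1 - y) powr (q - 1) < (1 + y) powr (q - 1)"
      using y x q by (intro powr_less_mono2) auto
    ultimately show "\<exists>d. (f has_real_derivative d) (at y) \<and> 0 < d"
      using q by (intro exI[of _ "q * (1 + y) powr (q - 1) - q * (1 - y) powr (q - 1)"]) simp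
    next
    show "continuous_on {0..x} f"
      unfolding f_def using x q by (intro continuous_intros continuous_on_powr') auto
  qed
  moreover have "f x = a powr q + b powr q"
  proof (cases "1 \<le> a")
    case True
    then have "1 + x = a" "1 - x = b" using ab by (auto simp: x_def)
    then show ?thesis by (simp add: f_def)
  next
    case False
    then have "1 + x = b" "1 - x = a" using ab by (auto simp: x_def)
    then show ?thesis by (simp add: f_def)
  qed
  ultimately show False using ab by (simp add: f_def)
qed

lemma powr_mean_le:
  fixes a b q :: real
  assumes "1 \<le> q" "0 \<le> a" "0 \<le> b"
  shows "((a + b) / 2) powr q \<le> (a powr q + b powr q) / 2"
  using powr_convex_combination[of a b "1/2" "1/2" q] assms by (simp add: add_divide_distrib)

text \<open>\<open>a\<close>, \<open>b\<close>, \<open>s\<close> and \<open>d\<close> stand for the Euclidean norms of two vectors, their midpoint and half of their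
  difference. By homogeneity and compactness it suffices that the midpoint is strictly shorter.\<close>

lemma midpoint_powr_bound:
  fixes q e :: real
  assumes q: "1 < q" and e: "0 < e"
  obtains c where "0 < c" "c \<le> 1"
    "\<And>a b s d. \<lbrakk>0 \<le> a; 0 \<le> b; 0 \<le> s; 0 \<le> d; s \<le> (a + b) / 2; s\<^sup>2 + d\<^sup>2 = (a\<^sup>2 + b\<^sup>2) / 2;
       e * (a powr q + b powr q) \<le> d powr q\<rbrakk> \<Longrightarrow> s powr q \<le> (1 - c) * ((a powr q + b powr q) / 2)"
proof -
  \<comment> \<open>By homogeneity the sum of the powers is normalised to 2. The absolute values
    keep the powers continuous on the whole space, which makes the set visibly closed.\<close>
  define K :: "(real \<times> real \<times> real \<times> real) set" where
    "K = {(a, b, s, d). 0 \<le> a \<and> 0 \<le> b \<and> 0 \<le> s \<and> 0 \<le> d \<and> s \<le> (a + b) / 2 \<and> s\<^sup>2 + d\<^sup>2 = (a\<^sup>2 + b\<^sup>2) / 2 \<and>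
       \<bar>a\<bar> powr q + \<bar>b\<bar> powr q = 2 \<and> e * 2 \<le> \<bar>d\<bar> powr q}"
  have "closed K"
  proof -
    have pw: "continuous_on UNIV (\<lambda>x. \<bar>g x\<bar> powr q)" if "continuous_on UNIV g" for g :: "real \<times> real \<times> real \<times> real \<Rightarrow> real"
      using q that by (intro continuous_on_powr' continuous_intros) auto
    show ?thesis
      unfolding K_def case_prod_unfold
      by (intro closed_Collect_conj closed_Collect_le closed_Collect_eq continuous_intros pw) auto
  qed
  have le2: "a \<le> 2" if "0 \<le> a" "a powr q \<le> 2" for a
  proof (rule ccontr)
    assume "\<not> a \<le> 2"
    then have "2 powr q < a powr q" using q by (intro powr_less_mono2) auto
    moreover have "2 powr 1 \<le> (2 :: real) powr q" using q by (intro powr_mono) auto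
    ultimately show False using that by simp
  qed
  have K_bounds: "0 \<le> a" "a \<le> 2" "0 \<le> b" "b \<le> 2" "0 \<le> s" "s \<le> 1" "0 < d" "d \<le> 2" "s < 1"
    if "(a, b, s, d) \<in> K" for a b s d
  proof -
    have *: "0 \<le> a" "0 \<le> b" "0 \<le> s" "0 \<le> d" "s \<le> (a + b) / 2" "s\<^sup>2 + d\<^sup>2 = (a\<^sup>2 + b\<^sup>2) / 2"
       "a powr q + b powr q = 2" "e * 2 \<le> d powr q" using that by (auto simp: K_def)
    show "0 \<le> a" "0 \<le> b" "0 \<le> s" by fact+
    have "0 \<le> a powr q" "0 \<le> b powr q" by simp_all
    then have "a powr q \<le> 2" "b powr q \<le> 2" using *(7) by linarith+
    then show a2: "a \<le> 2" and b2: "b \<le> 2" using le2 * by blast+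
    show d0: "0 < d" using *(4,8) e q by (cases "d = 0") auto
    have "((a + b) / 2) powr q \<le> 1" using powr_mean_le[of q a b] q * by simp
    then have ab1: "(a + b) / 2 \<le> 1"
      using powr_less_mono2[of q 1 "(a + b) / 2"] q by (force simp: not_le[symmetric])
    then show "s \<le> 1" using *(5) by linarith
    have "d\<^sup>2 \<le> (a\<^sup>2 + b\<^sup>2) / 2" using *(6) zero_le_power2[of s] by linarith
    also have "\<dots> \<le> (2\<^sup>2 + 2\<^sup>2) / 2" using a2 b2 * by (intro divide_right_mono add_mono power_mono) auto
    finally show "d \<le> 2" by (intro power2_le_imp_le[of d 2]) auto
    \<comment> \<open>If the mean of \<open>a\<close> and \<open>b\<close> is less than 1, so is
      \<open>s\<close>. If it is 1, both numbers are 1, and the parallelogram identity with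
      \<open>d > 0\<close> shortens the midpoint.\<close>
    show "s < 1"
    proof (cases "(a + b) / 2 = 1")
      case True
      then have "a = 1" using powr_mean_strict[OF q *(1,2)] *(7) by simp
      then have "b = 1" using True by simp
      have "0 < d\<^sup>2" using d0 by simp
      moreover have "s\<^sup>2 + d\<^sup>2 = 1" using *(6) \<open>a = 1\<close> \<open>b = 1\<close> by simp
      ultimately have "s\<^sup>2 < 1\<^sup>2" unfolding one_power2 by linarith
      then show ?thesis by (rule power2_less_imp_less) simp
    qed (use ab1 *(5) in linarith)
  qed
  have "bounded K"
  proof (rule bounded_subset)
    show "bounded ({0..2} \<times> {0..2} \<times> {0..1} \<times> {0..2::real} :: (real \<times> real \<times> real \<times> real) set)"
      by (intro bounded_Times bounded_closed_interval)
    show "K \<subseteq> {0..2} \<times> {0..2} \<times> {0..1} \<times> {0..2}"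
      using K_bounds by (auto simp: less_imp_le)
  qed
  with \<open>closed K\<close> have "compact K" by (simp add: compact_eq_bounded_closed)
  obtain h where h: "0 \<le> h" "h < 1" "\<And>a b s d. (a, b, s, d) \<in> K \<Longrightarrow> s \<le> h"
  proof (cases "K = {}")
    case True
    then show ?thesis using that[of 0] by simp
  next
    case False
    have "continuous_on K (\<lambda>x. fst (snd (snd x)))" by (intro continuous_intros)
    then obtain x where x: "x \<in> K" "\<And>y. y \<in> K \<Longrightarrow> fst (snd (snd y)) \<le> fst (snd (snd x))"
      using continuous_attains_sup[OF \<open>compact K\<close> False] by blast
    obtain a b s d where xs: "x = (a, b, s, d)" by (cases x)
    show ?thesis
    proof (rule that[of s])
      show "0 \<le> s" "s < 1" using x(1) unfolding xs by (rule K_bounds)+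
      show "s' \<le> s" if "(a', b', s', d') \<in> K" for a' b' s' d' using x(2)[OF that] by (simp add: xs)
    qed
  qed
  show ?thesis
  \<comment> \<open>\<open>h\<close> bounds the midpoint in the normalised situation; raising it to
    the power \<open>q\<close> gives the relative gain.\<close>
  proof (rule that[of "1 - h powr q"])
    show "0 < 1 - h powr q" using powr_less_mono2[of q h 1] h q by simp
    show "1 - h powr q \<le> 1" by simp
    fix a b s d :: real
    assume *: "0 \<le> a" "0 \<le> b" "0 \<le> s" "0 \<le> d" "s \<le> (a + b) / 2" "s\<^sup>2 + d\<^sup>2 = (a\<^sup>2 + b\<^sup>2) / 2"
      "e * (a powr q + b powr q) \<le> d powr q"
    define S where "S = (a powr q + b powr q) / 2"
    have S0: "0 \<le> S" by (simp add: S_def)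
    have "s powr q \<le> h powr q * S"
    proof (cases "S = 0")
      case True
      then have "a powr q = 0" "b powr q = 0" unfolding S_def by (simp_all add: add_nonneg_eq_0_iff)
      then have "s = 0" using * by simp
      then show ?thesis by (simp add: True)
    next
      case False
      define t where "t = S powr (1 / q)"
      have t: "0 < t" "t powr q = S" using False S0 q by (simp_all add: t_def powr_powr)
      have "(a / t, b / t, s / t, d / t) \<in> K"
        unfolding K_def
      proof (intro CollectI case_prodI conjI)
        show "s / t \<le> (a / t + b / t) / 2" using divide_right_mono[OF *(5), of t] t by (simp add: add_divide_distrib)
        have "(s / t)\<^sup>2 + (d / t)\<^sup>2 = (s\<^sup>2 + d\<^sup>2) / t\<^sup>2" by (simp add: power_divide add_divide_distrib)
        also have "\<dots> = ((a / t)\<^sup>2 + (b / t)\<^sup>2) / 2" unfolding *(6) by (simp add: power_divide add_divide_distrib)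
        finally show "(s / t)\<^sup>2 + (d / t)\<^sup>2 = ((a / t)\<^sup>2 + (b / t)\<^sup>2) / 2" .
        have "\<bar>a / t\<bar> powr q + \<bar>b / t\<bar> powr q = (2 * S) / S"
          using * t by (simp add: powr_divide add_divide_distrib S_def)
        then show "\<bar>a / t\<bar> powr q + \<bar>b / t\<bar> powr q = 2" using False by simp
        have "e * 2 * S \<le> d powr q" using *(7) by (simp add: S_def)
        then show "e * 2 \<le> \<bar>d / t\<bar> powr q" using * t False S0 by (simp add: powr_divide field_simps)
      qed (use * t in auto)
      from h(3)[OF this] have "s \<le> h * t" using t by (simp add: field_simps)
      then have "s powr q \<le> (h * t) powr q" using * q by (intro powr_mono2) auto
      then show ?thesis using h(1) t by (simp add: powr_mult)
    qed
    then show "s powr q \<le> (1 - (1 - h powr q)) * ((a powr q + b powr q) / 2)" by (simp add: S_def)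
  qed
qed

text \<open>A form of the gain that is linear in the powers and can be integrated. Let X be the sum
  of the two powers. Where \<open>d powr q\<close> is at least e X, the gain c X / 2 exceeds c times
  \<open>d powr q\<close>; elsewhere the bracket is negative and convexity suffices.\<close>

lemma midpoint_powr_integrand:
  fixes q e :: real
  assumes q: "1 < q" and e: "0 < e"
  obtains c where "0 < c"
    "\<And>a b s d. \<lbrakk>0 \<le> a; 0 \<le> b; 0 \<le> s; 0 \<le> d; s \<le> (a + b) / 2; s\<^sup>2 + d\<^sup>2 = (a\<^sup>2 + b\<^sup>2) / 2; d \<le> (a + b) / 2\<rbrakk>
      \<Longrightarrow> s powr q \<le> (a powr q + b powr q) / 2 - c * (d powr q - e * (a powr q + b powr q))"
proof -
  obtain c where c: "0 < c" "c \<le> 1"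
    "\<And>a b s d. \<lbrakk>0 \<le> a; 0 \<le> b; 0 \<le> s; 0 \<le> d; s \<le> (a + b) / 2; s\<^sup>2 + d\<^sup>2 = (a\<^sup>2 + b\<^sup>2) / 2;
       e * (a powr q + b powr q) \<le> d powr q\<rbrakk> \<Longrightarrow> s powr q \<le> (1 - c) * ((a powr q + b powr q) / 2)"
    using midpoint_powr_bound[OF q e] by blast
  show ?thesis
  proof (rule that[OF c(1)])
    fix a b s d :: real
    assume *: "0 \<le> a" "0 \<le> b" "0 \<le> s" "0 \<le> d" "s \<le> (a + b) / 2" "s\<^sup>2 + d\<^sup>2 = (a\<^sup>2 + b\<^sup>2) / 2" "d \<le> (a + b) / 2"
    define X where "X = a powr q + b powr q"
    have mean: "((a + b) / 2) powr q \<le> X / 2" using powr_mean_le[of q a b] q * by (simp add: X_def)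
    have "s powr q \<le> ((a + b) / 2) powr q" "d powr q \<le> ((a + b) / 2) powr q" using * q by (auto intro!: powr_mono2)
    with mean have sX: "s powr q \<le> X / 2" and dX: "d powr q \<le> X / 2" by linarith+
    have X0: "0 \<le> X" by (simp add: X_def)
    have "s powr q \<le> X / 2 - c * (d powr q - e * X)"
    proof (cases "e * X \<le> d powr q")
      case True
      have "s powr q \<le> (1 - c) * (X / 2)" using c(3)[OF *(1-6)] True by (simp add: X_def)
      also have "\<dots> = X / 2 - c * (X / 2)" by (simp add: left_diff_distrib)
      also have "\<dots> \<le> X / 2 - c * (d powr q - e * X)"
      proof -
        have "0 \<le> e * X" using e X0 by simp
        then have "c * (d powr q - e * X) \<le> c * (X / 2)" using dX c(1) by (intro mult_left_mono) auto
        then show ?thesis by linarith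
      qed
      finally show ?thesis .
    next
      case False
      then have "c * (d powr q - e * X) \<le> 0" using c(1) by (intro mult_nonneg_nonpos) auto
      then show ?thesis using sX by linarith
    qed
    then show "s powr q \<le> (a powr q + b powr q) / 2 - c * (d powr q - e * (a powr q + b powr q))" by (simp add: X_def)
  qed
qed

text \<open>One factor \<delta> has to serve all radii up to \<open>R\<close> with an absolute
  separation \<theta>: the levels of a tree lie in shrinking balls, but their siblings stay equally
  far apart.\<close>

definition uniformly_convex :: "('v::real_vector \<Rightarrow> real) \<Rightarrow> bool" where
  "uniformly_convex nrm \<longleftrightarrow> (\<forall>\<theta>>0. \<forall>R>0. \<exists>\<delta><1. 0 \<le> \<delta> \<and> (\<forall>r a b. r \<le> R \<and> nrm a \<le> r \<and> nrm b \<le> r \<and> \<theta> \<le> nrm (a - b) \<longrightarrow>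
     nrm ((1 / 2) *\<^sub>R (a + b)) \<le> \<delta> * r))"

lemma (in bounded_module) uniformly_convex_nrm':
  assumes p1: "1 < p" and pfin: "p \<noteq> \<infinity>"
  shows "uniformly_convex nrm'"
  unfolding uniformly_convex_def
proof (intro allI impI)
  fix \<theta> R :: real assume \<theta>: "0 < \<theta>" and R: "0 < R"
  define q where "q = enn2real p"
  have q: "1 < q"
  proof -
    have "ennreal (enn2real p) = p" using pfin by (simp add: infinity_ennreal_def less_top)
    then have "enn2real p \<noteq> 1" using p1 by auto
    then show ?thesis using enn2real_ge_1[OF p pfin] by (simp add: q_def less_le)
  qed
  have nn: "0 \<le> nrm' v" for v by (simp add: nrm'_def Lp_norm_nonneg)
  have int: "integrable m (\<lambda>x. pn' v x powr q)" and I: "(\<integral>x. pn' v x powr q \<partial>m) = nrm' v powr q" for v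
  proof -
    have eq: "AE x in m. \<bar>pn' v x\<bar> powr q = pn' v x powr q"
      using pn'_equivalent[of v] by eventually_elim simp
    have "integrable m (\<lambda>x. \<bar>pn' v x\<bar> powr q)" using pn'_Lp[of v] pfin by (simp add: Lp_space_def q_def)
    then show "integrable m (\<lambda>x. pn' v x powr q)" using eq by (subst integrable_cong_AE[symmetric, OF _ _ eq]) simp_all
    have "(\<integral>x. pn' v x powr q \<partial>m) = (\<integral>x. \<bar>pn' v x\<bar> powr q \<partial>m)"
      by (rule integral_cong_AE) (use eq in \<open>auto elim!: AE_mp\<close>)
    also have "\<dots> = nrm' v powr q" unfolding nrm'_def q_def by (rule Lp_norm_powr[OF p pfin, symmetric])
    finally show "(\<integral>x. pn' v x powr q \<partial>m) = nrm' v powr q" .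
  qed
  \<comment> \<open>Chosen so that the error \<open>e * (2 * R powr q)\<close> is half of the gain
    \<open>(\<theta> / 2) powr q\<close>.\<close>
  define e where "e = (\<theta> / 2) powr q / (4 * R powr q)"
  have Rq: "0 < R powr q" and \<theta>q: "0 < (\<theta> / 2) powr q" using R \<theta> by simp_all
  have e: "0 < e" unfolding e_def using Rq \<theta>q by simp
  obtain c where c: "0 < c"
    "\<And>a b s d. \<lbrakk>0 \<le> a; 0 \<le> b; 0 \<le> s; 0 \<le> d; s \<le> (a + b) / 2; s\<^sup>2 + d\<^sup>2 = (a\<^sup>2 + b\<^sup>2) / 2; d \<le> (a + b) / 2\<rbrakk>
      \<Longrightarrow> s powr q \<le> (a powr q + b powr q) / 2 - c * (d powr q - e * (a powr q + b powr q))"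
    using midpoint_powr_integrand[OF q e] by blast
  \<comment> \<open>The net gain as a fraction of \<open>R powr q\<close>; for
    \<open>r \<le> R\<close> it is at least \<open>\<eta> * r powr q\<close>. As \<eta> may exceed
    1, the root below is taken of a maximum with 0.\<close>
  define \<eta> where "\<eta> = c * (\<theta> / 2) powr q / 2 / R powr q"
  have \<eta>: "0 < \<eta>" unfolding \<eta>_def using c(1) Rq \<theta>q by simp
  define \<delta> where "\<delta> = (max 0 (1 - \<eta>)) powr (1 / q)"
  have \<delta>: "0 \<le> \<delta>" "\<delta> < 1" "\<delta> powr q = max 0 (1 - \<eta>)"
  proof -
    have "\<delta> < 1 powr (1 / q)" unfolding \<delta>_def using \<eta> q by (intro powr_less_mono2) auto
    then show "\<delta> < 1" by simp
  qed (use q in \<open>simp_all add: \<delta>_def powr_powr\<close>)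
  have "nrm' ((1 / 2) *\<^sub>R (v + w)) \<le> \<delta> * r"
    if r: "r \<le> R" and v: "nrm' v \<le> r" and w: "nrm' w \<le> r" and vw: "\<theta> \<le> nrm' (v - w)" for r v w
  proof -
    have r0: "0 \<le> r" using nn[of v] v by linarith
    define z where "z = (1 / 2) *\<^sub>R (v + w)"
    define d where "d = (1 / 2) *\<^sub>R (v - w)"
    have half: "AE x in m. pn' ((1 / 2) *\<^sub>R y) x = pn' y x / 2" for y
      using pn'_act[OF Linf_const[of "1 / 2"], of y] by (simp add: act_const)
    have minus: "AE x in m. pn' (- w) x = pn' w x"
      using pn'_act[OF Linf_const[of "- 1"], of w] by (simp add: act_const)
    have pt: "AE x in m. pn' z x powr q \<le> (pn' v x powr q + pn' w x powr q) / 2 - c * (pn' d x powr q - e * (pn' v x powr q + pn' w x powr q))"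
      using half[of "v + w"] half[of "v - w"] pn'_triangle[of v w] pn'_triangle[of v "- w"] minus pn'_parallelogram[of v w]
        pn'_equivalent[of v] pn'_equivalent[of w] pn'_equivalent[of z] pn'_equivalent[of d]
    proof eventually_elim
      case (elim x)
      have zx: "pn' z x = pn' (v + w) x / 2" and dx: "pn' d x = pn' (v - w) x / 2" using elim by (simp_all add: z_def d_def)
      show ?case
      proof (rule c(2))
        show "(pn' z x)\<^sup>2 + (pn' d x)\<^sup>2 = ((pn' v x)\<^sup>2 + (pn' w x)\<^sup>2) / 2"
          using elim(6) unfolding zx dx by (simp add: power_divide field_simps)
      qed (use elim zx dx in auto)
    qed
    have "nrm' z powr q = (\<integral>x. pn' z x powr q \<partial>m)" by (rule I[symmetric])
    also have "\<dots> \<le> (\<integral>x. (pn' v x powr q + pn' w x powr q) / 2 - c * (pn' d x powr q - e * (pn' v x powr q + pn' w x powr q)) \<partial>m)"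
      by (rule integral_mono_AE[OF int _ pt]) (use int in auto)
    also have "\<dots> = (nrm' v powr q + nrm' w powr q) / 2 - c * (nrm' d powr q - e * (nrm' v powr q + nrm' w powr q))"
      using int by (simp add: I)
    also have "\<dots> \<le> r powr q - c * ((\<theta> / 2) powr q / 2)"
    proof -
      have vr: "nrm' v powr q \<le> r powr q" and wr: "nrm' w powr q \<le> r powr q" using v w nn q by (auto intro!: powr_mono2)
      have "r powr q \<le> R powr q" using r r0 q by (intro powr_mono2) auto
      then have "e * (nrm' v powr q + nrm' w powr q) \<le> e * (2 * R powr q)" using vr wr e by (intro mult_left_mono) auto
      also have "\<dots> = (\<theta> / 2) powr q / 2" using Rq by (simp add: e_def)
      finally have 1: "e * (nrm' v powr q + nrm' w powr q) \<le> (\<theta> / 2) powr q / 2" .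
      have "nrm' d = nrm' (v - w) / 2" unfolding d_def nrm'_scale by simp
      then have "(\<theta> / 2) powr q \<le> nrm' d powr q" using vw \<theta> q by (intro powr_mono2) auto
      with 1 have "(\<theta> / 2) powr q / 2 \<le> nrm' d powr q - e * (nrm' v powr q + nrm' w powr q)" by linarith
      have "(nrm' v powr q + nrm' w powr q) / 2 \<le> r powr q" using vr wr by simp
      then show ?thesis using mult_left_mono[OF \<open>(\<theta> / 2) powr q / 2 \<le> _\<close> less_imp_le[OF c(1)]] by (rule diff_mono)
    qed
    also have "\<dots> \<le> (1 - \<eta>) * r powr q"
    proof -
      have "r powr q / R powr q \<le> 1" using r r0 q Rq by (simp add: powr_mono2)
      then have "\<eta> * r powr q \<le> c * ((\<theta> / 2) powr q / 2)"
        using mult_left_mono[of "r powr q / R powr q" 1 "c * ((\<theta> / 2) powr q / 2)"] c(1) by (simp add: \<eta>_def field_simps)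
      then show ?thesis by (simp add: left_diff_distrib)
    qed
    also have "\<dots> \<le> \<delta> powr q * r powr q" unfolding \<delta>(3) by (intro mult_right_mono) auto
    also have "\<dots> = (\<delta> * r) powr q" using \<delta> r0 by (simp add: powr_mult)
    finally have "nrm' z powr q \<le> (\<delta> * r) powr q" .
    then show ?thesis
      using powr_less_mono2[of q "\<delta> * r" "nrm' z"] q \<delta>(1) r0 unfolding z_def by (force simp: not_le[symmetric])
  qed
  with \<delta>(1,2) show "\<exists>\<delta><1. 0 \<le> \<delta> \<and> (\<forall>r a b. r \<le> R \<and> nrm' a \<le> r \<and> nrm' b \<le> r \<and> \<theta> \<le> nrm' (a - b) \<longrightarrow>
     nrm' ((1 / 2) *\<^sub>R (a + b)) \<le> \<delta> * r)"
    by blast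
qed

section \<open>Trees and reflexivity\<close>

text \<open>The roots of the dyadic trees of a given height with leaves in \<open>S\<close>: every node is the midpoint of its
  two children, and these have distance at least \<open>\<theta>\<close>.\<close>

primrec tree_roots :: "('v::real_vector \<Rightarrow> real) \<Rightarrow> real \<Rightarrow> 'v set \<Rightarrow> nat \<Rightarrow> 'v set" where
  "tree_roots nrm \<theta> S 0 = S"
| "tree_roots nrm \<theta> S (Suc n) = {(1 / 2) *\<^sub>R (a + b) | a b.
     a \<in> tree_roots nrm \<theta> S n \<and> b \<in> tree_roots nrm \<theta> S n \<and> \<theta> \<le> nrm (a - b)}"

lemma tree_roots_convex: "tree_roots nrm \<theta> S n \<subseteq> convex hull S"
proof (induction n)
  case (Suc n)
  have "(1 / 2) *\<^sub>R (a + b) \<in> convex hull S" if "a \<in> convex hull S" "b \<in> convex hull S" for a b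
    using convexD[OF convex_convex_hull that, of "1 / 2" "1 / 2"] by (simp add: scaleR_add_right)
  then show ?case using Suc by auto
qed (simp add: hull_subset)

lemma tree_roots_mono:
  assumes "\<And>x. \<theta> \<le> nrm x \<Longrightarrow> \<theta>' \<le> nrm' x" "S \<subseteq> S'"
  shows "tree_roots nrm \<theta> S n \<subseteq> tree_roots nrm' \<theta>' S' n"
proof (induction n)
  case (Suc n)
  then show ?case using assms(1) by fastforce
qed (use assms in simp)

text \<open>Finite representability embeds one finite dimensional subspace at a time, so a tree must
  first be reduced to finitely many leaves.\<close>

lemma tree_roots_finite:
  assumes "z \<in> tree_roots nrm \<theta> S n"
  shows "\<exists>B. finite B \<and> B \<subseteq> S \<and> z \<in> tree_roots nrm \<theta> B n"
  using assms
proof (induction n arbitrary: z)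
  case 0
  then show ?case by (intro exI[of _ "{z}"]) simp
next
  case (Suc n)
  then obtain a b where ab: "z = (1 / 2) *\<^sub>R (a + b)" "a \<in> tree_roots nrm \<theta> S n" "b \<in> tree_roots nrm \<theta> S n" "\<theta> \<le> nrm (a - b)"
    by auto
  obtain A B where AB: "finite A" "A \<subseteq> S" "a \<in> tree_roots nrm \<theta> A n" "finite B" "B \<subseteq> S" "b \<in> tree_roots nrm \<theta> B n"
    using Suc.IH[OF ab(2)] Suc.IH[OF ab(3)] by blast
  have "a \<in> tree_roots nrm \<theta> (A \<union> B) n" "b \<in> tree_roots nrm \<theta> (A \<union> B) n"
    using tree_roots_mono[of \<theta> nrm \<theta> nrm A "A \<union> B" n] tree_roots_mono[of \<theta> nrm \<theta> nrm B "A \<union> B" n] AB by blast+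
  then show ?case using ab AB by (intro exI[of _ "A \<union> B"]) auto
qed

text \<open>Linear maps preserve midpoints. All nodes are convex combinations of leaves, so the
  lower bound on the span of the leaves keeps siblings separated.\<close>

lemma tree_roots_linear:
  assumes T: "linear T" and le: "\<And>y. y \<in> span B \<Longrightarrow> nrm y \<le> nrm' (T y)"
  shows "z \<in> tree_roots nrm \<theta> B n \<Longrightarrow> T z \<in> tree_roots nrm' \<theta> (T ` B) n"
proof (induction n arbitrary: z)
  case (Suc n)
  then obtain a b where ab: "z = (1 / 2) *\<^sub>R (a + b)" "a \<in> tree_roots nrm \<theta> B n" "b \<in> tree_roots nrm \<theta> B n" "\<theta> \<le> nrm (a - b)"
    by auto
  have "a - b \<in> span B"
    using ab(2,3) tree_roots_convex[of nrm \<theta> B n] convex_hull_subset_span[of B] by (intro span_diff) auto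
  then have "\<theta> \<le> nrm' (T a - T b)" using le[of "a - b"] ab(4) by (simp add: linear_diff[OF T])
  moreover have "T z = (1 / 2) *\<^sub>R (T a + T b)" using ab(1) by (simp add: linear_cmul[OF T] linear_add[OF T])
  ultimately show ?case using Suc.IH[OF ab(2)] Suc.IH[OF ab(3)] by auto
qed simp

text \<open>Every level shrinks the radius by the factor \<delta> while siblings stay \<theta>
  apart, so the height is bounded.\<close>

lemma uniformly_convex_no_trees:
  assumes uc: "uniformly_convex nrm"
    and nn: "\<And>v. 0 \<le> nrm v" and diff: "\<And>v w. nrm (v - w) \<le> nrm v + nrm w"
    and \<theta>: "0 < \<theta>" and S: "\<And>v. v \<in> S \<Longrightarrow> nrm v \<le> R"
  shows "\<exists>n. tree_roots nrm \<theta> S n = {}"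
proof -
  \<comment> \<open>\<open>uniformly_convex\<close> speaks of positive radii only.\<close>
  define R' where "R' = max R 1"
  have R': "0 < R'" "\<And>v. v \<in> S \<Longrightarrow> nrm v \<le> R'" using S by (auto simp: R'_def intro: max.coboundedI1)
  obtain \<delta> where \<delta>: "0 \<le> \<delta>" "\<delta> < 1"
    "\<And>r a b. \<lbrakk>r \<le> R'; nrm a \<le> r; nrm b \<le> r; \<theta> \<le> nrm (a - b)\<rbrakk> \<Longrightarrow> nrm ((1 / 2) *\<^sub>R (a + b)) \<le> \<delta> * r"
    using uc \<theta> R'(1) unfolding uniformly_convex_def by metis
  have bound: "nrm z \<le> \<delta> ^ n * R'" if "z \<in> tree_roots nrm \<theta> S n" for z n
    using that
  proof (induction n arbitrary: z)
    case (Suc n)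
    then obtain a b where ab: "z = (1 / 2) *\<^sub>R (a + b)" "a \<in> tree_roots nrm \<theta> S n" "b \<in> tree_roots nrm \<theta> S n" "\<theta> \<le> nrm (a - b)"
      by auto
    have "\<delta> ^ n * R' \<le> R'" using \<delta> R'(1) power_le_one[of \<delta> n] by (simp add: mult_left_le_one_le)
    from \<delta>(3)[OF this Suc.IH[OF ab(2)] Suc.IH[OF ab(3)] ab(4)] show ?case by (simp add: ab(1))
  qed (use R' in simp)
  obtain n where n: "\<delta> ^ n < \<theta> / (2 * R')" using real_arch_pow_inv[of "\<theta> / (2 * R')" \<delta>] \<theta> R'(1) \<delta>(2) by auto
  have "tree_roots nrm \<theta> S (Suc n) = {}"
  proof (rule ccontr)
    assume "tree_roots nrm \<theta> S (Suc n) \<noteq> {}"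
    then obtain a b where "a \<in> tree_roots nrm \<theta> S n" "b \<in> tree_roots nrm \<theta> S n" "\<theta> \<le> nrm (a - b)" by auto
    then have "\<theta> \<le> 2 * (\<delta> ^ n * R')" using bound[of a n] bound[of b n] diff[of a b] by linarith
    also have "\<dots> < \<theta>" using n R'(1) by (simp add: field_simps)
    finally show False by simp
  qed
  then show ?thesis by blast
qed

text \<open>Goldstine's theorem. Minimising the quadratic error over the ball avoids the separation of convex sets.\<close>

lemma goldstine:
  fixes \<phi> :: "('v::real_normed_vector \<Rightarrow>\<^sub>L real) \<Rightarrow>\<^sub>L real"
  assumes fin: "finite J" and e: "0 < e"
  shows "\<exists>x\<in>cball 0 (norm \<phi>). \<forall>f\<in>J. \<bar>blinfun_apply f x - blinfun_apply \<phi> f\<bar> < e"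
proof (rule ccontr)
  assume contra: "\<not> ?thesis"
  define R where "R = norm \<phi>"
  define \<Psi> where "\<Psi> x = (\<Sum>f\<in>J. (blinfun_apply f x - blinfun_apply \<phi> f)\<^sup>2)" for x
  have ge: "e\<^sup>2 \<le> \<Psi> x" if "x \<in> cball 0 R" for x
  proof -
    obtain f where f: "f \<in> J" "e \<le> \<bar>blinfun_apply f x - blinfun_apply \<phi> f\<bar>"
      using contra \<open>x \<in> cball 0 R\<close> unfolding R_def by (meson not_less)
    have "e\<^sup>2 \<le> (blinfun_apply f x - blinfun_apply \<phi> f)\<^sup>2"
      using power_mono[OF f(2), of 2] e by simp
    also have "\<dots> \<le> \<Psi> x"
      unfolding \<Psi>_def by (rule member_le_sum[OF f(1) _ fin, of "\<lambda>f. (blinfun_apply f x - blinfun_apply \<phi> f)\<^sup>2"]) simp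
    finally show ?thesis .
  qed
  define Q where "Q = (\<Sum>f\<in>J. (norm f * (2 * R))\<^sup>2)"
  \<comment> \<open>Comparing the value at \<open>x\<close> with that at
    \<open>x + t (y - x)\<close>, allowing a slack of t squared, and dividing by
    \<open>2 * t\<close> leaves \<open>t * (1 + Q) / 2\<close>.\<close>
  define M where "M = (1 + Q) / 2"
  have M: "0 < M" unfolding M_def Q_def by (intro divide_pos_pos add_pos_nonneg sum_nonneg) auto
  have R0: "0 \<le> R" by (simp add: R_def)
  define I where "I = (INF x\<in>cball 0 R. \<Psi> x)"
  have ne: "cball 0 R \<noteq> ({} :: 'v set)" using R0 by simp
  have bdd: "bdd_below (\<Psi> ` cball 0 R)" by (rule bdd_belowI2[OF ge])
  have "e\<^sup>2 \<le> t * M" if t: "0 < t" "t \<le> 1" for t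
  proof -
    have "I < I + t\<^sup>2" using t by simp
    then obtain x where x: "x \<in> cball 0 R" "\<Psi> x < I + t\<^sup>2"
      unfolding I_def using cINF_less_iff[OF ne bdd] by blast
    \<comment> \<open>Minus half the gradient of \<Psi> at \<open>x\<close>.\<close>
    define g where "g = (\<Sum>f\<in>J. (blinfun_apply \<phi> f - blinfun_apply f x) *\<^sub>R f)"
    have g: "blinfun_apply g y = (\<Sum>f\<in>J. (blinfun_apply \<phi> f - blinfun_apply f x) * blinfun_apply f y)" for y
      by (simp add: g_def blinfun.sum_left blinfun.scaleR_left)
    have \<phi>g: "blinfun_apply \<phi> g = (\<Sum>f\<in>J. (blinfun_apply \<phi> f - blinfun_apply f x) * blinfun_apply \<phi> f)"
      by (simp add: g_def blinfun.sum_right blinfun.scaleR_right)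
    have gy: "blinfun_apply g y \<le> blinfun_apply g x + t * M" if y: "y \<in> cball 0 R" for y
    proof -
      define z where "z = (1 - t) *\<^sub>R x + t *\<^sub>R y"
      have "z \<in> cball 0 R" unfolding z_def using t x(1) y by (intro convexD_alt[OF convex_cball]) auto
      then have "I \<le> \<Psi> z" unfolding I_def by (rule cINF_lower[OF bdd])
      also have "\<Psi> z = (\<Sum>f\<in>J. ((blinfun_apply f x - blinfun_apply \<phi> f)\<^sup>2
          - 2 * t * ((blinfun_apply \<phi> f - blinfun_apply f x) * blinfun_apply f (y - x))) + t\<^sup>2 * (blinfun_apply f (y - x))\<^sup>2)"
        unfolding \<Psi>_def z_def
        by (intro sum.cong refl) (simp add: blinfun.add_right blinfun.scaleR_right blinfun.diff_right power2_eq_square algebra_simps)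
      also have "\<dots> = \<Psi> x - 2 * t * blinfun_apply g (y - x) + t\<^sup>2 * (\<Sum>f\<in>J. (blinfun_apply f (y - x))\<^sup>2)"
        unfolding \<Psi>_def g by (simp add: sum.distrib sum_subtractf sum_distrib_left)
      finally have 1: "I \<le> \<Psi> x - 2 * t * blinfun_apply g (y - x) + t\<^sup>2 * (\<Sum>f\<in>J. (blinfun_apply f (y - x))\<^sup>2)" .
      have 2: "(\<Sum>f\<in>J. (blinfun_apply f (y - x))\<^sup>2) \<le> Q"
        unfolding Q_def
      proof (rule sum_mono)
        fix f
        have "norm (y - x) \<le> 2 * R" using norm_triangle_ineq4[of y x] x(1) y by simp
        then have "\<bar>blinfun_apply f (y - x)\<bar> \<le> norm f * (2 * R)"
          using norm_blinfun[of f "y - x"] mult_left_mono[of "norm (y - x)" "2 * R" "norm f"] by simp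
        then show "(blinfun_apply f (y - x))\<^sup>2 \<le> (norm f * (2 * R))\<^sup>2" by (rule abs_le_square_iff[THEN iffD1, OF order_trans[OF _ abs_ge_self]])
      qed
      have "I \<le> \<Psi> x - 2 * t * blinfun_apply g (y - x) + t\<^sup>2 * Q"
        using 1 mult_left_mono[OF 2, of "t\<^sup>2"] by simp
      also have "Q = 2 * M - 1" by (simp add: M_def field_simps)
      finally have "I \<le> \<Psi> x - 2 * t * blinfun_apply g (y - x) + t\<^sup>2 * (2 * M - 1)" .
      then have "2 * t * blinfun_apply g (y - x) \<le> 2 * t * (t * M)" using x(2) by (simp add: power2_eq_square algebra_simps)
      then have "blinfun_apply g (y - x) \<le> t * M" using t by simp
      then show ?thesis by (simp add: blinfun.diff_right)
    qed
    define s where "s = blinfun_apply g x + t * M"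
    have s0: "0 \<le> s" using gy[of 0] R0 by (simp add: s_def blinfun.zero_right)
    \<comment> \<open>The supremum of \<open>g\<close> over the ball is \<open>R * norm g\<close>,
      which in turn bounds \<phi> at \<open>g\<close>; so \<phi> at \<open>g\<close> exceeds
      \<open>g x\<close> by at most \<open>t * M\<close>, whereas the difference is exactly
      \<open>\<Psi> x\<close>.\<close>
    have "R * norm g \<le> s"
    proof (cases "R = 0")
      case False
      then have Rp: "0 < R" using R0 by simp
      have "norm (blinfun_apply g y) \<le> s / R * norm y" for y
      proof (cases "y = 0")
        case False
        define y' where "y' = (R / norm y) *\<^sub>R y"
        have y': "y' \<in> cball 0 R" "- y' \<in> cball 0 R" using False Rp by (simp_all add: y'_def)
        have "\<bar>blinfun_apply g y'\<bar> \<le> s"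
          using gy[OF y'(1)] gy[OF y'(2)] by (simp add: s_def blinfun.minus_right abs_le_iff)
        then show ?thesis using False Rp by (simp add: y'_def blinfun.scaleR_right abs_mult field_simps)
      qed (simp add: blinfun.zero_right)
      then have "norm g \<le> s / R" using s0 Rp by (intro norm_blinfun_bound) auto
      then show ?thesis using Rp by (simp add: field_simps)
    qed (use s0 in simp)
    moreover have "blinfun_apply \<phi> g \<le> R * norm g" using norm_blinfun[of \<phi> g] by (simp add: R_def)
    ultimately have "blinfun_apply \<phi> g - blinfun_apply g x \<le> t * M" by (simp add: s_def)
    moreover have "blinfun_apply \<phi> g - blinfun_apply g x = \<Psi> x"
      unfolding \<phi>g g \<Psi>_def by (simp add: sum_subtractf[symmetric] right_diff_distrib[symmetric] power2_eq_square[symmetric] power2_commute)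
    ultimately show ?thesis using ge[OF x(1)] by simp
  qed
  note bound = this
  define t where "t = min 1 (e\<^sup>2 / (2 * M))"
  have t: "0 < t" "t \<le> 1" "t \<le> e\<^sup>2 / (2 * M)" unfolding t_def using e M by auto
  have "t * M \<le> e\<^sup>2 / 2" using mult_right_mono[OF t(3), of M] M by (simp add: field_simps)
  then have "e\<^sup>2 \<le> e\<^sup>2 / 2" using bound[OF t(1,2)] by linarith
  then show False using e by simp
qed

text \<open>\<phi> lies in the weak-star closure of the canonical image of \<open>S\<close> in the
  bidual.\<close>

definition weak_star_near :: "(('v::real_normed_vector \<Rightarrow>\<^sub>L real) \<Rightarrow>\<^sub>L real) \<Rightarrow> 'v set \<Rightarrow> bool" where
  "weak_star_near \<phi> S \<longleftrightarrow> (\<forall>J e. finite J \<and> 0 < e \<longrightarrow>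
     (\<exists>z\<in>S. \<forall>f\<in>J. \<bar>blinfun_apply f z - blinfun_apply \<phi> f\<bar> < e))"

lemma weak_star_near_nonempty: "weak_star_near \<phi> S \<Longrightarrow> S \<noteq> {}"
  unfolding weak_star_near_def by (metis empty_iff finite.emptyI zero_less_one)

text \<open>Take the roots of the highest trees over \<open>S\<close> that still accumulate at \<open>\<phi>\<close>: near \<open>\<phi>\<close>, two such roots
  cannot be separated, since they would be the children of a higher tree.\<close>

lemma weak_star_near_small:
  assumes near: "weak_star_near \<phi> S" and no_trees: "tree_roots norm \<theta> S n0 = {}"
  shows "\<exists>S'. weak_star_near \<phi> S' \<and> S' \<subseteq> convex hull S \<and> (\<forall>a\<in>S'. \<forall>b\<in>S'. norm (a - b) < \<theta>)"
proof -
  let ?T = "tree_roots norm \<theta> S"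
  have "\<exists>n. weak_star_near \<phi> (?T n) \<and> \<not> weak_star_near \<phi> (?T (Suc n))"
  proof (rule ccontr)
    assume *: "\<not> ?thesis"
    have "weak_star_near \<phi> (?T n)" for n by (induction n) (use near * in auto)
    then show False using weak_star_near_nonempty no_trees by blast
  qed
  then obtain n where n: "weak_star_near \<phi> (?T n)" "\<not> weak_star_near \<phi> (?T (Suc n))" by blast
  have "\<exists>J e. finite J \<and> 0 < e \<and> (\<forall>z\<in>U. \<exists>f\<in>J. \<not> \<bar>blinfun_apply f z - blinfun_apply \<phi> f\<bar> < e)"
    if "\<not> weak_star_near \<phi> U" for U
    using that unfolding weak_star_near_def by simp
  from this[OF n(2)] obtain J e where J: "finite J" "0 < e"
    "\<And>z. z \<in> ?T (Suc n) \<Longrightarrow> \<exists>f\<in>J. \<not> \<bar>blinfun_apply f z - blinfun_apply \<phi> f\<bar> < e"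
    by (elim exE conjE) simp
  define S' where "S' = {z \<in> ?T n. \<forall>f\<in>J. \<bar>blinfun_apply f z - blinfun_apply \<phi> f\<bar> < e}"
  have "weak_star_near \<phi> S'"
    unfolding weak_star_near_def
  proof (intro allI impI)
    fix J' :: "('a \<Rightarrow>\<^sub>L real) set" and e' :: real
    assume J': "finite J' \<and> 0 < e'"
    then obtain z where "z \<in> ?T n" "\<forall>f\<in>J \<union> J'. \<bar>blinfun_apply f z - blinfun_apply \<phi> f\<bar> < min e e'"
      using n(1)[unfolded weak_star_near_def, rule_format, of "J \<union> J'" "min e e'"] J(1,2) by auto
    then show "\<exists>z\<in>S'. \<forall>f\<in>J'. \<bar>blinfun_apply f z - blinfun_apply \<phi> f\<bar> < e'" by (auto simp: S'_def)
  qed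
  moreover have "S' \<subseteq> convex hull S" using tree_roots_convex[of norm \<theta> S n] by (auto simp: S'_def)
  moreover have "norm (a - b) < \<theta>" if a: "a \<in> S'" and b: "b \<in> S'" for a b
  proof (rule ccontr)
    assume "\<not> ?thesis"
    then have "\<theta> \<le> norm (a - b)" by simp
    moreover have "a \<in> ?T n" "b \<in> ?T n" using a b by (simp_all add: S'_def)
    ultimately have "(1 / 2) *\<^sub>R (a + b) \<in> ?T (Suc n)" unfolding tree_roots.simps by blast
    then obtain f where f: "f \<in> J" "e \<le> \<bar>blinfun_apply f ((1 / 2) *\<^sub>R (a + b)) - blinfun_apply \<phi> f\<bar>"
      using J(3) by (meson not_less)
    define A B where "A = blinfun_apply f a - blinfun_apply \<phi> f" and "B = blinfun_apply f b - blinfun_apply \<phi> f"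
    have "blinfun_apply f ((1 / 2) *\<^sub>R (a + b)) - blinfun_apply \<phi> f = (A + B) / 2"
      by (simp add: A_def B_def blinfun.add_right blinfun.scaleR_right field_simps)
    with f(2) have "2 * e \<le> \<bar>A + B\<bar>" by simp
    moreover have "\<bar>A\<bar> < e" "\<bar>B\<bar> < e" using a b f(1) by (auto simp: S'_def A_def B_def)
    ultimately show False by linarith
  qed
  ultimately show ?thesis by blast
qed

text \<open>Balls are convex, so first one point and then the other may be moved from
  \<open>S\<close> into its hull.\<close>

lemma norm_diff_convex_hull:
  assumes S: "\<And>a b. \<lbrakk>a \<in> S; b \<in> S\<rbrakk> \<Longrightarrow> norm (a - b) \<le> \<theta>"
    and ab: "a \<in> convex hull S" "b \<in> convex hull S"
  shows "norm (a - b) \<le> (\<theta> :: real)"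
proof -
  have 1: "norm (s - b) \<le> \<theta>" if s: "s \<in> S" for s
  proof -
    have "convex hull S \<subseteq> cball s \<theta>" by (rule hull_minimal) (use S s in \<open>auto simp: dist_norm\<close>)
    then show ?thesis using ab(2) by (auto simp: dist_norm)
  qed
  have "convex hull S \<subseteq> cball b \<theta>" by (rule hull_minimal) (use 1 in \<open>auto simp: dist_norm norm_minus_commute\<close>)
  then show ?thesis using ab(1) by (auto simp: dist_norm norm_minus_commute)
qed

text \<open>The nested sets converge in norm to a point representing \<open>\<phi>\<close>; the Hahn-Banach theorem is not needed.\<close>

lemma reflexive_if_no_trees:
  assumes no_trees: "\<And>\<theta> R. 0 < \<theta> \<Longrightarrow> \<exists>n. tree_roots norm \<theta> (cball (0::'v::banach) R) n = {}"
  shows "reflexive_space TYPE('v)"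
  unfolding reflexive_space_def
proof
  fix \<phi> :: "('v \<Rightarrow>\<^sub>L real) \<Rightarrow>\<^sub>L real"
  define R where "R = norm \<phi>"
  have start: "weak_star_near \<phi> (cball 0 R)"
    unfolding weak_star_near_def R_def using goldstine by blast
  let ?P = "\<lambda>k S. weak_star_near \<phi> S \<and> S \<subseteq> cball 0 R"
  \<comment> \<open>Since each set lies in the hull of its predecessor, a diameter bound once
    reached persists for all later sets.\<close>
  let ?Q = "\<lambda>k S S'. S' \<subseteq> convex hull S \<and> (\<forall>a\<in>S'. \<forall>b\<in>S'. norm (a - b) < inverse (real (Suc k)))"
  have "\<exists>X. \<forall>k. ?P k (X k) \<and> ?Q k (X k) (X (Suc k))"
  proof (rule dependent_nat_choice)
    show "\<exists>S. ?P 0 S" using start by blast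
    fix S k assume S: "?P k S"
    obtain n where n: "tree_roots norm (inverse (real (Suc k))) (cball (0::'v) R) n = {}" using no_trees[of "inverse (real (Suc k))" R] by auto
    have "tree_roots norm (inverse (real (Suc k))) S n = {}"
      using tree_roots_mono[of "inverse (real (Suc k))" norm "inverse (real (Suc k))" norm S "cball 0 R" n] S n by blast
    then obtain S' where S': "weak_star_near \<phi> S'" "?Q k S S'" using weak_star_near_small S by blast
    moreover have "convex hull S \<subseteq> cball 0 R" using S by (intro hull_minimal) auto
    ultimately show "\<exists>S'. ?P (Suc k) S' \<and> ?Q k S S'" by blast
  qed
  then obtain X where X: "\<And>k. weak_star_near \<phi> (X k)" "\<And>k. X (Suc k) \<subseteq> convex hull (X k)"
    "\<And>k a b. \<lbrakk>a \<in> X (Suc k); b \<in> X (Suc k)\<rbrakk> \<Longrightarrow> norm (a - b) < inverse (real (Suc k))" by blast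
  have "\<exists>y. y \<in> X (Suc k)" for k using weak_star_near_nonempty[OF X(1)] by blast
  then obtain z where z: "\<And>k. z k \<in> X (Suc k)" by metis
  have nested: "X j \<subseteq> convex hull X k" if "k \<le> j" for j k
    using that
  proof (induction rule: dec_induct)
    case (step j)
    have "X (Suc j) \<subseteq> convex hull X j" by (rule X(2))
    also have "\<dots> \<subseteq> convex hull X k" using hull_mono[OF step.IH, of convex] by (simp add: hull_hull)
    finally show ?case .
  qed (simp add: hull_subset)
  have zz: "norm (z j - z k) \<le> inverse (real (Suc k))" if "k \<le> j" for j k
  proof (rule norm_diff_convex_hull)
    show "norm (a - b) \<le> inverse (real (Suc k))" if "a \<in> X (Suc k)" "b \<in> X (Suc k)" for a b
      using X(3)[OF that] by simp
    show "z j \<in> convex hull X (Suc k)" using z[of j] nested[of "Suc k" "Suc j"] that by auto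
    show "z k \<in> convex hull X (Suc k)" using z[of k] nested[of "Suc k" "Suc k"] by auto
  qed
  have "Cauchy z"
  proof (rule CauchyI')
    fix e :: real assume "0 < e"
    then obtain K where K: "inverse (real (Suc K)) < e" using reals_Archimedean by blast
    show "\<exists>M. \<forall>k\<ge>M. \<forall>j>k. dist (z k) (z j) < e"
    proof (intro exI[of _ K] allI impI)
      fix k j assume kj: "K \<le> k" "k < j"
      have "inverse (real (Suc k)) \<le> inverse (real (Suc K))" using kj by (intro le_imp_inverse_le) auto
      then have "norm (z j - z k) < e" using zz[of k j] kj K by linarith
      then show "dist (z k) (z j) < e" by (simp add: dist_norm norm_minus_commute)
    qed
  qed
  then obtain v where v: "z \<longlonglongrightarrow> v" using Cauchy_convergent convergent_def by blast
  have "blinfun_apply \<phi> f = blinfun_apply f v" for f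
  proof (rule LIMSEQ_unique)
    show "(\<lambda>k. blinfun_apply f (z k)) \<longlonglongrightarrow> blinfun_apply f v" by (intro tendsto_intros v)
    have le: "norm (blinfun_apply f (z k) - blinfun_apply \<phi> f) \<le> (norm f + 1) * inverse (real (Suc k))" for k
    proof -
      \<comment> \<open>The point close to \<phi> depends on \<open>f\<close>, while
        \<open>z k\<close> does not; the small diameter passes the estimate from one to the
        other.\<close>
      obtain y where y: "y \<in> X (Suc k)" "\<bar>blinfun_apply f y - blinfun_apply \<phi> f\<bar> < inverse (real (Suc k))"
        using X(1)[of "Suc k", unfolded weak_star_near_def, rule_format, of "{f}" "inverse (real (Suc k))"] by auto
      have "norm (blinfun_apply f (z k - y)) \<le> norm f * norm (z k - y)" by (rule norm_blinfun)
      also have "\<dots> \<le> norm f * inverse (real (Suc k))" using X(3)[OF z y(1)] by (intro mult_left_mono) auto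
      finally have "\<bar>blinfun_apply f (z k) - blinfun_apply f y\<bar> \<le> norm f * inverse (real (Suc k))" by (simp add: blinfun.diff_right)
      then have "\<bar>blinfun_apply f (z k) - blinfun_apply \<phi> f\<bar> \<le> norm f * inverse (real (Suc k)) + inverse (real (Suc k))"
        using y(2) by linarith
      then show ?thesis by (simp only: distrib_right mult_1 real_norm_def)
    qed
    have "(\<lambda>k. (norm f + 1) * inverse (real (Suc k))) \<longlonglongrightarrow> 0"
      using tendsto_mult_left[OF LIMSEQ_inverse_real_of_nat, of "norm f + 1"] by simp
    then have "(\<lambda>k. blinfun_apply f (z k) - blinfun_apply \<phi> f) \<longlonglongrightarrow> 0"
      by (rule Lim_null_comparison[OF always_eventually, rotated, OF _ allI]) (rule le)
    then show "(\<lambda>k. blinfun_apply f (z k)) \<longlonglongrightarrow> blinfun_apply \<phi> f" by (simp add: LIM_zero_iff)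
  qed
  then show "\<exists>v. \<forall>f. blinfun_apply \<phi> f = blinfun_apply f v" by blast
qed

section \<open>Super-reflexivity\<close>

text \<open>Embeddings of distortion 2 are good enough: they do not decrease distances and at most
  double the radius.\<close>

lemma finitely_representable_no_trees:
  assumes fr: "finitely_representable TYPE('w::banach) TYPE('v::banach)"
    and empty: "tree_roots norm \<theta> (cball (0::'v) (2 * R)) n = {}"
  shows "tree_roots norm \<theta> (cball (0::'w) R) n = {}"
proof (rule ccontr)
  assume "\<not> ?thesis"
  then obtain z where z: "z \<in> tree_roots norm \<theta> (cball (0::'w) R) n" by blast
  obtain B where B: "finite B" "B \<subseteq> cball 0 R" "z \<in> tree_roots norm \<theta> B n"
    using tree_roots_finite[OF z] by (elim exE conjE)
  obtain T :: "'w \<Rightarrow> 'v" where T: "linear T" "\<And>y. y \<in> span B \<Longrightarrow> norm y \<le> norm (T y) \<and> norm (T y) \<le> (1 + 1) * norm y"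
    using fr[unfolded finitely_representable_def, rule_format, OF zero_less_one B(1)] by blast
  have "T z \<in> tree_roots norm \<theta> (T ` B) n" by (rule tree_roots_linear[OF T(1) _ B(3)]) (use T(2) in blast)
  moreover have "T ` B \<subseteq> cball 0 (2 * R)"
  proof
    fix y assume "y \<in> T ` B"
    then obtain x where "x \<in> B" "y = T x" by blast
    then show "y \<in> cball 0 (2 * R)" using T(2)[of x] B(2) span_base[of x B] by fastforce
  qed
  ultimately have "T z \<in> tree_roots norm \<theta> (cball (0::'v) (2 * R)) n"
    using tree_roots_mono[of \<theta> norm \<theta> norm "T ` B" "cball 0 (2 * R)" n] by blast
  then show False using empty by blast
qed

text \<open>Trees with separation \<theta> in \<open>norm\<close> have separation
  \<open>\<theta> / C\<close> in \<open>nrm'\<close>, so the bound on heights passes from the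
  uniformly convex norm to the given one, and from there to finitely representable spaces.\<close>

lemma super_reflexive_if_uniformly_convex:
  fixes nrm' :: "'v::banach \<Rightarrow> real"
  assumes uc: "uniformly_convex nrm'"
    and nn: "\<And>v. 0 \<le> nrm' v" and diff: "\<And>v w. nrm' (v - w) \<le> nrm' v + nrm' w"
    and C: "0 < C" "\<And>v. norm v \<le> C * nrm' v" "\<And>v. nrm' v \<le> C * norm v"
  shows "reflexive_space TYPE('v)"
    and "finitely_representable TYPE('w::banach) TYPE('v) \<Longrightarrow> reflexive_space TYPE('w)"
proof -
  have no_trees: "\<exists>n. tree_roots norm \<theta> (cball (0::'v) R) n = {}" if \<theta>: "0 < \<theta>" for \<theta> R
  proof -
    have "\<exists>n. tree_roots nrm' (\<theta> / C) (cball (0::'v) R) n = {}"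
    proof (rule uniformly_convex_no_trees[OF uc nn diff])
      show "0 < \<theta> / C" using \<theta> C(1) by simp
      show "nrm' v \<le> C * R" if "v \<in> cball 0 R" for v
      proof -
        have "C * norm v \<le> C * R" using that C(1) by (intro mult_left_mono) auto
        then show ?thesis using C(3)[of v] by linarith
      qed
    qed
    moreover have "\<theta> / C \<le> nrm' x" if "\<theta> \<le> norm x" for x
      using C(2)[of x] that C(1) by (simp add: field_simps)
    ultimately show ?thesis using tree_roots_mono[of \<theta> norm "\<theta> / C" nrm' "cball 0 R" "cball 0 R"] by blast
  qed
  show "reflexive_space TYPE('v)" using no_trees by (rule reflexive_if_no_trees)
  show "reflexive_space TYPE('w)" if fr: "finitely_representable TYPE('w) TYPE('v)"
  proof (rule reflexive_if_no_trees)
    fix \<theta> R :: real assume "0 < \<theta>"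
    then obtain n where "tree_roots norm \<theta> (cball (0::'v) (2 * R)) n = {}" using no_trees by blast
    then show "\<exists>n. tree_roots norm \<theta> (cball (0::'w) R) n = {}" using finitely_representable_no_trees[OF fr] by blast
  qed
qed

theorem theorem1p5:
  fixes m :: "'a::complete_space measure"
    and p :: ennreal
    and act :: "('a \<Rightarrow> real) \<Rightarrow> 'v::banach \<Rightarrow> 'v"
    and pn :: "'v \<Rightarrow> 'a \<Rightarrow> real"
    and E :: "nat \<Rightarrow> 'a set"
    and Einf :: "'a set"
  assumes "Radon_measure m"
    and "1 \<le> p"
    and "Lp_normed_module p m norm act pn"
    and "dimensional_decomposition m act pn E Einf"
  shows "\<exists>F T.
    (\<forall>n. F n \<in> restrict_space m (E n) \<rightarrow>\<^sub>M Norms_borel n) \<and>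
    Lp_product_isometry p m act pn E F T \<and>
    (\<forall>N. (\<forall>n>N. emeasure m (E n) = 0) \<longrightarrow>
      (\<exists>F' nrm' pn' C.
        (\<forall>n. F' n \<in> restrict_space m (E n) \<rightarrow>\<^sub>M Norms_borel n) \<and>
        (\<forall>n. AE x in m. x \<in> E n \<longrightarrow> norm_from_scalar_product n (F' n x)) \<and>
        0 < C \<and>
        (\<forall>n. AE x in m. x \<in> E n \<longrightarrow>
          (\<forall>a \<in> Rn n. F n x a \<le> C * F' n x a \<and> F' n x a \<le> C * F n x a)) \<and>
        Lp_normed_module p m nrm' act pn' \<and>
        Lp_product_isometry p m act pn' E F' T \<and>
        (\<forall>v. AE x in m. pn v x \<le> C * pn' v x \<and> pn' v x \<le> C * pn v x) \<and>
        (\<forall>v. norm v \<le> C * nrm' v \<and> nrm' v \<le> C * norm v)) \<and>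
      (1 < p \<and> p < \<infinity> \<longrightarrow>
        reflexive_space TYPE('v) \<and>
        (finitely_representable TYPE('w::banach) TYPE('v) \<longrightarrow> reflexive_space TYPE('w))))"
proof -
  have dec: "decomposed_module p m norm act pn E Einf"
    by (intro decomposed_module.intro premodule_ge_1.intro premodule_ge_1_axioms.intro decomposed_module_axioms.intro
        assms Lp_normed_module.axioms(1)[OF assms(3)])
  obtain b F where frame: "\<And>n. coordinate_frame p m norm act pn (E n) n (b n) (F n)"
    and spanning: "\<And>n v. AE x in m. x \<in> E n \<longrightarrow> x \<in> premodule_ge_1.near_span m pn n (b n) v"
    using decomposed_module.frames_exist[OF dec] by blast
  interpret framed_module p m norm act pn E Einf b F
    by (intro framed_module.intro framed_module_axioms.intro dec frame spanning)
  \<comment> \<open>Neither \<open>F\<close> nor \<open>coordinates\<close> depends on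
    \<open>N\<close>, so the consequences of a dimension bound are derived for each \<open>N\<close>
    with the same isometry.\<close>
  have reduction: "(\<exists>F' nrm' pn' C.
        (\<forall>n. F' n \<in> restrict_space m (E n) \<rightarrow>\<^sub>M Norms_borel n) \<and>
        (\<forall>n. AE x in m. x \<in> E n \<longrightarrow> norm_from_scalar_product n (F' n x)) \<and>
        0 < C \<and>
        (\<forall>n. AE x in m. x \<in> E n \<longrightarrow>
          (\<forall>a \<in> Rn n. F n x a \<le> C * F' n x a \<and> F' n x a \<le> C * F n x a)) \<and>
        Lp_normed_module p m nrm' act pn' \<and>
        Lp_product_isometry p m act pn' E F' coordinates \<and>
        (\<forall>v. AE x in m. pn v x \<le> C * pn' v x \<and> pn' v x \<le> C * pn v x) \<and>
        (\<forall>v. norm v \<le> C * nrm' v \<and> nrm' v \<le> C * norm v)) \<and>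
      (1 < p \<and> p < \<infinity> \<longrightarrow>
        reflexive_space TYPE('v) \<and>
        (finitely_representable TYPE('w) TYPE('v) \<longrightarrow> reflexive_space TYPE('w)))"
    if "\<forall>n>N. emeasure m (E n) = 0" for N
  proof (intro conjI impI)
    interpret bounded_module p m norm act pn E Einf b F N
      by (intro bounded_module.intro bounded_module_axioms.intro framed_module_axioms) (use that in blast)
    have "AE x in m. pn v x \<le> C * pn' v x \<and> pn' v x \<le> C * pn v x" for v
      using pn'_equivalent[of v] by eventually_elim simp
    then show "\<exists>F' nrm' pn' C.
        (\<forall>n. F' n \<in> restrict_space m (E n) \<rightarrow>\<^sub>M Norms_borel n) \<and>
        (\<forall>n. AE x in m. x \<in> E n \<longrightarrow> norm_from_scalar_product n (F' n x)) \<and>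
        0 < C \<and>
        (\<forall>n. AE x in m. x \<in> E n \<longrightarrow>
          (\<forall>a \<in> Rn n. F n x a \<le> C * F' n x a \<and> F' n x a \<le> C * F n x a)) \<and>
        Lp_normed_module p m nrm' act pn' \<and>
        Lp_product_isometry p m act pn' E F' coordinates \<and>
        (\<forall>v. AE x in m. pn v x \<le> C * pn' v x \<and> pn' v x \<le> C * pn v x) \<and>
        (\<forall>v. norm v \<le> C * nrm' v \<and> nrm' v \<le> C * norm v)"
      using eu.F_Norms_borel F'_scalar_product C_pos F'_equivalent module' isometry' nrm'_equivalent
      by (intro exI[of _ F'] exI[of _ nrm'] exI[of _ pn'] exI[of _ C] conjI allI) (auto intro!: AE_I2)
    assume "1 < p \<and> p < \<infinity>"
    then have uc: "uniformly_convex nrm'" by (intro uniformly_convex_nrm') auto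
    have nn: "0 \<le> nrm' v" for v by (simp add: nrm'_def Lp_norm_nonneg)
    have diff: "nrm' (v - w) \<le> nrm' v + nrm' w" for v w
      using nrm'_triangle[of v "- w"] nrm'_scale[of "- 1" w] by simp
    note super = super_reflexive_if_uniformly_convex[OF uc nn diff C_pos nrm'_equivalent]
    show "reflexive_space TYPE('v)" by (rule super(1))
    show "reflexive_space TYPE('w)" if "finitely_representable TYPE('w) TYPE('v)"
      using that by (rule super(2))
  qed
  show ?thesis
    by (rule exI[of _ F], rule exI[of _ coordinates])
      (rule conjI[OF allI[OF F_Norms_borel] conjI[OF coordinates_isometry allI[OF impI[OF reduction]]]])
qed

end
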